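(* Let $R(u)=\frac12\|u\|_{L^2(\mathbb{T}^d)}^2$. Assume that $\{\lambda_j\}_{j=1}^\infty$ are the eigenvalues of $KK^*:L^2(\mathbb{T}^d)\to L^2(\mathbb{T}^d)$ and that there exists $0<m\le1$ such that $$\sum_{j=1}^\infty\lambda_j^m<\infty.$$ When the true unknown $u^\dagger$ fulfills the exact source condition $\mu^\dagger=K^*w^\dagger$ with $w^\dagger\in L^2(\mathbb{T}^d)$, where $\mu^\dagger=u^\dagger\in\partial R(u^\dagger)$, it follows that for $\alpha\simeq\delta^\kappa$ with $\kappa=\frac{2}{2+m}$, $$E_B(U_\alpha^\delta,u^\dagger)=\mathbb{E}\,\|U_\alpha^\delta-u^\dagger\|_{L^2(\mathbb{T}^d)}^2\lesssim\delta^{\frac{2}{2+m}}.$$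
   Context: $X=Y=L^2(\mathbb{T}^d)$ on the $d$-dimensional torus, and $K:L^2(\mathbb{T}^d)\to H^t(\mathbb{T}^d)$ is a bounded linear operator for some $t>d/2$. $N$ is Gaussian white noise on $\mathbb{T}^d$: a centered Gaussian random variable in $\mathcal{D}'(\mathbb{T}^d)$ on a complete probability space with $\mathbb{E}\langle N,\phi\rangle\langle N,\psi\rangle=\langle\phi,\psi\rangle$ for all $\phi,\psi\in C^\infty(\mathbb{T}^d)$; its realizations lie almost surely in $H^{-d/2-\epsilon}(\mathbb{T}^d)$ for every $\epsilon>0$. The data are $F^\delta=Ku^\dagger+\delta N$, $\delta>0$, with deterministic $u^\dagger$. The estimator $U_\alpha^\delta$ is, realization-wise, the minimizer over $u\in L^2(\mathbb{T}^d)$ of $$\tfrac12\|Ku\|_{L^2}^2-\langle Ku,F^\delta\rangle_{H^t\times H^{-t}}+\alpha R(u).$$ $K^*$ is the adjoint of $K$ (with respect to $L^2$, extended to $H^{-t}(\mathbb{T}^d)\to L^2(\mathbb{T}^d)$). The risk is $E_B(U_\alpha^\delta,u^\dagger)=\mathbb{E}\,D_R^{\mu_\alpha^\delta,\mu^\dagger}(U_\alpha^\delta,u^\dagger)$, where $D_R^{\mu_u,\mu_v}(u,v)=\langle\mu_u-\mu_v,u-v\rangle$ is the symmetric Bregman distance, here equal to $\|u-v\|_{L^2}^2$. $a\simeq b$ means mutual boundedness by constant multiples and $a\lesssim b$ means $a\le Cb$, with constants independent of $\delta$, as $\delta\to0$. *)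

theory Defs
  imports "HOL-Probability.Probability" "HOL-Library.Landau_Symbols"
begin

section \<open>The Hilbert space of square integrable functions on the torus\<close>

text \<open>
  The torus is the quotient of \<^typ>\<open>real^'d\<close> by the integer lattice, so its dimension
  is \<open>d = CARD('d)\<close>.  Its (normalised) measure is Lebesgue measure on the unit cube, and its
  \<open>L\<^sup>2\<close> space consists of the real square integrable functions on the cube modulo
  equality almost everywhere; the values of a representative outside the cube play no role.
\<close>

abbreviation torus :: "(real^'d) measure"
  where "torus \<equiv> lebesgue_on (cbox 0 1)"

definition L2_fun :: "(real^'d \<Rightarrow> real) \<Rightarrow> bool"
  where "L2_fun f \<longleftrightarrow> f \<in> borel_measurable torus \<and> integrable torus (\<lambda>x. (f x)\<^sup>2)"

definition L2_eq :: "(real^'d \<Rightarrow> real) \<Rightarrow> (real^'d \<Rightarrow> real) \<Rightarrow> bool"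
  where "L2_eq f g \<longleftrightarrow> L2_fun f \<and> L2_fun g \<and> (AE x in torus. f x = g x)"

lemma L2_fun_zero: "L2_fun (\<lambda>x. 0)"
  by (simp add: L2_fun_def)

lemma L2_fun_prod_integrable:
  assumes "L2_fun f" "L2_fun g"
  shows "integrable torus (\<lambda>x. f x * g x)"
proof (rule Bochner_Integration.integrable_bound)
  show "integrable torus (\<lambda>x. (f x)\<^sup>2 + (g x)\<^sup>2)"
    using assms by (auto simp: L2_fun_def)
  show "(\<lambda>x. f x * g x) \<in> borel_measurable torus"
    using assms by (auto simp: L2_fun_def)
  have "\<bar>a * b\<bar> \<le> a\<^sup>2 + b\<^sup>2" for a b :: real
  proof -
    have "0 \<le> (\<bar>a\<bar> - \<bar>b\<bar>)\<^sup>2" by simp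
    then have "2 * (\<bar>a\<bar> * \<bar>b\<bar>) \<le> a\<^sup>2 + b\<^sup>2" by (simp add: power2_diff)
    moreover have "0 \<le> \<bar>a\<bar> * \<bar>b\<bar>" by simp
    ultimately show ?thesis unfolding abs_mult by linarith
  qed
  then show "AE x in torus. norm (f x * g x) \<le> norm ((f x)\<^sup>2 + (g x)\<^sup>2)"
    by (intro AE_I2) (simp add: abs_of_nonneg)
qed

lemma L2_fun_add: "L2_fun f \<Longrightarrow> L2_fun g \<Longrightarrow> L2_fun (\<lambda>x. f x + g x)"
  using L2_fun_prod_integrable[of f g]
  by (auto simp: L2_fun_def power2_sum mult.assoc)

lemma L2_fun_scale: "L2_fun f \<Longrightarrow> L2_fun (\<lambda>x. c * f x)"
  by (auto simp: L2_fun_def power_mult_distrib)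

lemma L2_fun_uminus: "L2_fun f \<Longrightarrow> L2_fun (\<lambda>x. - f x)"
  using L2_fun_scale[of f "-1"] by simp

lemma L2_fun_diff: "L2_fun f \<Longrightarrow> L2_fun g \<Longrightarrow> L2_fun (\<lambda>x. f x - g x)"
  using L2_fun_add[of f "\<lambda>x. - g x"] L2_fun_uminus[of g] by simp

quotient_type (overloaded) 'd torus_L2 = "real^'d \<Rightarrow> real" / partial: L2_eq
proof (rule part_equivpI)
  show "\<exists>f::real^'d \<Rightarrow> real. L2_eq f f"
    using L2_fun_zero by (auto simp: L2_eq_def)
  show "symp (L2_eq :: (real^'d \<Rightarrow> real) \<Rightarrow> _)"
    by (rule sympI) (auto simp: L2_eq_def elim: AE_mp)
  show "transp (L2_eq :: (real^'d \<Rightarrow> real) \<Rightarrow> _)"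
    by (rule transpI) (unfold L2_eq_def, auto)
qed

instantiation torus_L2 :: (finite) real_inner
begin

lift_definition zero_torus_L2 :: "'a torus_L2" is "\<lambda>x. 0"
  by (simp add: L2_eq_def L2_fun_zero)

lift_definition plus_torus_L2 :: "'a torus_L2 \<Rightarrow> 'a torus_L2 \<Rightarrow> 'a torus_L2"
  is "\<lambda>f g x. f x + g x"
  unfolding L2_eq_def by (auto intro: L2_fun_add)

lift_definition minus_torus_L2 :: "'a torus_L2 \<Rightarrow> 'a torus_L2 \<Rightarrow> 'a torus_L2"
  is "\<lambda>f g x. f x - g x"
  unfolding L2_eq_def by (auto intro: L2_fun_diff)

lift_definition uminus_torus_L2 :: "'a torus_L2 \<Rightarrow> 'a torus_L2"
  is "\<lambda>f x. - f x"
  unfolding L2_eq_def by (auto intro: L2_fun_uminus)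

lift_definition scaleR_torus_L2 :: "real \<Rightarrow> 'a torus_L2 \<Rightarrow> 'a torus_L2"
  is "\<lambda>c f x. c * f x"
  unfolding L2_eq_def by (auto intro: L2_fun_scale)

lift_definition inner_torus_L2 :: "'a torus_L2 \<Rightarrow> 'a torus_L2 \<Rightarrow> real"
  is "\<lambda>f g. LINT x|torus. f x * g x"
proof -
  fix f f' g g' :: "real^'a \<Rightarrow> real"
  assume *: "L2_eq f f'" "L2_eq g g'"
  show "(LINT x|torus. f x * g x) = (LINT x|torus. f' x * g' x)"
  proof (rule integral_cong_AE)
    show "AE x in torus. f x * g x = f' x * g' x"
      using * unfolding L2_eq_def by auto
  qed (use * L2_fun_prod_integrable in \<open>auto simp: L2_eq_def\<close>)
qed

definition norm_torus_L2 :: "'a torus_L2 \<Rightarrow> real"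
  where "norm_torus_L2 u = sqrt (inner u u)"

definition dist_torus_L2 :: "'a torus_L2 \<Rightarrow> 'a torus_L2 \<Rightarrow> real"
  where "dist_torus_L2 u v = norm (u - v)"

definition sgn_torus_L2 :: "'a torus_L2 \<Rightarrow> 'a torus_L2"
  where "sgn_torus_L2 u = scaleR (inverse (norm u)) u"

definition uniformity_torus_L2 :: "('a torus_L2 \<times> 'a torus_L2) filter"
  where "uniformity_torus_L2 = (INF e\<in>{0<..}. principal {(u, v). dist u v < e})"

definition open_torus_L2 :: "'a torus_L2 set \<Rightarrow> bool"
  where "open_torus_L2 S \<longleftrightarrow>
    (\<forall>u\<in>S. \<forall>\<^sub>F (u', v) in uniformity. u' = u \<longrightarrow> v \<in> S)"

instance
proof
  fix u v w :: "'a torus_L2" and a b :: real and S :: "'a torus_L2 set"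
  show "u + v + w = u + (v + w)"
    by transfer (auto simp: L2_eq_def add.assoc intro!: L2_fun_add)
  show "u + v = v + u"
    by transfer (auto simp: L2_eq_def add.commute intro!: L2_fun_add)
  show "0 + u = u"
    by transfer (auto simp: L2_eq_def)
  show "- u + u = 0"
    by transfer (auto simp: L2_eq_def L2_fun_zero)
  show "u - v = u + - v"
    by transfer (auto simp: L2_eq_def intro!: L2_fun_diff)
  show "a *\<^sub>R (u + v) = a *\<^sub>R u + a *\<^sub>R v"
    by transfer (auto simp: L2_eq_def distrib_left intro!: L2_fun_add L2_fun_scale)
  show "(a + b) *\<^sub>R u = a *\<^sub>R u + b *\<^sub>R u"
    by transfer (auto simp: L2_eq_def distrib_right intro!: L2_fun_add L2_fun_scale)
  show "a *\<^sub>R b *\<^sub>R u = (a * b) *\<^sub>R u"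
    by transfer (auto simp: L2_eq_def mult.assoc intro!: L2_fun_scale)
  show "1 *\<^sub>R u = u"
    by transfer (auto simp: L2_eq_def)
  show "inner u v = inner v u"
    by transfer (simp add: mult.commute)
  show "inner (u + v) w = inner u w + inner v w"
    by transfer (auto simp: L2_eq_def distrib_right L2_fun_prod_integrable)
  show "inner (a *\<^sub>R u) v = a * inner u v"
    by transfer (simp add: mult.assoc)
  show "0 \<le> inner u u"
    by transfer simp
  show "inner u u = 0 \<longleftrightarrow> u = 0"
  proof transfer
    fix f :: "real^'a \<Rightarrow> real"
    assume f: "L2_eq f f"
    then have "integrable torus (\<lambda>x. f x * f x)"
      by (simp add: L2_eq_def L2_fun_prod_integrable)
    then have "(LINT x|torus. f x * f x) = 0 \<longleftrightarrow> (AE x in torus. f x * f x = 0)"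
      by (intro integral_nonneg_eq_0_iff_AE) auto
    then show "(LINT x|torus. f x * f x) = 0 \<longleftrightarrow> L2_eq f (\<lambda>x. 0)"
      using f by (simp add: L2_eq_def L2_fun_zero)
  qed
  show "norm u = sqrt (inner u u)"
    by (rule norm_torus_L2_def)
  show "dist u v = norm (u - v)"
    by (rule dist_torus_L2_def)
  show "sgn u = scaleR (inverse (norm u)) u"
    by (rule sgn_torus_L2_def)
  show "(uniformity :: ('a torus_L2 \<times> 'a torus_L2) filter) =
      (INF e\<in>{0<..}. principal {(u, v). dist u v < e})"
    by (rule uniformity_torus_L2_def)
  show "open S \<longleftrightarrow> (\<forall>u\<in>S. \<forall>\<^sub>F (u', v) in uniformity. u' = u \<longrightarrow> v \<in> S)"
    by (rule open_torus_L2_def)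
qed

end

section \<open>Test functions and distributions\<close>

primrec iter_pderiv :: "'d list \<Rightarrow> (real^'d \<Rightarrow> real) \<Rightarrow> real^'d \<Rightarrow> real"
  where
    "iter_pderiv [] f = f"
  | "iter_pderiv (j # js) f = (\<lambda>x. frechet_derivative (iter_pderiv js f) (at x) (axis j 1))"

text \<open>Smooth functions on the torus are smooth functions of \<^typ>\<open>real^'d\<close> with period 1 in
  every coordinate.\<close>

definition torus_smooth :: "(real^'d \<Rightarrow> real) set"
  where "torus_smooth = {f. (\<forall>x j. f (x + axis j 1) = f x) \<and>
    (\<forall>js x. iter_pderiv js f differentiable at x)}"

definition C_norm :: "nat \<Rightarrow> (real^'d \<Rightarrow> real) \<Rightarrow> real"
  where "C_norm n f = (\<Sum>js | length js \<le> n. SUP x. \<bar>iter_pderiv js f x\<bar>)"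

text \<open>Continuity with respect to the Frechet topology given by the seminorms \<^const>\<open>C_norm\<close>
  amounts to a bound by one of them.  The values of a distribution outside
  \<^const>\<open>torus_smooth\<close> are irrelevant.\<close>

definition torus_distributions :: "((real^'d \<Rightarrow> real) \<Rightarrow> real) set"
  where "torus_distributions = {F.
    (\<forall>\<phi>\<in>torus_smooth. \<forall>\<psi>\<in>torus_smooth. F (\<lambda>x. \<phi> x + \<psi> x) = F \<phi> + F \<psi>) \<and>
    (\<forall>c. \<forall>\<phi>\<in>torus_smooth. F (\<lambda>x. c * \<phi> x) = c * F \<phi>) \<and>
    (\<exists>C n. \<forall>\<phi>\<in>torus_smooth. \<bar>F \<phi>\<bar> \<le> C * C_norm n \<phi>)}"

text \<open>The embedding of \<open>L\<^sup>2\<close> into the distributions: \<^const>\<open>abs_torus_L2\<close> sends a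
  square integrable function to its class.\<close>

definition L2_distr :: "'d torus_L2 \<Rightarrow> (real^'d \<Rightarrow> real) \<Rightarrow> real"
  where "L2_distr u = (\<lambda>\<phi>. inner u (abs_torus_L2 \<phi>))"

section \<open>Sobolev spaces of arbitrary real order\<close>

definition freq_phase :: "int^'d \<Rightarrow> real^'d \<Rightarrow> real"
  where "freq_phase k x = 2 * pi * (\<Sum>j\<in>UNIV. of_int (k $ j) * x $ j)"

definition fourier_coeff :: "((real^'d \<Rightarrow> real) \<Rightarrow> real) \<Rightarrow> int^'d \<Rightarrow> complex"
  where "fourier_coeff F k =
    Complex (F (\<lambda>x. cos (freq_phase k x))) (- F (\<lambda>x. sin (freq_phase k x)))"

definition sobolev_weight :: "real \<Rightarrow> int^'d \<Rightarrow> real"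
  where "sobolev_weight s k = (1 + (\<Sum>j\<in>UNIV. (of_int (k $ j))\<^sup>2)) powr s"

definition sobolev :: "real \<Rightarrow> ((real^'d \<Rightarrow> real) \<Rightarrow> real) set"
  where "sobolev s = {F \<in> torus_distributions.
    (\<lambda>k. sobolev_weight s k * (cmod (fourier_coeff F k))\<^sup>2) summable_on UNIV}"

definition sobolev_norm :: "real \<Rightarrow> ((real^'d \<Rightarrow> real) \<Rightarrow> real) \<Rightarrow> real"
  where "sobolev_norm s F =
    sqrt (\<Sum>\<^sub>\<infinity>k. sobolev_weight s k * (cmod (fourier_coeff F k))\<^sup>2)"

text \<open>The pairing of \<open>G \<in> H\<^sup>t\<close> with \<open>F \<in> H\<^bsup>-t\<^esup>\<close>, for every \<open>t\<close>.  It is the continuous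
  extension of the pairing \<open>F \<phi>\<close> of distributions with (embedded) test functions.  The sum
  converges absolutely and is real for real \<open>G\<close> and \<open>F\<close>.\<close>

definition sobolev_pairing ::
    "((real^'d \<Rightarrow> real) \<Rightarrow> real) \<Rightarrow> ((real^'d \<Rightarrow> real) \<Rightarrow> real) \<Rightarrow> real"
  where "sobolev_pairing G F = Re (\<Sum>\<^sub>\<infinity>k. fourier_coeff G k * cnj (fourier_coeff F k))"

text \<open>A bounded linear operator from \<open>L\<^sup>2\<close> to \<open>H\<^sup>t\<close>, \<open>t \<ge> 0\<close>, is given as a map into \<open>L\<^sup>2\<close>
  (which contains \<open>H\<^sup>t\<close>) with values in \<open>H\<^sup>t\<close>.\<close>

definition bounded_linear_sobolev :: "real \<Rightarrow> ('d::finite torus_L2 \<Rightarrow> 'd torus_L2) \<Rightarrow> bool"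
  where "bounded_linear_sobolev t K \<longleftrightarrow>
    linear K \<and> (\<forall>u. L2_distr (K u) \<in> sobolev t) \<and>
    (\<exists>C. \<forall>u. sobolev_norm t (L2_distr (K u)) \<le> C * norm u)"

section \<open>Gaussian white noise\<close>

text \<open>Centered Gaussian laws include the point mass at 0.\<close>

definition centered_gaussian :: "'w measure \<Rightarrow> ('w \<Rightarrow> real) \<Rightarrow> bool"
  where "centered_gaussian M X \<longleftrightarrow> X \<in> borel_measurable M \<and>
    ((AE \<omega> in M. X \<omega> = 0) \<or>
     (\<exists>\<sigma>>0. distributed M lborel X (\<lambda>x. ennreal (normal_density 0 \<sigma> x))))"

definition gaussian_white_noise ::
    "'w measure \<Rightarrow> ('w \<Rightarrow> (real^'d \<Rightarrow> real) \<Rightarrow> real) \<Rightarrow> bool"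
  where "gaussian_white_noise M N \<longleftrightarrow>
    (\<forall>\<omega>\<in>space M. N \<omega> \<in> torus_distributions) \<and>
    (\<forall>\<phi>\<in>torus_smooth. centered_gaussian M (\<lambda>\<omega>. N \<omega> \<phi>)) \<and>
    (\<forall>\<phi>\<in>torus_smooth. \<forall>\<psi>\<in>torus_smooth.
      (LINT \<omega>|M. N \<omega> \<phi> * N \<omega> \<psi>) = (LINT x|torus. \<phi> x * \<psi> x))"

section \<open>Variational regularization\<close>

definition noisy_data ::
    "('d torus_L2 \<Rightarrow> 'd torus_L2) \<Rightarrow> 'd torus_L2 \<Rightarrow> real \<Rightarrow> ((real^'d \<Rightarrow> real) \<Rightarrow> real) \<Rightarrow>
      (real^'d \<Rightarrow> real) \<Rightarrow> real"
  where "noisy_data K u \<delta> n = (\<lambda>\<phi>. L2_distr (K u) \<phi> + \<delta> * n \<phi>)"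

definition variational_functional ::
    "('d torus_L2 \<Rightarrow> 'd torus_L2) \<Rightarrow> ('d torus_L2 \<Rightarrow> real) \<Rightarrow> real \<Rightarrow>
      ((real^'d \<Rightarrow> real) \<Rightarrow> real) \<Rightarrow> 'd torus_L2 \<Rightarrow> real"
  where "variational_functional K R \<alpha> F u =
    1/2 * (norm (K u))\<^sup>2 - sobolev_pairing (L2_distr (K u)) F + \<alpha> * R u"

definition quadratic_penalty :: "'d::finite torus_L2 \<Rightarrow> real"
  where "quadratic_penalty u = 1/2 * (norm u)\<^sup>2"

definition subdifferential :: "('a::real_inner \<Rightarrow> real) \<Rightarrow> 'a \<Rightarrow> 'a set"
  where "subdifferential R u = {\<mu>. \<forall>v. R v \<ge> R u + inner \<mu> (v - u)}"

definition sym_bregman :: "'a::real_inner \<Rightarrow> 'a \<Rightarrow> 'a \<Rightarrow> 'a \<Rightarrow> real"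
  where "sym_bregman \<mu>u \<mu>v u v = inner (\<mu>u - \<mu>v) (u - v)"

section \<open>Eigenvalues with multiplicity\<close>

definition eigenspace :: "('a::real_vector \<Rightarrow> 'a) \<Rightarrow> real \<Rightarrow> 'a set"
  where "eigenspace A \<mu> = {f. A f = \<mu> *\<^sub>R f}"

text \<open>Every nonzero \<open>\<mu>\<close> occurs in the sequence exactly as often as the dimension of its
  eigenspace (hence not at all unless it is an eigenvalue).  The eigenvalue 0 may be omitted, or
  repeated any number of times; this also covers the padding by zeros that an operator with
  finitely many nonzero eigenvalues requires.\<close>

definition eigenvalue_sequence :: "('a::real_vector \<Rightarrow> 'a) \<Rightarrow> (nat \<Rightarrow> real) \<Rightarrow> bool"
  where "eigenvalue_sequence A l \<longleftrightarrow> (\<forall>\<mu>. \<mu> \<noteq> 0 \<longrightarrow>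
    (\<exists>B b. independent B \<and> span B = eigenspace A \<mu> \<and> bij_betw b {j. l j = \<mu>} B))"

end

theory Submission
  imports Defs
begin

text \<open>
  Write \<open>B = K K\<^sup>*\<close>, and let \<open>v j\<close> be an orthonormal family of eigenvectors of \<open>B\<close> for its nonzero
  eigenvalues \<open>\<lambda> j\<close>.  The quadratic functional is minimized where its normal equation holds; with the
  source condition \<open>u = K\<^sup>* w\<close> (here \<open>\<mu> = u\<close>, as the penalty is half the squared norm) the error
  \<open>x = U - u\<close> solves \<open>(K\<^sup>* K + \<alpha>) x = \<delta> K\<^sup>* N - \<alpha> K\<^sup>* w\<close>.  In the basis of singular vectors
  \<open>K\<^sup>* (v j) / sqrt (\<lambda> j)\<close> this equation is diagonal, and
  \<open>\<parallel>x\<parallel>\<^sup>2 = \<Sum>j. \<lambda> j * (\<delta> * \<langle>N, v j\<rangle> - \<alpha> * \<langle>w, v j\<rangle>)\<^sup>2 / (\<lambda> j + \<alpha>)\<^sup>2\<close>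
  (\<open>spectral_error_expansion\<close>).

  The variables \<open>\<langle>N, v j\<rangle>\<close> have second moment at most 1 (\<open>gaussian_white_noise_functional\<close>), so the expected
  error is at most \<open>2 * \<delta>\<^sup>2 * (\<Sum>j. \<lambda> j / (\<lambda> j + \<alpha>)\<^sup>2)\<close> plus a bias of at most \<open>2 * \<alpha> * \<parallel>w\<parallel>\<^sup>2\<close>.  Since
  \<open>\<lambda> / (\<lambda> + \<alpha>)\<^sup>2 \<le> \<alpha> powr (- 1 - m) * \<lambda> powr m\<close>, the summability of \<open>\<lambda> j powr m\<close> bounds the variance by a
  multiple of \<open>\<delta>\<^sup>2 * \<alpha> powr (- 1 - m)\<close> (\<open>expected_tikhonov_error_bound\<close>).  For \<open>\<alpha>\<close> of order
  \<open>\<delta> powr (2 / (2 + m))\<close> variance and bias have the same order, which is the asserted rate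
  (\<open>tikhonov_rate_balance\<close>).

  Three facts make the computation rigorous.  The first is the spectral theorem for compact positive
  operators, which connects the eigenvectors with the given eigenvalue sequence
  (\<open>eigenvalue_sequence_orthonormal_basis\<close>); \<open>B\<close> is compact because a bounded map into \<open>H\<^sup>t\<close> with
  \<open>t > d/2\<close> has uniformly and summably decaying Fourier coefficients.  The second is that \<open>L\<^sup>2\<close> of the torus is a
  Hilbert space in which the trigonometric system is complete (\<open>hartley_basis_complete\<close>): adjoints exist,
  and the duality pairing, which is defined by Fourier coefficients, agrees with the inner product on
  \<open>L\<^sup>2\<close>.  The third is that the noise almost surely lies in \<open>H\<^bsup>-t\<^esup>\<close>
  (\<open>gaussian_white_noise_AE_weighted_summable\<close>), so that the minimizer is available almost surely.
  Throughout, the real Hartley functions \<open>cos + sin\<close> replace the complex exponentials: they are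
  orthonormal and indexed by all frequencies, and their coefficients determine the complex ones
  (\<open>cmod_fourier_coeff\<close>).
\<close>

section \<open>Orthonormal families in Hilbert spaces\<close>

definition orthonormal_on :: "'i set \<Rightarrow> ('i \<Rightarrow> 'a::real_inner) \<Rightarrow> bool"
  where "orthonormal_on I e \<longleftrightarrow> (\<forall>i\<in>I. \<forall>j\<in>I. inner (e i) (e j) = (if i = j then 1 else 0))"

lemma norm_sum_orthonormal:
  assumes "orthonormal_on I e" "finite A" "A \<subseteq> I"
  shows "(norm (\<Sum>i\<in>A. a i *\<^sub>R e i))\<^sup>2 = (\<Sum>i\<in>A. (a i)\<^sup>2)"
proof -
  have "(norm (\<Sum>i\<in>A. a i *\<^sub>R e i))\<^sup>2 = (\<Sum>i\<in>A. \<Sum>j\<in>A. a i * (a j * inner (e j) (e i)))"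
    by (simp add: power2_norm_eq_inner inner_sum_left inner_sum_right
        sum_distrib_left)
  also have "\<dots> = (\<Sum>i\<in>A. \<Sum>j\<in>A. if i = j then (a i)\<^sup>2 else 0)"
    using assms by (intro sum.cong refl) (auto simp: orthonormal_on_def power2_eq_square subset_iff)
  also have "\<dots> = (\<Sum>i\<in>A. (a i)\<^sup>2)"
    using assms(2) by simp
  finally show ?thesis .
qed

lemma bessel_finite:
  assumes "orthonormal_on I e" "finite A" "A \<subseteq> I"
  shows "(\<Sum>i\<in>A. (inner x (e i))\<^sup>2) \<le> (norm x)\<^sup>2"
proof -
  define p where "p = (\<Sum>i\<in>A. inner x (e i) *\<^sub>R e i)"
  have "inner x p = (\<Sum>i\<in>A. (inner x (e i))\<^sup>2)"
    by (simp add: p_def inner_sum_right power2_eq_square)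
  moreover have "(norm p)\<^sup>2 = (\<Sum>i\<in>A. (inner x (e i))\<^sup>2)"
    unfolding p_def by (rule norm_sum_orthonormal[OF assms])
  moreover have "(norm (x - p))\<^sup>2 = (norm x)\<^sup>2 - 2 * inner x p + (norm p)\<^sup>2"
    by (simp add: power2_norm_eq_inner inner_diff_left inner_diff_right inner_commute[of p x])
  ultimately show ?thesis
    using zero_le_power2[of "norm (x - p)"] by linarith
qed

lemma bessel_summable:
  assumes "orthonormal_on I e"
  shows "(\<lambda>i. (inner x (e i))\<^sup>2) summable_on I"
    and "(\<Sum>\<^sub>\<infinity>i\<in>I. (inner x (e i))\<^sup>2) \<le> (norm x)\<^sup>2"
proof -
  show s: "(\<lambda>i. (inner x (e i))\<^sup>2) summable_on I"
    by (rule nonneg_bdd_above_summable_on)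
      (auto intro!: bdd_aboveI2[where M="(norm x)\<^sup>2"] bessel_finite[OF assms])
  show "(\<Sum>\<^sub>\<infinity>i\<in>I. (inner x (e i))\<^sup>2) \<le> (norm x)\<^sup>2"
    by (rule infsum_le_finite_sums[OF s bessel_finite[OF assms]])
qed

text \<open>
  The partial sums over finite sets \<open>G \<supseteq> F\<close> differ from the one over \<open>F\<close> by an orthogonal sum whose squared
  norm is a tail of \<open>\<Sum> (a i)\<^sup>2\<close>, so the net of partial sums is Cauchy.  The series need not converge
  absolutely, which is why unordered summability is the right notion here.
\<close>

lemma riesz_fischer:
  fixes e :: "'i \<Rightarrow> 'a::{real_inner,banach}"
  assumes "orthonormal_on I e" "(\<lambda>i. (a i)\<^sup>2) summable_on I"
  shows "(\<lambda>i. a i *\<^sub>R e i) summable_on I"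
proof -
  let ?S = "\<lambda>A. \<Sum>i\<in>A. a i *\<^sub>R e i"
  obtain s where s: "((\<lambda>i. (a i)\<^sup>2) has_sum s) I"
    using assms(2) by (auto simp: summable_on_def)
  have "\<exists>P. eventually P (finite_subsets_at_top I) \<and> (\<forall>F1 F2. P F1 \<and> P F2 \<longrightarrow> dist (?S F1) (?S F2) < \<epsilon>)"
    if "\<epsilon> > 0" for \<epsilon>
  proof -
    \<comment> \<open>chosen so that tails of size \<open>d\<close> keep partial sums within \<open>\<epsilon> / 2\<close> of the one over \<open>F\<close>\<close>
    define d where "d = (\<epsilon> / 2)\<^sup>2 / 2"
    have "d > 0" using that by (simp add: d_def)
    obtain F where F: "finite F" "F \<subseteq> I"
        "dist (\<Sum>i\<in>F. (a i)\<^sup>2) s \<le> d"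
      using has_sum_finite_approximation[OF s \<open>d > 0\<close>] by auto
    have upper: "(\<Sum>i\<in>G. (a i)\<^sup>2) \<le> s" if "finite G" "G \<subseteq> I" for G
      by (rule finite_sum_le_has_sum[OF s that]) simp
    have near: "dist (?S G) (?S F) < \<epsilon> / 2" if G: "finite G" "F \<subseteq> G" "G \<subseteq> I" for G
    proof -
      have "?S G - ?S F = ?S (G - F)"
        using G by (simp add: sum_diff)
      then have "(norm (?S G - ?S F))\<^sup>2 = (\<Sum>i\<in>G - F. (a i)\<^sup>2)"
        using norm_sum_orthonormal[OF assms(1), of "G - F" a] G by auto
      also have "\<dots> = (\<Sum>i\<in>G. (a i)\<^sup>2) - (\<Sum>i\<in>F. (a i)\<^sup>2)"
        using G by (simp add: sum_diff)
      also have "\<dots> \<le> d"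
        using upper[OF G(1,3)] F(3) by (simp add: dist_real_def)
      also have "\<dots> < (\<epsilon> / 2)\<^sup>2"
        using \<open>\<epsilon> > 0\<close> by (simp add: d_def)
      finally have "norm (?S G - ?S F) < \<epsilon> / 2"
        by (rule power2_less_imp_less) (use \<open>\<epsilon> > 0\<close> in simp)
      then show ?thesis
        by (simp add: dist_norm)
    qed
    show ?thesis
    proof (intro exI[of _ "\<lambda>G. finite G \<and> F \<subseteq> G \<and> G \<subseteq> I"] conjI allI impI)
      show "\<forall>\<^sub>F G in finite_subsets_at_top I. finite G \<and> F \<subseteq> G \<and> G \<subseteq> I"
        using F by (auto simp: eventually_finite_subsets_at_top)
      fix F1 F2
      assume *: "(finite F1 \<and> F \<subseteq> F1 \<and> F1 \<subseteq> I) \<and> finite F2 \<and> F \<subseteq> F2 \<and> F2 \<subseteq> I"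
      show "dist (?S F1) (?S F2) < \<epsilon>"
        by (rule dist_triangle_half_l[OF near near]) (use * in blast)+
    qed
  qed
  then have "cauchy_filter (filtermap ?S (finite_subsets_at_top I))"
    by (simp add: cauchy_filter_metric_filtermap)
  moreover have "Topological_Spaces.complete (UNIV :: 'a set)"
    by (meson Cauchy_convergent UNIV_I complete_def convergent_def)
  ultimately obtain L where "(?S \<longlongrightarrow> L) (finite_subsets_at_top I)"
    using complete_uniform[where S="UNIV :: 'a set"] by (force simp add: filterlim_def)
  then show ?thesis
    using summable_on_def has_sum_def by blast
qed

text \<open>
  The second hypothesis places \<open>x\<close> in the double orthogonal complement of the family, that is, in the
  closed span.  Phrased this way the lemma covers both complete families (every \<open>x\<close> qualifies) and
  families that miss a kernel, such as the singular vectors of an operator.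
\<close>

lemma orthonormal_expansion:
  fixes e :: "'i \<Rightarrow> 'a::{real_inner,banach}"
  assumes on: "orthonormal_on I e"
    and perp: "\<And>h. (\<And>i. i \<in> I \<Longrightarrow> inner h (e i) = 0) \<Longrightarrow> inner x h = 0"
  shows "((\<lambda>i. inner x (e i) *\<^sub>R e i) has_sum x) I"
proof -
  define y where "y = (\<Sum>\<^sub>\<infinity>i\<in>I. inner x (e i) *\<^sub>R e i)"
  have y: "((\<lambda>i. inner x (e i) *\<^sub>R e i) has_sum y) I"
    unfolding y_def using riesz_fischer[OF on bessel_summable(1)[OF on]] by (rule has_sum_infsum)
  have yi: "((\<lambda>i. inner x (e i) * inner (e i) z) has_sum inner y z) I" for z
    using has_sum_bounded_linear[OF bounded_linear_inner_left y, of z] by simp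
  have coeff: "inner (x - y) (e j) = 0" if "j \<in> I" for j
  proof -
    have "((\<lambda>i. inner x (e i) * inner (e i) (e j)) has_sum inner x (e j)) I"
      using that on
      by (intro has_sum_finite_neutralI[of "{j}"]) (auto simp: orthonormal_on_def)
    then have "inner y (e j) = inner x (e j)"
      using yi has_sum_unique by blast
    then show ?thesis by (simp add: inner_diff_left)
  qed
  have "inner (e j) (x - y) = 0" if "j \<in> I" for j
    using coeff[OF that] by (subst inner_commute)
  then have "((\<lambda>i. inner x (e i) * inner (e i) (x - y)) has_sum 0) I"
    by (intro has_sum_0) simp
  then have "inner y (x - y) = 0"
    using yi has_sum_unique by blast
  moreover have "inner x (x - y) = 0"
    by (rule perp[OF coeff])
  ultimately have "inner (x - y) (x - y) = 0"
    by (simp add: inner_diff_left)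
  then have "x = y" by simp
  with y show ?thesis by simp
qed

lemma parseval_inner:
  fixes e :: "'i \<Rightarrow> 'a::{real_inner,banach}"
  assumes "orthonormal_on I e"
    and "\<And>h. (\<And>i. i \<in> I \<Longrightarrow> inner h (e i) = 0) \<Longrightarrow> inner x h = 0"
  shows "((\<lambda>i. inner x (e i) * inner z (e i)) has_sum inner x z) I"
  using has_sum_bounded_linear[OF bounded_linear_inner_left orthonormal_expansion[OF assms], of z]
  by (simp add: inner_commute)

lemma parseval:
  fixes e :: "'i \<Rightarrow> 'a::{real_inner,banach}"
  assumes "orthonormal_on I e"
    and "\<And>h. (\<And>i. i \<in> I \<Longrightarrow> inner h (e i) = 0) \<Longrightarrow> inner x h = 0"
  shows "((\<lambda>i. (inner x (e i))\<^sup>2) has_sum (norm x)\<^sup>2) I"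
  using parseval_inner[OF assms, of x] 
  by (simp only: power2_norm_eq_inner flip: power2_eq_square)

text \<open>
  The coefficients \<open>f (e i)\<close> of the representing vector are square summable because \<open>f\<close>, evaluated at a
  partial sum \<open>z\<close> of the series with these coefficients, equals \<open>\<parallel>z\<parallel>\<^sup>2\<close>, so that \<open>\<parallel>z\<parallel>\<close> is at
  most the norm of \<open>f\<close>.
\<close>

lemma riesz_representation:
  fixes e :: "'i \<Rightarrow> 'a::{real_inner,banach}" and f :: "'a \<Rightarrow> real"
  assumes on: "orthonormal_on UNIV e"
    and complete: "\<And>h. (\<And>i. inner h (e i) = 0) \<Longrightarrow> h = 0"
    and f: "bounded_linear f"
  shows "\<exists>y. \<forall>x. f x = inner x y"
proof -
  interpret f: bounded_linear f by fact
  obtain C where C: "0 < C" "\<And>x. norm (f x) \<le> norm x * C"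
    using f.pos_bounded by blast
  have "(\<lambda>i. (f (e i))\<^sup>2) summable_on UNIV"
  proof (rule nonneg_bdd_above_summable_on)
    have "(\<Sum>i\<in>A. (f (e i))\<^sup>2) \<le> C\<^sup>2" if "finite A" for A
    proof -
      let ?z = "\<Sum>i\<in>A. f (e i) *\<^sub>R e i" and ?q = "\<Sum>i\<in>A. (f (e i))\<^sup>2"
      \<comment> \<open>applying \<open>f\<close> to its own truncated representation bounds the coefficients\<close>
      have "f ?z = ?q"
        by (simp add: f.sum f.scale power2_eq_square)
      moreover have nz: "(norm ?z)\<^sup>2 = ?q"
        using norm_sum_orthonormal[OF on that] by simp
      ultimately have "(norm ?z)\<^sup>2 \<le> norm ?z * C"
        using C(2)[of ?z] by (metis abs_le_D1 real_norm_def)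
      then have "norm ?z \<le> C"
        using C(1) by (cases "norm ?z = 0") (simp_all add: power2_eq_square)
      then show ?thesis
        unfolding nz[symmetric] by (intro power_mono) auto
    qed
    then show "bdd_above (sum (\<lambda>i. (f (e i))\<^sup>2) ` {F. F \<subseteq> UNIV \<and> finite F})"
      by (intro bdd_aboveI2[where M = "C\<^sup>2"]) auto
  qed simp
  from riesz_fischer[OF on this] obtain y where y: "((\<lambda>i. f (e i) *\<^sub>R e i) has_sum y) UNIV"
    by (auto simp: summable_on_def)
  have "f x = inner x y" for x
  proof -
    have "((\<lambda>i. inner x (e i) *\<^sub>R e i) has_sum x) UNIV"
    proof (rule orthonormal_expansion[OF on])
      show "inner x h = 0" if "\<And>i. i \<in> UNIV \<Longrightarrow> inner h (e i) = 0" for h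
        using complete[of h] that by simp
    qed
    from has_sum_bounded_linear[OF f this]
    have "((\<lambda>i. inner x (e i) * f (e i)) has_sum f x) UNIV"
      by (simp add: f.scale)
    moreover have "((\<lambda>i. inner x (e i) * f (e i)) has_sum inner x y) UNIV"
      using has_sum_bounded_linear[OF bounded_linear_inner_right y, of x]
      by (simp add: mult.commute)
    ultimately show ?thesis
      by (rule has_sum_unique)
  qed
  then show ?thesis by blast
qed

text \<open>
  The constant \<open>adjoint\<close> is defined by choice, so its characteristic identity holds once some adjoint is
  known to exist; this is what the Riesz representation provides.
\<close>

lemma inner_adjoint:
  fixes e :: "'i \<Rightarrow> 'a::{real_inner,banach}" and K :: "'a \<Rightarrow> 'b::real_inner"
  assumes "orthonormal_on UNIV e" "\<And>h. (\<And>i. inner h (e i) = 0) \<Longrightarrow> h = 0"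
    and K: "bounded_linear K"
  shows "inner x (adjoint K y) = inner (K x) y"
proof -
  have "\<exists>z. \<forall>x. inner (K x) y = inner x z" for y
    by (intro riesz_representation[OF assms(1,2)]
        bounded_linear_compose[OF bounded_linear_inner_left K])
  then have "\<exists>K'. \<forall>x y. inner (K x) y = inner x (K' y)"
    by metis
  then have "\<forall>x y. inner (K x) y = inner x (adjoint K y)"
    unfolding adjoint_def by (rule someI_ex)
  then show ?thesis by simp
qed

lemma bounded_linear_adjoint_pair:
  fixes K :: "'a::real_inner \<Rightarrow> 'b::real_inner"
  assumes "bounded_linear K" "\<And>x y. inner x (L y) = inner (K x) y"
  shows "bounded_linear L"
proof -
  obtain C where C: "0 < C" "\<And>x. norm (K x) \<le> norm x * C"
    using bounded_linear.pos_bounded[OF assms(1)] by blast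
  show ?thesis
  proof (rule bounded_linear_intro)
    show "L (x + y) = L x + L y" for x y
      by (rule vector_eq_ldot[THEN iffD1]) (simp add: assms(2) inner_add_right)
    show "L (r *\<^sub>R x) = r *\<^sub>R L x" for r x
      by (rule vector_eq_ldot[THEN iffD1]) (simp add: assms(2))
    show "norm (L x) \<le> norm x * C" for x
    proof -
      have "norm (L x) * norm (L x) = inner (K (L x)) x"
        using assms(2)[of "L x" x] by (simp add: power2_norm_eq_inner power2_eq_square[symmetric])
      also have "\<dots> \<le> norm (K (L x)) * norm x"
        by (rule norm_cauchy_schwarz)
      also have "\<dots> \<le> norm (L x) * C * norm x"
        by (intro mult_right_mono C) auto
      finally show ?thesis
        using C(1) by (cases "norm (L x) = 0") (auto simp: mult.assoc mult.commute)
    qed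
  qed
qed

section \<open>Compact positive operators and their eigenvectors\<close>

text \<open>
  Compactness of boxes in a finite-dimensional span, by adding one compact segment at a time.  These
  boxes are the finite-dimensional approximations of the image of a ball below.
\<close>

lemma compact_coefficient_box:
  fixes e :: "'i \<Rightarrow> 'a::real_normed_vector"
  assumes "finite A"
  shows "compact {\<Sum>i\<in>A. a i *\<^sub>R e i | a. \<forall>i\<in>A. \<bar>a i\<bar> \<le> r i}"
  using assms
proof (induction A)
  case empty
  then show ?case by simp
next
  case (insert j A)
  let ?B = "\<lambda>A. {\<Sum>i\<in>A. a i *\<^sub>R e i | a. \<forall>i\<in>A. \<bar>a i\<bar> \<le> r i}"
  have "compact ((\<lambda>c. c *\<^sub>R e j) ` {-r j..r j})"
    by (intro compact_continuous_image continuous_intros) auto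
  from compact_sums[OF this insert.IH]
  have "compact {x + y | x y. x \<in> (\<lambda>c. c *\<^sub>R e j) ` {-r j..r j} \<and> y \<in> ?B A}" .
  moreover have "{x + y | x y. x \<in> (\<lambda>c. c *\<^sub>R e j) ` {-r j..r j} \<and> y \<in> ?B A} = ?B (insert j A)"
  proof (intro equalityI subsetI)
    fix z assume "z \<in> {x + y | x y. x \<in> (\<lambda>c. c *\<^sub>R e j) ` {-r j..r j} \<and> y \<in> ?B A}"
    then obtain c a where *: "c \<in> {-r j..r j}" "\<forall>i\<in>A. \<bar>a i\<bar> \<le> r i"
        "z = c *\<^sub>R e j + (\<Sum>i\<in>A. a i *\<^sub>R e i)"
      by blast
    have "(\<Sum>i\<in>A. (a(j := c)) i *\<^sub>R e i) = (\<Sum>i\<in>A. a i *\<^sub>R e i)"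
      using insert.hyps by (intro sum.cong) auto
    then have "z = (\<Sum>i\<in>insert j A. (a(j := c)) i *\<^sub>R e i)"
      using insert.hyps * by simp
    moreover have "\<forall>i\<in>insert j A. \<bar>(a(j := c)) i\<bar> \<le> r i"
      using * by (auto simp: abs_le_iff)
    ultimately show "z \<in> ?B (insert j A)" by blast
  next
    fix z assume "z \<in> ?B (insert j A)"
    then obtain a where *: "\<forall>i\<in>insert j A. \<bar>a i\<bar> \<le> r i" "z = (\<Sum>i\<in>insert j A. a i *\<^sub>R e i)"
      by blast
    have "z = a j *\<^sub>R e j + (\<Sum>i\<in>A. a i *\<^sub>R e i)"
      using * insert.hyps by simp
    moreover have "a j \<in> {-r j..r j}" using * by (auto simp: abs_le_iff)
    ultimately show "z \<in> {x + y | x y. x \<in> (\<lambda>c. c *\<^sub>R e j) ` {-r j..r j} \<and> y \<in> ?B A}"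
      using * by blast
  qed
  ultimately show ?case by simp
qed

lemma compact_closure_if_finitely_approximable:
  fixes S :: "'a::banach set"
  assumes "\<And>\<epsilon>. \<epsilon> > 0 \<Longrightarrow> \<exists>C. compact C \<and> (\<forall>x\<in>S. \<exists>y\<in>C. dist x y < \<epsilon>)"
  shows "compact (closure S)"
  unfolding compact_eq_totally_bounded
proof (intro conjI allI impI)
  show "Topological_Spaces.complete (closure S)"
    by (simp add: complete_eq_closed)
  fix \<epsilon> :: real assume "\<epsilon> > 0"
  obtain C where C: "compact C" "\<And>x. x \<in> S \<Longrightarrow> \<exists>y\<in>C. dist x y < \<epsilon> / 4"
    using assms[of "\<epsilon> / 4"] \<open>\<epsilon> > 0\<close> by auto
  obtain F where F: "finite F" "C \<subseteq> (\<Union>x\<in>F. ball x (\<epsilon> / 4))"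
    using C(1) \<open>\<epsilon> > 0\<close> unfolding compact_eq_totally_bounded by (meson zero_less_divide_iff zero_less_numeral)
  have "closure S \<subseteq> (\<Union>x\<in>F. ball x \<epsilon>)"
  proof
    fix x assume "x \<in> closure S"
    then obtain x' where x': "x' \<in> S" "dist x' x < \<epsilon> / 4"
      using \<open>\<epsilon> > 0\<close> unfolding closure_approachable by (meson zero_less_divide_iff zero_less_numeral)
    obtain y where y: "y \<in> C" "dist x' y < \<epsilon> / 4" using C(2)[OF x'(1)] by blast
    obtain z where z: "z \<in> F" "dist z y < \<epsilon> / 4" using F(2) y(1) by auto
    have "dist z x \<le> dist z y + (dist x' y + dist x' x)"
      using dist_triangle[of z x y] dist_triangle3[of y x x'] by linarith
    also have "\<dots> < \<epsilon>" using x'(2) y(2) z(2) \<open>\<epsilon> > 0\<close> by linarith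
    finally show "x \<in> (\<Union>x\<in>F. ball x \<epsilon>)" using z(1) by auto
  qed
  with F(1) show "\<exists>k. finite k \<and> closure S \<subseteq> (\<Union>x\<in>k. ball x \<epsilon>)" by blast
qed

text \<open>
  A Hilbert-Schmidt type criterion: if the \<open>i\<close>-th coefficient of \<open>T u\<close> is at most \<open>sqrt (b i)\<close> on the
  unit ball, uniformly in \<open>u\<close>, and \<open>b\<close> is summable, then cutting off all but finitely many
  coefficients changes \<open>T u\<close> by little, uniformly in \<open>u\<close>.
\<close>

lemma compact_image_of_ball:
  fixes e :: "'i \<Rightarrow> 'a::{real_inner,banach}" and T :: "'b::real_normed_vector \<Rightarrow> 'a"
  assumes on: "orthonormal_on UNIV e"
    and complete: "\<And>h. (\<And>i. inner h (e i) = 0) \<Longrightarrow> h = 0"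
    and b: "b summable_on UNIV"
    and T: "\<And>u i. (inner (T u) (e i))\<^sup>2 \<le> b i * (norm u)\<^sup>2"
  shows "compact (closure (T ` cball 0 1))"
proof (rule compact_closure_if_finitely_approximable)
  fix \<epsilon> :: real assume "\<epsilon> > 0"
  have coeff: "(inner (T u) (e i))\<^sup>2 \<le> b i" if "norm u \<le> 1" and "0 \<le> b i" for u i
  proof -
    have "b i * (norm u)\<^sup>2 \<le> b i * 1"
      using that by (intro mult_left_mono power_le_one) auto
    with T[of u i] show ?thesis by simp
  qed
  have b0: "0 \<le> b i" if "u \<noteq> 0" for i and u :: 'b
  proof -
    have "0 \<le> b i * (norm u)\<^sup>2" using T[of u i] by (meson order_trans zero_le_power2)
    then show ?thesis using that by (simp add: zero_le_mult_iff)
  qed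
  have T0: "T 0 = 0"
    using T[of 0] by (intro complete) simp
  obtain s where s: "(b has_sum s) UNIV" using b by (auto simp: summable_on_def)
  obtain A where A: "finite A" "dist (sum b A) s \<le> \<epsilon>\<^sup>2 / 2"
    using has_sum_finite_approximation[OF s, of "\<epsilon>\<^sup>2 / 2"] \<open>\<epsilon> > 0\<close> by auto
  \<comment> \<open>the coefficients of \<open>T u\<close> on \<open>A\<close> stay in this box for all \<open>u\<close> in the unit ball\<close>
  let ?C = "{\<Sum>i\<in>A. a i *\<^sub>R e i | a. \<forall>i\<in>A. \<bar>a i\<bar> \<le> sqrt \<bar>b i\<bar>}"
  have "\<exists>y\<in>?C. dist (T u) y < \<epsilon>" if u: "norm u \<le> 1" for u
  proof (cases "u = 0")
    case True
    have "0 \<in> ?C" by (auto intro!: exI[of _ "\<lambda>_. 0"])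
    then show ?thesis using T0 \<open>\<epsilon> > 0\<close> True by force
  next
    case False
    define y where "y = (\<Sum>i\<in>A. inner (T u) (e i) *\<^sub>R e i)"
    have "\<bar>inner (T u) (e i)\<bar> \<le> sqrt \<bar>b i\<bar>" for i
      using coeff[OF u b0[OF False], of i] b0[OF False] by (intro real_le_rsqrt) simp
    then have "y \<in> ?C"
      unfolding y_def by (intro CollectI exI[of _ "\<lambda>i. inner (T u) (e i)"]) simp
    have yi: "inner y (e i) = (if i \<in> A then inner (T u) (e i) else 0)" for i
    proof -
      have "inner y (e i) = (\<Sum>j\<in>A. if j = i then inner (T u) (e j) else 0)"
        unfolding y_def inner_sum_left using on by (intro sum.cong) (auto simp: orthonormal_on_def)
      then show ?thesis using A(1) by simp
    qed
    have perp: "inner z h = 0" if "\<And>i. i \<in> UNIV \<Longrightarrow> inner h (e i) = 0" for z h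
      using complete[of h] that by simp
    have "((\<lambda>i. (inner (T u - y) (e i))\<^sup>2) has_sum (norm (T u - y))\<^sup>2) UNIV"
      by (rule parseval[OF on perp])
    moreover have "((\<lambda>i. b i - (if i \<in> A then b i else 0)) has_sum (s - sum b A)) UNIV"
    proof -
      have "((\<lambda>i. - (if i \<in> A then b i else 0)) has_sum (- sum b A)) UNIV"
        unfolding has_sum_uminus using A(1) by (intro has_sum_finite_neutralI[of A]) auto
      from has_sum_add[OF s this] show ?thesis by simp
    qed
    ultimately have "(norm (T u - y))\<^sup>2 \<le> s - sum b A"
    proof (rule has_sum_mono)
      show "(inner (T u - y) (e i))\<^sup>2 \<le> b i - (if i \<in> A then b i else 0)" for i
        using coeff[OF u b0[OF False], of i] by (simp add: inner_diff_left yi)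
    qed
    also have "\<dots> \<le> \<epsilon>\<^sup>2 / 2" using A(2) unfolding dist_real_def by linarith
    also have "\<dots> < \<epsilon>\<^sup>2" using \<open>\<epsilon> > 0\<close> by simp
    finally have "norm (T u - y) < \<epsilon>"
      by (rule power2_less_imp_less) (use \<open>\<epsilon> > 0\<close> in simp)
    with \<open>y \<in> ?C\<close> show ?thesis by (auto simp: dist_norm)
  qed
  then have "\<forall>x\<in>T ` cball 0 1. \<exists>y\<in>?C. dist x y < \<epsilon>" by simp
  with compact_coefficient_box[OF A(1), of e "\<lambda>i. sqrt \<bar>b i\<bar>"]
  show "\<exists>C. compact C \<and> (\<forall>x\<in>T ` cball 0 1. \<exists>y\<in>C. dist x y < \<epsilon>)" by (intro exI[of _ ?C] conjI)
qed

text \<open>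
  The variational construction of an eigenvector: let \<open>s\<close> be the supremum of \<open>inner (B x) x\<close> over unit
  vectors of \<open>W\<close> and \<open>x n\<close> a maximizing sequence.  Positivity gives \<open>\<parallel>B x\<parallel>\<^sup>2 \<le> s * inner (B x) x\<close>, hence
  \<open>B (x n) - s *\<^sub>R x n\<close> tends to 0; compactness makes a subsequence of \<open>B (x n)\<close> converge, and its limit is
  an eigenvector for \<open>s\<close>.  The invariant subspace \<open>W\<close> will be the orthogonal complement of all
  eigenvectors that are already known.
\<close>

lemma compact_positive_operator_eigenvector:
  fixes B :: "'a::real_inner \<Rightarrow> 'a"
  assumes B: "bounded_linear B"
    and compact: "compact (closure (B ` cball 0 1))"
    and selfadj: "\<And>x y. inner (B x) y = inner x (B y)"
    and pos: "\<And>x. 0 \<le> inner (B x) x"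
    and W: "subspace W" "closed W" "\<And>x. x \<in> W \<Longrightarrow> B x \<in> W"
    and x0: "x0 \<in> W" "inner (B x0) x0 \<noteq> 0"
  shows "\<exists>s>0. \<exists>y\<in>W. y \<noteq> 0 \<and> B y = s *\<^sub>R y"
proof -
  interpret B: bounded_linear B by fact
  obtain C where C: "0 < C" "\<And>x. norm (B x) \<le> norm x * C"
    using B.pos_bounded by blast
  define Q where "Q = (\<lambda>x. inner (B x) x) ` {x \<in> W. norm x = 1}"
  have x0nz: "x0 \<noteq> 0" using x0(2) by auto
  have unit: "inner (B x) x / (norm x)\<^sup>2 \<in> Q" if "x \<in> W" "x \<noteq> 0" for x
  proof -
    let ?x = "(1 / norm x) *\<^sub>R x"
    have "?x \<in> W" "norm ?x = 1" using that W(1) by (auto intro: subspace_scale)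
    moreover have "inner (B ?x) ?x = inner (B x) x / (norm x)\<^sup>2"
      by (simp add: B.scale power2_eq_square)
    ultimately show ?thesis unfolding Q_def by (metis (mono_tags, lifting) imageI mem_Collect_eq)
  qed
  have bdd: "bdd_above Q"
  proof (rule bdd_aboveI)
    fix q assume "q \<in> Q"
    then obtain x where x: "norm x = 1" "q = inner (B x) x" unfolding Q_def by auto
    then show "q \<le> C" using norm_cauchy_schwarz[of "B x" x] C(2)[of x] by simp
  qed
  define s where "s = Sup Q"
  have s_upper: "inner (B x) x \<le> s * (norm x)\<^sup>2" if "x \<in> W" for x
  proof (cases "x = 0")
    case False
    then show ?thesis using cSup_upper[OF unit[OF that False] bdd]
      by (simp add: s_def pos_divide_le_eq)
  qed simp
  have s0: "s > 0"
  proof -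
    have "0 < inner (B x0) x0 / (norm x0)\<^sup>2" using pos[of x0] x0(2) x0nz by simp
    also have "\<dots> \<le> s" unfolding s_def by (rule cSup_upper[OF unit[OF x0(1) x0nz] bdd])
    finally show ?thesis .
  qed
  have image_bound: "(norm (B x))\<^sup>2 \<le> s * inner (B x) x" if x: "x \<in> W" for x
  proof -
    \<comment> \<open>among the vectors \<open>x - c *\<^sub>R B x\<close> the choice \<open>c = 1 / s\<close> gives the best estimate\<close>
    let ?z = "x - (1 / s) *\<^sub>R B x"
    have "0 \<le> inner (B ?z) ?z" by (rule pos)
    also have "inner (B ?z) ?z =
        inner (B x) x - (2 / s) * (norm (B x))\<^sup>2 + (1 / s)\<^sup>2 * inner (B (B x)) (B x)"
      by (simp add: B.diff B.scale inner_diff_left inner_diff_right selfadj[of "B x" x]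
          power2_norm_eq_inner power2_eq_square[of s] power_divide diff_divide_distrib)
    also have "\<dots> \<le> inner (B x) x - (2 / s) * (norm (B x))\<^sup>2 + (1 / s)\<^sup>2 * (s * (norm (B x))\<^sup>2)"
      using s_upper[OF W(3)[OF x]] by (intro add_left_mono mult_left_mono) auto
    also have "\<dots> = inner (B x) x - (norm (B x))\<^sup>2 / s"
      using s0 by (simp add: power2_eq_square field_simps)
    finally show ?thesis using s0 by (simp add: field_simps)
  qed
  have "\<exists>x\<in>W. norm x = 1 \<and> s - 1 / real (Suc n) < inner (B x) x" for n
  proof -
    have "Q \<noteq> {}" using unit[OF x0(1) x0nz] by blast
    then obtain q where "q \<in> Q" "s - 1 / real (Suc n) < q"
      using less_cSupD[of Q "s - 1 / real (Suc n)"] unfolding s_def by auto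
    then show ?thesis unfolding Q_def by auto
  qed
  then obtain x where x: "\<And>n. x n \<in> W" "\<And>n. norm (x n) = 1"
      "\<And>n. s - 1 / real (Suc n) < inner (B (x n)) (x n)"
    by metis
  have residual: "(norm (B (x n) - s *\<^sub>R x n))\<^sup>2 \<le> s / real (Suc n)" for n
  proof -
    have "(norm (B (x n) - s *\<^sub>R x n))\<^sup>2 =
        (norm (B (x n)))\<^sup>2 - 2 * s * inner (B (x n)) (x n) + s\<^sup>2 * (norm (x n))\<^sup>2"
      by (simp add: power2_norm_eq_inner inner_diff_left inner_diff_right
          inner_commute[of "x n" "B (x n)"] power2_eq_square[of s] algebra_simps)
    also have "\<dots> \<le> s * (s - inner (B (x n)) (x n))"
      using image_bound[OF x(1)[of n]] by (simp add: x(2) power2_eq_square algebra_simps)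
    also have "\<dots> \<le> s * (1 / real (Suc n))"
      using x(3)[of n] s0 by (intro mult_left_mono) auto
    finally show ?thesis by simp
  qed
  have "(\<lambda>n. (norm (B (x n) - s *\<^sub>R x n))\<^sup>2) \<longlonglongrightarrow> 0"
  proof (rule tendsto_sandwich[of "\<lambda>_. 0"])
    show "(\<lambda>n. s / real (Suc n)) \<longlonglongrightarrow> 0"
      using LIMSEQ_Suc[OF lim_const_over_n[of s]] by simp
  qed (use residual in \<open>auto simp del: of_nat_Suc\<close>)
  then have "(\<lambda>n. norm (B (x n) - s *\<^sub>R x n)) \<longlonglongrightarrow> 0"
    by (simp add: power_tendsto_0_iff)
  then have res0: "(\<lambda>n. B (x n) - s *\<^sub>R x n) \<longlonglongrightarrow> 0"
    by (rule tendsto_norm_zero_cancel)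
  have "\<forall>n. B (x n) \<in> closure (B ` cball 0 1)"
    using x(2) by (intro allI subsetD[OF closure_subset] imageI) simp
  then obtain y r where y: "strict_mono (r :: nat \<Rightarrow> nat)" "((\<lambda>n. B (x n)) \<circ> r) \<longlonglongrightarrow> y"
    using compact[unfolded compact_def, rule_format, of "\<lambda>n. B (x n)"] by blast
  \<comment> \<open>as \<open>s \<noteq> 0\<close>, the maximizing sequence itself converges along \<open>r\<close>\<close>
  have lim: "(\<lambda>n. s *\<^sub>R x (r n)) \<longlonglongrightarrow> y"
    using tendsto_diff[OF y(2) LIMSEQ_subseq_LIMSEQ[OF res0 y(1)]] by (simp add: o_def)
  have "y \<in> W"
    using closed_sequentially[OF W(2) _ lim] x(1) W(1) by (simp add: subspace_scale)
  moreover have "norm y = s"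
  proof -
    have "(\<lambda>n. norm (s *\<^sub>R x (r n))) \<longlonglongrightarrow> norm y" by (rule tendsto_norm[OF lim])
    then show ?thesis using s0 by (simp add: x(2) LIMSEQ_const_iff)
  qed
  moreover have "B y = s *\<^sub>R y"
  proof -
    have "(\<lambda>n. B (s *\<^sub>R x (r n))) \<longlonglongrightarrow> B y" by (rule B.tendsto[OF lim])
    moreover have "(\<lambda>n. B (s *\<^sub>R x (r n))) \<longlonglongrightarrow> s *\<^sub>R y"
      using tendsto_scaleR[OF tendsto_const y(2), of s] by (simp add: B.scale o_def)
    ultimately show ?thesis by (rule LIMSEQ_unique)
  qed
  ultimately show ?thesis using s0 by (intro exI[of _ s] conjI bexI[of _ y]) auto
qed

text \<open>
  Gram-Schmidt followed by discarding 0 and normalizing.  The cardinality bound is all that is needed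
  to index the new vectors by the multiset of eigenvalues.
\<close>

lemma orthonormal_basis_of_finite_span:
  fixes S :: "'a::real_inner set"
  assumes "finite S"
  shows "\<exists>D. finite D \<and> card D \<le> card S \<and> span D = span S \<and> orthonormal_on D (\<lambda>x. x)"
proof -
  obtain C where C: "finite C" "card C \<le> card S" "span C = span S" "pairwise orthogonal C"
    using basis_orthogonal[OF assms] by blast
  define D where "D = (\<lambda>x. (1 / norm x) *\<^sub>R x) ` (C - {0})"
  have "card D \<le> card (C - {0})"
    unfolding D_def using C(1) by (intro card_image_le) simp
  also have "\<dots> \<le> card S"
    using C(1,2) card_mono[of C "C - {0}"] by auto
  finally have "card D \<le> card S" .
  moreover have "span D = span S"
  proof -
    have "span D = span (C - {0})"
      unfolding D_def using C(1) by (intro span_image_scale) auto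
    then show ?thesis using C(3) by simp
  qed
  moreover have "orthonormal_on D (\<lambda>x. x)"
    unfolding orthonormal_on_def
  proof (intro ballI)
    fix u v assume "u \<in> D" "v \<in> D"
    then obtain x y where *: "x \<in> C" "x \<noteq> 0" "u = (1 / norm x) *\<^sub>R x"
        "y \<in> C" "y \<noteq> 0" "v = (1 / norm y) *\<^sub>R y"
      unfolding D_def by blast
    show "inner u v = (if u = v then 1 else 0)"
    proof (cases "x = y")
      case True
      then show ?thesis using * by (simp add: power2_norm_eq_inner[symmetric] power2_eq_square)
    next
      case False
      then have "inner x y = 0" using C(4) * by (auto simp: pairwise_def orthogonal_def)
      then have "inner u v = 0" using * by simp
      moreover have "inner u u \<noteq> 0" using * by simp
      ultimately show ?thesis by auto
    qed
  qed
  ultimately show ?thesis using C(1) by (intro exI[of _ D]) (auto simp: D_def)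
qed

lemma eigenvalue_sequence_nonneg:
  fixes B :: "'a::real_inner \<Rightarrow> 'a"
  assumes "eigenvalue_sequence B l" "\<And>x. 0 \<le> inner (B x) x"
  shows "0 \<le> l j"
proof (cases "l j = 0")
  case False
  then obtain S b where S: "independent S" "span S = eigenspace B (l j)"
      "bij_betw b {i. l i = l j} S"
    using assms(1) unfolding eigenvalue_sequence_def by blast
  have "b j \<in> S" using S(3) by (auto simp: bij_betw_def)
  then have b: "b j \<noteq> 0" "B (b j) = l j *\<^sub>R b j"
    using S(1,2) dependent_zero[of S] span_base[of "b j" S] by (auto simp: eigenspace_def)
  then have "inner (b j) (b j) > 0" by simp
  with assms(2)[of "b j"] b(2) show ?thesis
    by (simp add: zero_le_mult_iff)
qed simp

text \<open>
  The spectral theorem in the form in which the eigenvalue sequence enters: the indices \<open>j\<close> of the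
  sequence can be used to label an orthonormal family of eigenvectors \<open>v j\<close> for \<open>l j\<close>.  Inside one
  eigenspace this is Gram-Schmidt applied to the given basis; distinct eigenspaces are orthogonal.  On
  the orthogonal complement of all \<open>v j\<close> the quadratic form vanishes, since otherwise that complement
  would contain another eigenvector with a nonzero eigenvalue.
\<close>

lemma eigenvalue_sequence_orthonormal_basis:
  fixes B :: "'a::real_inner \<Rightarrow> 'a"
  assumes B: "bounded_linear B"
    and compact: "compact (closure (B ` cball 0 1))"
    and selfadj: "\<And>x y. inner (B x) y = inner x (B y)"
    and pos: "\<And>x. 0 \<le> inner (B x) x"
    and l: "eigenvalue_sequence B l"
    and fin: "\<And>\<mu>. \<mu> \<noteq> 0 \<Longrightarrow> finite {j. l j = \<mu>}"
  shows "\<exists>J v. orthonormal_on J v \<and> (\<forall>j\<in>J. B (v j) = l j *\<^sub>R v j \<and> l j > 0) \<and>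
    (\<forall>x. (\<forall>j\<in>J. inner x (v j) = 0) \<longrightarrow> inner (B x) x = 0)"
proof -
  interpret B: bounded_linear B by fact
  have "\<exists>I c. I \<subseteq> {j. l j = \<mu>} \<and> orthonormal_on I c \<and> span (c ` I) = eigenspace B \<mu>"
    if "\<mu> \<noteq> 0" for \<mu>
  proof -
    obtain S b where S: "span S = eigenspace B \<mu>" "bij_betw b {i. l i = \<mu>} S"
      using l \<open>\<mu> \<noteq> 0\<close> unfolding eigenvalue_sequence_def by blast
    have "finite S" "card S = card {i. l i = \<mu>}"
      using fin[OF that] S(2) by (auto simp: bij_betw_finite bij_betw_same_card[symmetric])
    with orthonormal_basis_of_finite_span[of S] obtain D where D: "finite D"
        "card D \<le> card {i. l i = \<mu>}" "span D = span S" "orthonormal_on D (\<lambda>x. x)"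
      by auto
    obtain I where I: "I \<subseteq> {i. l i = \<mu>}" "card I = card D"
      using obtain_subset_with_card_n[OF D(2)] by metis
    obtain c where c: "bij_betw c I D"
      using finite_same_card_bij[of I D] I D(1) finite_subset[OF I(1) fin[OF \<open>\<mu> \<noteq> 0\<close>]] by auto
    have "orthonormal_on I c"
      using D(4) bij_betwE[OF c] bij_betw_imp_inj_on[OF c]
      unfolding orthonormal_on_def by (auto simp: inj_on_eq_iff)
    moreover have "span (c ` I) = eigenspace B \<mu>"
      using c D(3) S(1) by (simp add: bij_betw_imp_surj_on)
    ultimately show ?thesis using I(1) by blast
  qed
  then obtain I c where Ic: "\<And>\<mu>. \<mu> \<noteq> 0 \<Longrightarrow> I \<mu> \<subseteq> {j. l j = \<mu>}"
      "\<And>\<mu>. \<mu> \<noteq> 0 \<Longrightarrow> orthonormal_on (I \<mu>) (c \<mu>)"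
      "\<And>\<mu>. \<mu> \<noteq> 0 \<Longrightarrow> span (c \<mu> ` I \<mu>) = eigenspace B \<mu>"
    by metis
  define J where "J = {j. l j \<noteq> 0 \<and> j \<in> I (l j)}"
  define v where "v j = c (l j) j" for j
  have eig: "B (v j) = l j *\<^sub>R v j" if "j \<in> J" for j
    using that Ic(3)[of "l j"] span_base[of "v j" "c (l j) ` I (l j)"]
    by (auto simp: J_def v_def eigenspace_def)
  have on: "orthonormal_on J v"
    unfolding orthonormal_on_def
  proof (intro ballI)
    fix i j assume ij: "i \<in> J" "j \<in> J"
    show "inner (v i) (v j) = (if i = j then 1 else 0)"
    proof (cases "l i = l j")
      case True
      then show ?thesis
        using Ic(2)[of "l j"] ij by (auto simp: J_def v_def orthonormal_on_def)
    next
      case False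
      have "l i * inner (v i) (v j) = l j * inner (v i) (v j)"
        using selfadj[of "v i" "v j"] eig ij by simp
      with False show ?thesis by auto
    qed
  qed
  have lpos: "l j > 0" if "j \<in> J" for j
    using eigenvalue_sequence_nonneg[OF l pos, of j] that by (auto simp: J_def)
  have "inner (B x0) x0 = 0" if x0: "\<And>j. j \<in> J \<Longrightarrow> inner x0 (v j) = 0" for x0
  proof (rule ccontr)
    assume nz: "inner (B x0) x0 \<noteq> 0"
    define W where "W = {x. \<forall>j\<in>J. inner x (v j) = 0}"
    have "subspace W"
      by (auto simp: W_def subspace_def inner_add_left)
    moreover have "closed W"
    proof -
      have "W = (\<Inter>j\<in>J. {x. inner x (v j) = 0})" by (auto simp: W_def)
      then show ?thesis
        by (auto intro!: closed_INT closed_Collect_eq continuous_intros)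
    qed
    moreover have "B x \<in> W" if "x \<in> W" for x
      using that by (auto simp: W_def selfadj eig)
    moreover have "x0 \<in> W" using x0 by (simp add: W_def)
    ultimately obtain s y where y: "s > 0" "y \<in> W" "y \<noteq> 0" "B y = s *\<^sub>R y"
      using compact_positive_operator_eigenvector[OF B compact selfadj pos, of W x0] nz by blast
    have "y \<in> span (c s ` I s)"
      using Ic(3)[of s] y by (simp add: eigenspace_def)
    moreover have "orthogonal y z" if "z \<in> c s ` I s" for z
    proof -
      obtain j where j: "j \<in> I s" "z = c s j" using \<open>z \<in> c s ` I s\<close> by blast
      then have "l j = s" using Ic(1)[of s] y(1) by auto
      then have "j \<in> J" "z = v j" using j y(1) by (auto simp: J_def v_def)
      then show ?thesis using y(2) by (simp add: W_def orthogonal_def)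
    qed
    ultimately have "orthogonal y y" by (metis orthogonal_to_span)
    with y(3) show False by (simp add: orthogonal_self)
  qed
  with on eig lpos show ?thesis by blast
qed

section \<open>The regularization error in singular coordinates\<close>

text \<open>
  The key identity.  Put \<open>g j = L (v j) / sqrt (l j)\<close>, the singular vectors of \<open>K\<close> (with \<open>L\<close> its
  adjoint).  Testing the equation for \<open>x\<close> with \<open>h = L (v j)\<close> decouples it, because
  \<open>K (L (v j)) = l j *\<^sub>R v j\<close>, and yields the coefficient of \<open>x\<close> along \<open>g j\<close>.  Testing with an \<open>h\<close>
  orthogonal to all \<open>g j\<close>, for which \<open>K h = 0\<close>, shows that \<open>x\<close> has no further component.  Parseval's
  identity then gives the norm of \<open>x\<close>.  Here \<open>P\<close> stands for one realization of the noise and \<open>x\<close> for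
  the reconstruction error.
\<close>

lemma spectral_error_expansion:
  fixes K L :: "'a::{real_inner,banach} \<Rightarrow> 'a" and P :: "'a \<Rightarrow> real"
  assumes K: "linear K" and L: "\<And>x y. inner x (L y) = inner (K x) y"
    and on: "orthonormal_on J v" and eig: "\<And>j. j \<in> J \<Longrightarrow> K (L (v j)) = l j *\<^sub>R v j"
    and lpos: "\<And>j. j \<in> J \<Longrightarrow> l j > 0"
    and perp: "\<And>x. (\<And>j. j \<in> J \<Longrightarrow> inner x (v j) = 0) \<Longrightarrow> inner (K (L x)) x = 0"
    and P: "linear P" "\<And>h. K h = 0 \<Longrightarrow> P h = 0"
    and "\<alpha> > 0"
    and x: "\<And>h. inner (K x) (K h) + \<alpha> * inner x h = \<delta> * P h - \<alpha> * inner w (K h)"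
  shows "((\<lambda>j. l j * (\<delta> * P ((1 / l j) *\<^sub>R L (v j)) - \<alpha> * inner w (v j))\<^sup>2 / (l j + \<alpha>)\<^sup>2)
      has_sum (norm x)\<^sup>2) J"
proof -
  interpret K: linear K by fact
  interpret P: linear P by fact
  define g where "g j = (1 / sqrt (l j)) *\<^sub>R L (v j)" for j
  have LL: "inner (L y) (L z) = inner (K (L y)) z" for y z
    by (simp add: L)
  have g_on: "orthonormal_on J g"
    unfolding orthonormal_on_def
  proof (intro ballI)
    fix i j assume ij: "i \<in> J" "j \<in> J"
    have "inner (g i) (g j) = l i * inner (v i) (v j) / (sqrt (l i) * sqrt (l j))"
      by (simp add: g_def LL eig ij)
    also have "\<dots> = (if i = j then 1 else 0)"
      using on ij lpos[of i] by (auto simp: orthonormal_on_def)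
    finally show "inner (g i) (g j) = (if i = j then 1 else 0)" .
  qed
  have x_perp: "inner x h = 0" if h: "\<And>j. j \<in> J \<Longrightarrow> inner h (g j) = 0" for h
  proof -
    have "inner (K h) (v j) = 0" if "j \<in> J" for j
      using h[OF that] lpos[OF that] by (simp add: g_def L)
    \<comment> \<open>\<open>K h\<close> is orthogonal to all \<open>v j\<close>, hence in the kernel of \<open>L\<close>; but it also lies in the range of \<open>K\<close>\<close>
    then have "inner (K (L (K h))) (K h) = 0" by (rule perp)
    then have "L (K h) = 0" by (simp add: L[symmetric])
    then have "K h = 0" using L[of h "K h"] by simp
    with x[of h] P(2)[of h] \<open>\<alpha> > 0\<close> show ?thesis by simp
  qed
  have "(inner x (g j))\<^sup>2 =
      l j * (\<delta> * P ((1 / l j) *\<^sub>R L (v j)) - \<alpha> * inner w (v j))\<^sup>2 / (l j + \<alpha>)\<^sup>2" if j: "j \<in> J" for j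
  proof -
    define r where "r = \<delta> * P ((1 / l j) *\<^sub>R L (v j)) - \<alpha> * inner w (v j)"
    note l0 = lpos[OF j]
    have "inner (K x) (K (L (v j))) = l j * inner x (L (v j))"
      by (simp add: eig j L)
    with x[of "L (v j)"] have "(l j + \<alpha>) * inner x (L (v j)) = l j * r"
      using l0 by (simp add: eig j r_def P.scale algebra_simps)
    then have "inner x (L (v j)) = l j * r / (l j + \<alpha>)"
      using l0 \<open>\<alpha> > 0\<close> by (simp add: field_simps)
    then have "(inner x (g j))\<^sup>2 = (l j * r / (l j + \<alpha>))\<^sup>2 / l j"
      using l0 by (simp add: g_def power_divide power_mult_distrib)
    also have "\<dots> = l j * r\<^sup>2 / (l j + \<alpha>)\<^sup>2"
      using l0 by (simp add: power_divide power_mult_distrib power2_eq_square)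
    finally show ?thesis by (simp add: r_def)
  qed
  with parseval[OF g_on x_perp] show ?thesis
    by (simp cong: has_sum_cong)
qed

section \<open>Completeness of the space of square integrable functions\<close>

text \<open>
  By monotone convergence the pointwise sum has a finite integral, so it is finite almost everywhere.
\<close>

lemma AE_summable_if_summable_integrals:
  fixes f :: "nat \<Rightarrow> 'a \<Rightarrow> real"
  assumes f: "\<And>i. integrable M (f i)" "\<And>i x. 0 \<le> f i x"
    and sum: "summable (\<lambda>i. integral\<^sup>L M (f i))"
  shows "AE x in M. summable (\<lambda>i. f i x)"
proof -
  have [measurable]: "f i \<in> borel_measurable M" for i
    using f(1) by (rule borel_measurable_integrable)
  have "(\<integral>\<^sup>+x. (\<Sum>i. ennreal (f i x)) \<partial>M) = (\<Sum>i. \<integral>\<^sup>+x. ennreal (f i x) \<partial>M)"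
    by (rule nn_integral_suminf) measurable
  also have "\<dots> = (\<Sum>i. ennreal (integral\<^sup>L M (f i)))"
    using f by (simp add: nn_integral_eq_integral)
  also have "\<dots> \<noteq> \<infinity>"
    using f sum by (simp add: ennreal_suminf_neq_top)
  finally have "(\<integral>\<^sup>+x. (\<Sum>i. ennreal (f i x)) \<partial>M) \<noteq> \<infinity>" .
  then have "AE x in M. (\<Sum>i. ennreal (f i x)) \<noteq> \<infinity>"
    by (intro nn_integral_noteq_infinite) measurable
  then show ?thesis
    by eventually_elim (use f(2) in \<open>auto intro: summable_suminf_not_top\<close>)
qed

lemma torus_L2_representative:
  obtains f where "L2_fun f" "u = abs_torus_L2 f"
  using torus_L2.abs_induct[of "\<lambda>u. \<exists>f. L2_fun f \<and> u = abs_torus_L2 f" u]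
  unfolding L2_eq_def by blast

lemma L2_eq_refl: "L2_fun f \<Longrightarrow> L2_eq f f"
  by (simp add: L2_eq_def)

lemma inner_abs_torus_L2:
  "L2_fun f \<Longrightarrow> L2_fun g \<Longrightarrow> inner (abs_torus_L2 f) (abs_torus_L2 g) = (LINT x|torus. f x * g x)"
  by (rule inner_torus_L2.abs_eq) (simp_all add: L2_eq_refl)

lemma diff_abs_torus_L2:
  "L2_fun f \<Longrightarrow> L2_fun g \<Longrightarrow> abs_torus_L2 f - abs_torus_L2 g = abs_torus_L2 (\<lambda>x. f x - g x)"
  by (rule minus_torus_L2.abs_eq) (simp_all add: L2_eq_refl)

lemma norm_abs_torus_L2:
  "L2_fun f \<Longrightarrow> (norm (abs_torus_L2 f))\<^sup>2 = (LINT x|torus. (f x)\<^sup>2)"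
  unfolding power2_norm_eq_inner by (simp add: inner_abs_torus_L2 power2_eq_square)

lemma finite_measure_torus: "finite_measure (torus :: (real^'d) measure)"
  using emeasure_lborel_cbox_finite[of "0 :: real^'d" 1]
  by (intro finite_measureI) (simp add: space_restrict_space emeasure_restrict_space)

lemma L2_fun_bounded:
  assumes "f \<in> borel_measurable (torus :: (real^'d) measure)" "\<And>x. \<bar>f x\<bar> \<le> C"
  shows "L2_fun f"
proof -
  interpret finite_measure "torus :: (real^'d) measure" by (rule finite_measure_torus)
  have "(f x)\<^sup>2 \<le> C\<^sup>2" for x
    using power_mono[OF assms(2)[of x], of 2] by simp
  then have "integrable torus (\<lambda>x. (f x)\<^sup>2)"
    using assms(1) by (intro integrable_const_bound[where B = "C\<^sup>2"]) auto
  with assms(1) show ?thesis by (simp add: L2_fun_def)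
qed

lemma L2_fun_abs:
  assumes "L2_fun f"
  shows "L2_fun (\<lambda>x. \<bar>f x\<bar>)"
proof -
  have [measurable]: "f \<in> borel_measurable torus"
    using assms by (simp add: L2_fun_def)
  have "(\<lambda>x. \<bar>f x\<bar>) \<in> borel_measurable torus"
    by measurable
  with assms show ?thesis by (simp add: L2_fun_def)
qed

lemma L2_fun_integrable: "L2_fun f \<Longrightarrow> integrable torus f"
  using L2_fun_prod_integrable[of f "\<lambda>_. 1"] L2_fun_bounded[of "\<lambda>_. 1" 1] by simp

text \<open>
  Cauchy-Schwarz against the constant function: on a space of finite measure \<open>L\<^sup>2\<close> convergence controls
  \<open>L\<^sup>1\<close> convergence.
\<close>

lemma integral_abs_le_norm_L2:
  fixes f :: "real^'d \<Rightarrow> real"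
  assumes "L2_fun f"
  shows "(LINT x|torus. \<bar>f x\<bar>) \<le> norm (abs_torus_L2 f) * norm (abs_torus_L2 (\<lambda>_::real^'d. 1))"
proof -
  have 1: "L2_fun (\<lambda>_::real^'d. 1)" by (rule L2_fun_bounded[of _ 1]) auto
  have "(norm (abs_torus_L2 (\<lambda>x. \<bar>f x\<bar>)))\<^sup>2 = (norm (abs_torus_L2 f))\<^sup>2"
    using assms by (simp add: norm_abs_torus_L2 L2_fun_abs)
  then have "norm (abs_torus_L2 (\<lambda>x. \<bar>f x\<bar>)) = norm (abs_torus_L2 f)"
    by (rule power2_eq_imp_eq) auto
  then show ?thesis
    using norm_cauchy_schwarz[of "abs_torus_L2 (\<lambda>x. \<bar>f x\<bar>)" "abs_torus_L2 (\<lambda>_::real^'d. 1)"]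
    by (simp add: inner_abs_torus_L2 L2_fun_abs[OF assms] 1)
qed

lemma L2_fun_norm_le_if_nn_integral_le:
  assumes [measurable]: "f \<in> borel_measurable torus"
    and le: "(\<integral>\<^sup>+x. ennreal ((f x)\<^sup>2) \<partial>torus) \<le> ennreal (\<epsilon>\<^sup>2)" and "\<epsilon> \<ge> 0"
  shows "L2_fun f" "norm (abs_torus_L2 f) \<le> \<epsilon>"
proof -
  have int: "integrable torus (\<lambda>x. (f x)\<^sup>2)"
    using le_less_trans[OF le ennreal_less_top] by (intro integrableI_nonneg) auto
  then show f: "L2_fun f" by (simp add: L2_fun_def)
  have "ennreal ((norm (abs_torus_L2 f))\<^sup>2) \<le> ennreal (\<epsilon>\<^sup>2)"
    using le int by (simp add: nn_integral_eq_integral norm_abs_torus_L2[OF f])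
  then show "norm (abs_torus_L2 f) \<le> \<epsilon>"
    using \<open>\<epsilon> \<ge> 0\<close> power2_le_imp_le by (simp add: ennreal_le_iff)
qed

text \<open>
  Riesz-Fischer: along a subsequence with \<open>\<parallel>X (r (Suc n)) - X (r n)\<parallel> < (1/2)^n\<close> the increments of the
  representatives are absolutely summable almost everywhere, so the representatives converge pointwise;
  Fatou's lemma shows that the pointwise limit is also the limit in norm.
\<close>

instance torus_L2 :: (finite) banach
proof
  fix X :: "nat \<Rightarrow> 'a torus_L2"
  assume X: "Cauchy X"
  have "\<forall>n. \<exists>N. \<forall>i\<ge>N. \<forall>j\<ge>N. dist (X i) (X j) < (1/2)^n"
    using X unfolding Cauchy_def by simp
  then obtain N where N: "\<And>n i j. i \<ge> N n \<Longrightarrow> j \<ge> N n \<Longrightarrow> dist (X i) (X j) < (1/2)^n"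
    by metis
  \<comment> \<open>adding \<open>n\<close> and summing the \<open>N i\<close> makes \<open>r\<close> strictly increasing and at least \<open>N n\<close>\<close>
  define r where "r n = n + (\<Sum>i\<le>n. N i)" for n
  have r_mono: "strict_mono r"
    unfolding strict_mono_Suc_iff by (simp add: r_def)
  have rN: "r n \<ge> N n" for n
    using member_le_sum[of n "{..n}" N] by (simp add: r_def)
  have "\<exists>f. L2_fun f \<and> X (r n) = abs_torus_L2 f" for n
    by (metis torus_L2_representative)
  then obtain F where F: "\<And>n. L2_fun (F n)" "\<And>n. X (r n) = abs_torus_L2 (F n)"
    by metis
  have [measurable]: "F n \<in> borel_measurable torus" for n
    using F(1)[of n] by (simp add: L2_fun_def)
  have diff: "L2_fun (\<lambda>x. F k x - F n x)" for k n
    by (rule L2_fun_diff[OF F(1) F(1)])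
  have dist: "norm (abs_torus_L2 (\<lambda>x. F k x - F n x)) = dist (X (r k)) (X (r n))" for k n
    by (simp add: F diff_abs_torus_L2 dist_norm)
  define c where "c = norm (abs_torus_L2 (\<lambda>_::real^'a. 1))"
  have "AE x in torus. summable (\<lambda>n. \<bar>F (Suc n) x - F n x\<bar>)"
  proof (rule AE_summable_if_summable_integrals)
    show "integrable torus (\<lambda>x. \<bar>F (Suc i) x - F i x\<bar>)" for i
      using L2_fun_integrable[OF diff] by simp
    show "summable (\<lambda>n. LINT x|torus. \<bar>F (Suc n) x - F n x\<bar>)"
    proof (rule summable_comparison_test')
      show "summable (\<lambda>n. (1/2)^n * c)" by (intro summable_mult2 summable_geometric) simp
      fix n :: nat
      have "(LINT x|torus. \<bar>F (Suc n) x - F n x\<bar>) \<le> dist (X (r (Suc n))) (X (r n)) * c"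
        using integral_abs_le_norm_L2[OF diff, of "Suc n" n] by (simp add: dist c_def)
      also have "\<dots> \<le> (1/2)^n * c"
        using N[of n "r (Suc n)" "r n"] rN[of n] strict_monoD[OF r_mono, of n "Suc n"]
        by (intro mult_right_mono) (auto simp: c_def)
      finally show "norm (LINT x|torus. \<bar>F (Suc n) x - F n x\<bar>) \<le> (1/2)^n * c" by simp
    qed
  qed auto
  then have AE_conv: "AE x in torus. convergent (\<lambda>n. F n x)"
  proof eventually_elim
    case (elim x)
    then have "summable (\<lambda>n. F (Suc n) x - F n x)" by (rule summable_rabs_cancel)
    then have "convergent (\<lambda>n. \<Sum>i<n. F (Suc i) x - F i x)" by (simp add: summable_iff_convergent)
    then have "convergent (\<lambda>n. F n x - F 0 x)" by (simp only: sum_lessThan_telescope[of "\<lambda>n. F n x"])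
    then have "convergent (\<lambda>n. (F n x - F 0 x) + F 0 x)" by (intro convergent_add convergent_const)
    then show ?case by simp
  qed
  define G where "G x = lim (\<lambda>n. F n x)" for x
  have [measurable]: "G \<in> borel_measurable torus"
    unfolding G_def by (rule borel_measurable_lim_metric) measurable
  have G: "L2_fun (\<lambda>x. G x - F n x)" "norm (abs_torus_L2 (\<lambda>x. G x - F n x)) \<le> (1/2)^n" for n
  proof -
    have "AE x in torus. ennreal ((G x - F n x)\<^sup>2) = liminf (\<lambda>k. ennreal ((F k x - F n x)\<^sup>2))"
      using AE_conv
    proof eventually_elim
      case (elim x)
      then have "(\<lambda>k. F k x) \<longlonglongrightarrow> G x" by (simp add: G_def convergent_LIMSEQ_iff)
      then have "(\<lambda>k. ennreal ((F k x - F n x)\<^sup>2)) \<longlonglongrightarrow> ennreal ((G x - F n x)\<^sup>2)"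
        by (intro tendsto_intros)
      then show ?case by (intro lim_imp_Liminf[symmetric]) auto
    qed
    then have "(\<integral>\<^sup>+x. ennreal ((G x - F n x)\<^sup>2) \<partial>torus)
        = (\<integral>\<^sup>+x. liminf (\<lambda>k. ennreal ((F k x - F n x)\<^sup>2)) \<partial>torus)"
      by (rule nn_integral_cong_AE)
    also have "\<dots> \<le> liminf (\<lambda>k. \<integral>\<^sup>+x. ennreal ((F k x - F n x)\<^sup>2) \<partial>torus)"
      by (rule nn_integral_liminf) measurable
    also have "\<dots> \<le> liminf (\<lambda>k. ennreal (((1/2)^n)\<^sup>2))"
    proof (rule Liminf_mono, rule eventually_mono[OF eventually_ge_at_top[of n]])
      fix k assume "k \<ge> n"
      have "(\<integral>\<^sup>+x. ennreal ((F k x - F n x)\<^sup>2) \<partial>torus) = ennreal ((dist (X (r k)) (X (r n)))\<^sup>2)"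
        using diff[of k n]
        by (simp add: nn_integral_eq_integral L2_fun_def dist[symmetric] norm_abs_torus_L2)
      also have "dist (X (r k)) (X (r n)) < (1/2)^n"
        using \<open>k \<ge> n\<close> r_mono rN[of n] by (intro N) (auto simp: strict_mono_less_eq intro: order_trans)
      then have "ennreal ((dist (X (r k)) (X (r n)))\<^sup>2) \<le> ennreal (((1/2)^n)\<^sup>2)"
        by (intro ennreal_leI power_mono) auto
      finally show "(\<integral>\<^sup>+x. ennreal ((F k x - F n x)\<^sup>2) \<partial>torus) \<le> ennreal (((1/2)^n)\<^sup>2)" .
    qed
    also have "\<dots> = ennreal (((1/2)^n)\<^sup>2)" by (simp add: Liminf_const)
    finally have *: "(\<integral>\<^sup>+x. ennreal ((G x - F n x)\<^sup>2) \<partial>torus) \<le> ennreal (((1/2)^n)\<^sup>2)" .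
    show "L2_fun (\<lambda>x. G x - F n x)" "norm (abs_torus_L2 (\<lambda>x. G x - F n x)) \<le> (1/2)^n"
      using L2_fun_norm_le_if_nn_integral_le[OF _ *] by simp_all
  qed
  have "L2_fun G"
    using L2_fun_add[OF G(1)[of 0] F(1)[of 0]] by simp
  have "(\<lambda>n. X (r n)) \<longlonglongrightarrow> abs_torus_L2 G"
  proof (rule metric_tendsto_imp_tendsto[where f = "\<lambda>n. (1/2)^n" and a = "0 :: real"])
    show "(\<lambda>n. (1/2)^n) \<longlonglongrightarrow> (0::real)" by (rule LIMSEQ_power_zero) simp
    show "\<forall>\<^sub>F n in sequentially. dist (X (r n)) (abs_torus_L2 G) \<le> dist ((1/2)^n) (0::real)"
    proof (intro always_eventually allI)
      fix n
      have "dist (X (r n)) (abs_torus_L2 G) = norm (abs_torus_L2 G - abs_torus_L2 (F n))"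
        unfolding F dist_norm by (rule norm_minus_commute)
      also have "\<dots> \<le> (1/2)^n"
        using G(2)[of n] by (simp add: diff_abs_torus_L2 \<open>L2_fun G\<close> F(1))
      finally show "dist (X (r n)) (abs_torus_L2 G) \<le> dist ((1/2)^n) (0::real)" by simp
    qed
  qed
  then show "convergent X"
    using Cauchy_converges_subseq[OF X r_mono] by (auto simp: convergent_def o_def)
qed

section \<open>Orthonormality of the Hartley functions\<close>

definition freq_vec :: "int^'d \<Rightarrow> real^'d"
  where "freq_vec k = (\<chi> j. of_int (k $ j))"

lemma freq_phase_inner: "freq_phase k x = 2 * pi * inner (freq_vec k) x"
  by (simp add: freq_phase_def freq_vec_def inner_vec_def)

lemma freq_phase_add: "freq_phase (k + l) x = freq_phase k x + freq_phase l x"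
  by (simp add: freq_phase_def distrib_right sum.distrib distrib_left)

lemma freq_phase_uminus: "freq_phase (- k) x = - freq_phase k x"
  by (simp add: freq_phase_def sum_negf)

lemma freq_phase_diff: "freq_phase (k - l) x = freq_phase k x - freq_phase l x"
  using freq_phase_add[of k "- l" x] by (simp add: freq_phase_uminus)

lemma freq_phase_zero [simp]: "freq_phase 0 x = 0"
  by (simp add: freq_phase_def)

lemma freq_phase_axis: "freq_phase (axis i 1) x = 2 * pi * x $ i"
proof -
  have "(\<Sum>j\<in>UNIV. of_int ((axis i 1 :: int^'a) $ j) * x $ j) = (\<Sum>j\<in>UNIV. if j = i then x $ j else 0)"
    by (intro sum.cong) (auto simp: axis_def)
  then show ?thesis by (simp add: freq_phase_def)
qed

lemma continuous_on_freq_phase [continuous_intros]: "continuous_on S (freq_phase k)"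
  unfolding freq_phase_inner[abs_def] by (intro continuous_intros)

lemma borel_measurable_torus_if_continuous:
  fixes f :: "real^'d \<Rightarrow> 'b::topological_space"
  assumes "continuous_on UNIV f"
  shows "f \<in> borel_measurable torus"
  using borel_measurable_continuous_onI[OF assms]
  by (intro measurable_restrict_space1 measurable_completion) simp

lemma integral_cis_period:
  fixes n :: int
  shows "(LINT x|lborel. indicator {0..1} x *\<^sub>R cis (2 * pi * n * x)) = (if n = 0 then 1 else 0)"
proof (cases "n = 0")
  case True
  then show ?thesis by (simp add: measure_def)
next
  case False
  let ?c = "2 * pi * of_int n :: real"
  have c: "?c \<noteq> 0" using False by simp
  have "((\<lambda>x. cis (?c * x) * (- \<i> / ?c)) has_vector_derivative cis (?c * x)) (at x within {0..1})" for x
  proof -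
    have "((\<lambda>x. cis (?c * x)) has_derivative (\<lambda>t. (t * ?c) *\<^sub>R (\<i> * cis (?c * x)))) (at x within {0..1})"
      by (auto intro!: derivative_eq_intros has_derivative_cis simp: fun_eq_iff)
    from has_derivative_mult_left[OF this, of "- \<i> / ?c"]
    show ?thesis
      unfolding has_vector_derivative_def
      by (rule has_derivative_eq_rhs) (use c in \<open>simp add: fun_eq_iff scaleR_conv_of_real mult.commute[of "cis _" \<i>]\<close>)
  qed
  then have "(LINT x|lborel. indicator {0..1} x *\<^sub>R cis (?c * x))
      = cis (?c * 1) * (- \<i> / ?c) - cis (?c * 0) * (- \<i> / ?c)"
    by (intro integral_FTC_Icc) (auto intro!: continuous_intros)
  also have "\<dots> = 0" by simp
  finally show ?thesis using False by simp
qed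

text \<open>
  The cube is a product of intervals and the exponential a product of functions of one variable, so
  Fubini reduces the integral to one-dimensional ones, one of which vanishes unless \<open>k = 0\<close>.
\<close>

lemma integral_torus_cis:
  "(LINT x|torus. cis (freq_phase k x)) = (if k = (0 :: int^'d) then 1 else 0)"
proof -
  let ?g = "\<lambda>b t. indicator {0..1} t *\<^sub>R cis (2 * pi * inner (freq_vec k) b * t)"
  let ?h = "\<lambda>f. \<Sum>b\<in>Basis. f b *\<^sub>R b :: real^'d"
  interpret product_sigma_finite "\<lambda>_::real^'d. lborel :: real measure" ..
  have meas: "(\<lambda>x. indicator (cbox 0 1) x *\<^sub>R cis (freq_phase k x)) \<in> borel_measurable borel"
    unfolding freq_phase_inner
    by (intro borel_measurable_scaleR borel_measurable_indicator borel_measurable_continuous_onI continuous_intros) auto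
  have h: "?h \<in> (\<Pi>\<^sub>M b\<in>Basis. lborel) \<rightarrow>\<^sub>M borel"
    by measurable
  have "(LINT x|torus. cis (freq_phase k x))
      = (LINT x|lebesgue. indicator (cbox 0 1) x *\<^sub>R cis (freq_phase k x))"
    by (rule integral_restrict_space) simp
  also have "\<dots> = (LINT x|lborel. indicator (cbox 0 1) x *\<^sub>R cis (freq_phase k x))"
    using meas by (intro integral_completion) simp
  also have "\<dots> = (LINT f|(\<Pi>\<^sub>M b\<in>Basis. lborel). indicator (cbox 0 1) (?h f) *\<^sub>R cis (freq_phase k (?h f)))"
    by (subst lborel_eq) (rule integral_distr[OF h meas])
  also have "\<dots> = (LINT f|(\<Pi>\<^sub>M b\<in>Basis. lborel). (\<Prod>b\<in>Basis. ?g b (f b)))"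
  proof (rule Bochner_Integration.integral_cong[OF refl])
    fix f :: "real^'d \<Rightarrow> real"
    have "cis (freq_phase k (?h f)) = (\<Prod>b\<in>Basis. cis (2 * pi * inner (freq_vec k) b * f b))"
      by (simp add: freq_phase_inner inner_sum_right cis_conv_exp sum_distrib_left sum_distrib_right
          mult_ac flip: exp_sum)
    moreover have "indicator (cbox 0 1) (?h f) = (\<Prod>b\<in>Basis. indicator {0..1} (f b) :: real)"
    proof -
      have "inner (?h f) b = f b" if "b \<in> Basis" for b
        using that by simp
      moreover have "inner 0 b = 0" "inner 1 b = 1" if "b \<in> Basis" for b :: "real^'d"
        using that by (auto simp: Basis_vec_def inner_axis)
      ultimately have "?h f \<in> cbox 0 1 \<longleftrightarrow> (\<forall>b\<in>Basis. f b \<in> {0..1})"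
        by (simp add: mem_box)
      then show ?thesis
        by (auto simp: indicator_def intro!: prod.neutral[symmetric])
    qed
    ultimately show "indicator (cbox 0 1) (?h f) *\<^sub>R cis (freq_phase k (?h f)) = (\<Prod>b\<in>Basis. ?g b (f b))"
      by (simp add: scaleR_conv_of_real prod.distrib)
  qed
  also have "\<dots> = (\<Prod>b\<in>Basis. (LINT t|lborel. ?g b t))"
  proof (rule product_integral_prod)
    show "integrable lborel (?g b)" for b
      by (intro borel_integrable_compact continuous_intros) simp
  qed simp
  also have "\<dots> = (\<Prod>b\<in>Basis. if inner (freq_vec k) b = 0 then 1 else 0)"
  proof (rule prod.cong[OF refl])
    fix b :: "real^'d" assume "b \<in> Basis"
    then obtain i where "b = axis i 1" by (auto simp: Basis_vec_def)
    then have "inner (freq_vec k) b = of_int (k $ i)" by (simp add: inner_axis freq_vec_def)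
    then show "(LINT t|lborel. ?g b t) = (if inner (freq_vec k) b = 0 then 1 else 0)"
      using integral_cis_period[of "k $ i"] by simp
  qed
  also have "\<dots> = (if k = 0 then 1 else 0)"
  proof -
    have "k = 0 \<longleftrightarrow> freq_vec k = 0" by (simp add: freq_vec_def vec_eq_iff)
    also have "\<dots> \<longleftrightarrow> (\<forall>b\<in>Basis. inner (freq_vec k) b = 0)" by (simp add: euclidean_all_zero_iff)
    finally show ?thesis by auto
  qed
  finally show ?thesis .
qed

lemma integral_torus_cos: "(LINT x|torus. cos (freq_phase k x)) = (if k = (0 :: int^'d) then 1 else 0)"
  and integral_torus_sin: "(LINT x|torus. sin (freq_phase k x)) = 0"
proof -
  interpret finite_measure "torus :: (real^'d) measure" by (rule finite_measure_torus)
  have "integrable torus (\<lambda>x. cis (freq_phase k x))"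
    by (intro integrable_const_bound[where B = 1] borel_measurable_torus_if_continuous continuous_intros) auto
  from integral_Re[OF this] integral_Im[OF this]
  show "(LINT x|torus. cos (freq_phase k x)) = (if k = 0 then 1 else 0)"
    and "(LINT x|torus. sin (freq_phase k x)) = 0"
    by (simp_all add: integral_torus_cis)
qed

lemma L2_fun_cos_phase: "L2_fun (\<lambda>x. cos (freq_phase k x))"
  and L2_fun_sin_phase: "L2_fun (\<lambda>x. sin (freq_phase k x))"
  by (rule L2_fun_bounded[where C = 1];
      auto intro!: borel_measurable_torus_if_continuous continuous_intros)+

text \<open>
  The Hartley functions form a real orthonormal system indexed by the frequencies themselves.  With
  cosines and sines one would have to normalize the zero frequency differently and to keep only one of
  \<open>k\<close> and \<open>- k\<close>.
\<close>

definition hartley :: "int^'d \<Rightarrow> real^'d \<Rightarrow> real"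
  where "hartley k x = cos (freq_phase k x) + sin (freq_phase k x)"

definition hartley_basis :: "int^'d \<Rightarrow> 'd::finite torus_L2"
  where "hartley_basis k = abs_torus_L2 (hartley k)"

lemma L2_fun_hartley: "L2_fun (hartley k)"
  unfolding hartley_def[abs_def] by (intro L2_fun_add L2_fun_cos_phase L2_fun_sin_phase)

lemma integral_hartley_product:
  "(LINT x|torus. hartley k x * hartley l x) = (if k = l then 1 else 0)"
proof -
  have "hartley k x * hartley l x = cos (freq_phase (k - l) x) + sin (freq_phase (k + l) x)" for x
    by (simp add: hartley_def freq_phase_diff freq_phase_add cos_diff sin_add algebra_simps)
  then show ?thesis
    by (simp add: L2_fun_integrable[OF L2_fun_cos_phase] L2_fun_integrable[OF L2_fun_sin_phase]
        integral_torus_cos integral_torus_sin)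
qed

lemma orthonormal_hartley_basis: "orthonormal_on UNIV hartley_basis"
  by (simp add: orthonormal_on_def hartley_basis_def inner_abs_torus_L2 L2_fun_hartley
      integral_hartley_product)

section \<open>Completeness of the Hartley functions\<close>

text \<open>
  The linear span of the functions \<open>cos (freq_phase k x)\<close> and \<open>sin (freq_phase k x)\<close>, in a form suited
  to induction.
\<close>

inductive_set trig_poly :: "(real^'d \<Rightarrow> real) set" where
  trig_cos: "(\<lambda>x. cos (freq_phase k x)) \<in> trig_poly"
| trig_sin: "(\<lambda>x. sin (freq_phase k x)) \<in> trig_poly"
| trig_add: "f \<in> trig_poly \<Longrightarrow> g \<in> trig_poly \<Longrightarrow> (\<lambda>x. f x + g x) \<in> trig_poly"
| trig_scale: "f \<in> trig_poly \<Longrightarrow> (\<lambda>x. c * f x) \<in> trig_poly"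

lemma trig_poly_const: "(\<lambda>x. c) \<in> trig_poly"
  using trig_scale[OF trig_cos[of 0], of c] by simp

lemma trig_poly_sum:
  "finite A \<Longrightarrow> (\<And>i. i \<in> A \<Longrightarrow> f i \<in> trig_poly) \<Longrightarrow> (\<lambda>x. \<Sum>i\<in>A. f i x) \<in> trig_poly"
  by (induction A rule: finite_induct) (auto intro: trig_poly_const trig_add)

lemma trig_poly_mult_basic:
  assumes "g \<in> trig_poly"
  shows "(\<lambda>x. cos (freq_phase k x) * g x) \<in> trig_poly \<and> (\<lambda>x. sin (freq_phase k x) * g x) \<in> trig_poly"
  using assms
proof induction
  case (trig_cos l)
  have "(\<lambda>x. 1/2 * (cos (freq_phase (k - l) x) + cos (freq_phase (k + l) x))) \<in> trig_poly"
    "(\<lambda>x. 1/2 * (sin (freq_phase (k + l) x) + sin (freq_phase (k - l) x))) \<in> trig_poly"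
    by (intro trig_scale trig_add trig_poly.trig_cos trig_poly.trig_sin)+
  then show ?case
    by (simp add: freq_phase_diff freq_phase_add cos_times_cos sin_times_cos)
next
  case (trig_sin l)
  have "(\<lambda>x. 1/2 * (sin (freq_phase (k + l) x) + -1 * sin (freq_phase (k - l) x))) \<in> trig_poly"
    "(\<lambda>x. 1/2 * (cos (freq_phase (k - l) x) + -1 * cos (freq_phase (k + l) x))) \<in> trig_poly"
    by (intro trig_scale trig_add trig_poly.trig_cos trig_poly.trig_sin)+
  then show ?case
    by (simp add: freq_phase_diff freq_phase_add cos_times_sin sin_times_sin)
next
  case (trig_add f g)
  then show ?case by (simp add: distrib_left trig_poly.trig_add)
next
  case (trig_scale f c)
  then show ?case by (simp add: mult.left_commute[of _ c] trig_poly.trig_scale)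
qed

lemma trig_poly_mult:
  assumes "f \<in> trig_poly" "g \<in> trig_poly"
  shows "(\<lambda>x. f x * g x) \<in> trig_poly"
  using assms(1)
proof induction
  case (trig_add f1 f2)
  then show ?case by (simp add: distrib_right trig_poly.trig_add)
next
  case (trig_scale f c)
  then show ?case by (simp add: mult.assoc trig_poly.trig_scale)
qed (use trig_poly_mult_basic[OF assms(2)] in auto)

text \<open>
  The torus as a product of circles.  It identifies opposite faces of the cube, so continuous functions
  of the embedded point are the periodic ones, and polynomials in it are trigonometric polynomials;
  this makes the Stone-Weierstrass theorem applicable.
\<close>

definition torus_embedding :: "real^'d \<Rightarrow> (real^'d) \<times> (real^'d)"
  where "torus_embedding x = (\<chi> i. cos (2 * pi * x $ i), \<chi> i. sin (2 * pi * x $ i))"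

lemma continuous_on_torus_embedding: "continuous_on S torus_embedding"
  unfolding torus_embedding_def[abs_def] by (intro continuous_intros)

lemma trig_poly_torus_embedding:
  assumes "real_polynomial_function p"
  shows "(\<lambda>x. p (torus_embedding x)) \<in> trig_poly"
  using assms
proof induction
  case (linear f)
  then interpret bounded_linear f .
  have "(\<lambda>x. inner (torus_embedding x) b) \<in> trig_poly" if "b \<in> Basis" for b :: "(real^'a) \<times> (real^'a)"
    using that trig_cos[of "axis i 1" for i] trig_sin[of "axis i 1" for i]
    by (auto simp: Basis_prod_def Basis_vec_def torus_embedding_def inner_axis freq_phase_axis)
  then have "(\<lambda>x. \<Sum>b\<in>Basis. f b * inner (torus_embedding x) b) \<in> trig_poly"
    by (intro trig_poly_sum trig_scale) auto
  moreover have "f (torus_embedding x) = (\<Sum>b\<in>Basis. f b * inner (torus_embedding x) b)" for x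
  proof -
    have "f (torus_embedding x) = f (\<Sum>b\<in>Basis. inner (torus_embedding x) b *\<^sub>R b)"
      by (simp only: euclidean_representation)
    also have "\<dots> = (\<Sum>b\<in>Basis. f b * inner (torus_embedding x) b)"
      unfolding sum by (simp add: scale mult.commute)
    finally show ?thesis .
  qed
  ultimately show ?case by simp
next
  case (const c)
  show ?case by (rule trig_poly_const)
next
  case (add f g)
  then show ?case by (intro trig_add)
next
  case (mult f g)
  then show ?case by (intro trig_poly_mult)
qed

lemma torus_embedding_inj:
  assumes "torus_embedding x = torus_embedding y" "x \<in> cbox 0 1" "y \<in> box 0 1"
  shows "x = y"
proof -
  have "x $ i = y $ i" for i
  proof -
    have "cos (2 * pi * x $ i) = cos (2 * pi * y $ i)" "sin (2 * pi * x $ i) = sin (2 * pi * y $ i)"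
      using assms(1) by (auto simp: torus_embedding_def vec_eq_iff)
    then obtain n :: int where "2 * pi * x $ i = 2 * pi * y $ i + 2 * pi * n"
      using sin_cos_eq_iff by blast
    then have "2 * pi * (x $ i) = 2 * pi * (y $ i + n)" by (simp add: algebra_simps)
    then have n: "x $ i = y $ i + n" by simp
    have "0 \<le> x $ i" "x $ i \<le> 1" "0 < y $ i" "y $ i < 1"
      using assms(2,3) by (auto simp: mem_box_cart)
    with n have "real_of_int n < 1" "real_of_int n > -1" by linarith+
    then have "n = 0" by linarith
    with n show ?thesis by simp
  qed
  then show ?thesis by (simp add: vec_eq_iff)
qed

lemma integrable_mult_bounded:
  fixes f g :: "'a \<Rightarrow> real"
  assumes "integrable M f" "g \<in> borel_measurable M" "\<And>x. x \<in> space M \<Longrightarrow> \<bar>g x\<bar> \<le> C"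
  shows "integrable M (\<lambda>x. f x * g x)"
proof (rule Bochner_Integration.integrable_bound)
  show "integrable M (\<lambda>x. C * f x)" using assms(1) by simp
  show "(\<lambda>x. f x * g x) \<in> borel_measurable M"
    using borel_measurable_integrable[OF assms(1)] assms(2) by measurable
  have "\<bar>f x\<bar> * \<bar>g x\<bar> \<le> \<bar>C\<bar> * \<bar>f x\<bar>" if "x \<in> space M" for x
    using mult_right_mono[OF order_trans[OF assms(3)[OF that] abs_ge_self[of C]], of "\<bar>f x\<bar>"]
    by (simp add: mult.commute)
  then show "AE x in M. norm (f x * g x) \<le> norm (C * f x)"
    by (intro AE_I2) (simp add: abs_mult)
qed

lemma integral_trig_poly_orthogonal:
  fixes f :: "real^'d \<Rightarrow> real"
  assumes f: "integrable torus f"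
    and orth: "\<And>k. (LINT x|torus. f x * cos (freq_phase k x)) = 0"
      "\<And>k. (LINT x|torus. f x * sin (freq_phase k x)) = 0"
    and g: "g \<in> trig_poly"
  shows "integrable torus (\<lambda>x. f x * g x)" "(LINT x|torus. f x * g x) = 0"
proof -
  have "integrable torus (\<lambda>x. f x * g x) \<and> (LINT x|torus. f x * g x) = 0"
    using g
  proof induction
    case (trig_cos k)
    show ?case
      by (intro conjI integrable_mult_bounded[OF f, where C = 1] orth
          borel_measurable_torus_if_continuous continuous_intros) auto
  next
    case (trig_sin k)
    show ?case
      by (intro conjI integrable_mult_bounded[OF f, where C = 1] orth
          borel_measurable_torus_if_continuous continuous_intros) auto
  next
    case (trig_add g h)
    then show ?case by (simp add: distrib_left)
  next
    case (trig_scale g c)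
    then show ?case by (simp add: mult.left_commute[of _ c])
  qed
  then show "integrable torus (\<lambda>x. f x * g x)" "(LINT x|torus. f x * g x) = 0" by auto
qed

text \<open>
  By Stone-Weierstrass a continuous function is uniformly approximated on the embedded torus by
  polynomials, that is, by trigonometric polynomials, to which \<open>f\<close> is orthogonal.
\<close>

lemma integral_continuous_orthogonal:
  fixes f :: "real^'d \<Rightarrow> real" and g :: "(real^'d) \<times> (real^'d) \<Rightarrow> real"
  assumes f: "integrable torus f"
    and orth: "\<And>k. (LINT x|torus. f x * cos (freq_phase k x)) = 0"
      "\<And>k. (LINT x|torus. f x * sin (freq_phase k x)) = 0"
    and g: "continuous_on UNIV g"
  shows "integrable torus (\<lambda>x. f x * g (torus_embedding x))"
    and "(LINT x|torus. f x * g (torus_embedding x)) = 0"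
proof -
  have comp: "compact (torus_embedding ` cbox 0 (1::real^'d))"
    by (intro compact_continuous_image continuous_on_torus_embedding compact_cbox)
  have space: "space (torus :: (real^'d) measure) = cbox 0 1"
    by (simp add: space_restrict_space)
  have gE: "continuous_on UNIV (\<lambda>x. g (torus_embedding x))"
    by (rule continuous_on_compose2[OF g continuous_on_torus_embedding]) simp
  have "bounded (g ` torus_embedding ` cbox 0 (1::real^'d))"
    by (intro compact_imp_bounded compact_continuous_image comp continuous_on_subset[OF g]) simp
  then obtain C where "\<And>x. x \<in> cbox 0 (1::real^'d) \<Longrightarrow> \<bar>g (torus_embedding x)\<bar> \<le> C"
    unfolding bounded_iff by auto
  then show int: "integrable torus (\<lambda>x. f x * g (torus_embedding x))"
    by (intro integrable_mult_bounded[OF f borel_measurable_torus_if_continuous[OF gE]]) (auto simp: space)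
  have approx: "\<bar>LINT x|torus. f x * g (torus_embedding x)\<bar> \<le> \<epsilon> * (LINT x|torus. \<bar>f x\<bar>)" if "\<epsilon> > 0" for \<epsilon>
  proof -
    obtain p where p: "real_polynomial_function p"
      "\<And>z. z \<in> torus_embedding ` cbox 0 (1::real^'d) \<Longrightarrow> \<bar>g z - p z\<bar> < \<epsilon>"
      using Stone_Weierstrass_real_polynomial_function[OF comp continuous_on_subset[OF g] \<open>\<epsilon> > 0\<close>]
      by blast
    note pE = integral_trig_poly_orthogonal[OF f orth trig_poly_torus_embedding[OF p(1)]]
    have "(LINT x|torus. f x * g (torus_embedding x))
        = (LINT x|torus. f x * g (torus_embedding x) - f x * p (torus_embedding x))"
      using int pE by simp
    also have "\<bar>\<dots>\<bar> \<le> (LINT x|torus. \<bar>f x * g (torus_embedding x) - f x * p (torus_embedding x)\<bar>)"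
      by (rule integral_abs_bound)
    also have "\<dots> \<le> (LINT x|torus. \<epsilon> * \<bar>f x\<bar>)"
    proof (rule integral_mono)
      show "integrable torus (\<lambda>x. \<bar>f x * g (torus_embedding x) - f x * p (torus_embedding x)\<bar>)"
        using int pE(1) by simp
      show "integrable torus (\<lambda>x. \<epsilon> * \<bar>f x\<bar>)" using f by simp
      fix x :: "real^'d" assume "x \<in> space torus"
      then have "\<bar>g (torus_embedding x) - p (torus_embedding x)\<bar> \<le> \<epsilon>"
        using p(2)[of "torus_embedding x"] by (simp add: space less_imp_le)
      then show "\<bar>f x * g (torus_embedding x) - f x * p (torus_embedding x)\<bar> \<le> \<epsilon> * \<bar>f x\<bar>"
        using mult_left_mono[of _ \<epsilon> "\<bar>f x\<bar>"]
        by (simp add: right_diff_distrib[symmetric] abs_mult mult.commute[of \<epsilon>])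
    qed
    finally show ?thesis by simp
  qed
  show "(LINT x|torus. f x * g (torus_embedding x)) = 0"
  proof (rule ccontr)
    define I where "I = \<bar>LINT x|torus. f x * g (torus_embedding x)\<bar>"
    \<comment> \<open>the summand 1 keeps \<open>F\<close> positive when \<open>f\<close> vanishes almost everywhere\<close>
    define F where "F = (LINT x|torus. \<bar>f x\<bar>) + 1"
    assume "(LINT x|torus. f x * g (torus_embedding x)) \<noteq> 0"
    then have I: "I > 0" by (simp add: I_def)
    have "0 \<le> (LINT x|torus. \<bar>f x\<bar>)" by simp
    then have F: "F > 0" unfolding F_def by linarith
    have \<epsilon>: "I / (2 * F) > 0" using I F by simp
    have "I \<le> I / (2 * F) * (F - 1)" using approx[OF \<epsilon>] by (simp add: I_def F_def)
    also have "\<dots> \<le> I / (2 * F) * F" using \<epsilon> by (intro mult_left_mono) simp_all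
    also have "\<dots> = I / 2" using F by simp
    finally show False using I by simp
  qed
qed

text \<open>
  The indicator of a compact set in the open cube is the bounded pointwise limit of continuous
  functions of the embedded point: their supports shrink to the image of \<open>A\<close>, which is met only by
  points of \<open>A\<close> because the embedding is injective away from the boundary of the cube.
\<close>

lemma integral_compact_orthogonal:
  fixes f :: "real^'d \<Rightarrow> real"
  assumes f: "integrable torus f"
    and orth: "\<And>k. (LINT x|torus. f x * cos (freq_phase k x)) = 0"
      "\<And>k. (LINT x|torus. f x * sin (freq_phase k x)) = 0"
    and A: "compact A" "A \<subseteq> box 0 1" "A \<noteq> {}"
  shows "(LINT x|torus. f x * indicator A x) = 0"
proof -
  let ?E = "torus_embedding ` A"
  \<comment> \<open>tent functions that are 1 on the image of \<open>A\<close> and 0 from distance \<open>1 / n\<close> on\<close>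
  define g where "g n z = max 0 (1 - real n * infdist z ?E)" for n z
  have E: "closed ?E" "?E \<noteq> {}"
    using compact_imp_closed[OF compact_continuous_image[OF continuous_on_torus_embedding A(1)]] A(3)
    by auto
  have cont: "continuous_on UNIV (g n)" for n
    unfolding g_def[abs_def] by (intro continuous_intros)
  have bound: "0 \<le> g n z" "g n z \<le> 1" for n z
    using infdist_nonneg[of z ?E] by (auto simp: g_def)
  have lim: "(\<lambda>n. g n (torus_embedding x)) \<longlonglongrightarrow> indicator A x" if x: "x \<in> cbox 0 1" for x
  proof (cases "x \<in> A")
    case True
    then have "infdist (torus_embedding x) ?E = 0" by simp
    then show ?thesis using True by (simp add: g_def)
  next
    case False
    then have "torus_embedding x \<notin> ?E"
      using torus_embedding_inj[OF _ x] A(2) by blast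
    then have d: "infdist (torus_embedding x) ?E > 0"
      using in_closed_iff_infdist_zero[OF E] infdist_nonneg[of "torus_embedding x" ?E] by (simp add: less_le)
    obtain N :: nat where N: "1 / infdist (torus_embedding x) ?E < real N"
      using reals_Archimedean2 by blast
    have "g n (torus_embedding x) = 0" if "n \<ge> N" for n
    proof -
      have "1 / infdist (torus_embedding x) ?E \<le> real n" using N that by linarith
      then show ?thesis using d by (simp add: g_def field_simps)
    qed
    then have "(\<lambda>n. g n (torus_embedding x)) \<longlonglongrightarrow> 0"
      by (intro tendsto_eventually eventually_sequentiallyI[of N])
    then show ?thesis using False by simp
  qed
  have "(\<lambda>n. LINT x|torus. f x * g n (torus_embedding x)) \<longlonglongrightarrow> (LINT x|torus. f x * indicator A x)"
  proof (rule integral_dominated_convergence)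
    show "integrable torus (\<lambda>x. \<bar>f x\<bar>)" using f by simp
    have "A \<in> sets lebesgue" using A(1) by (simp add: compact_imp_closed borel_closed)
    then have "indicator A \<in> borel_measurable torus"
      by (intro measurable_restrict_space1 borel_measurable_indicator)
    with borel_measurable_integrable[OF f]
    show "(\<lambda>x. f x * indicator A x) \<in> borel_measurable torus" by measurable
    show "(\<lambda>x. f x * g n (torus_embedding x)) \<in> borel_measurable torus" for n
      by (intro borel_measurable_integrable integral_continuous_orthogonal(1)[OF f orth cont])
    show "AE x in torus. (\<lambda>n. f x * g n (torus_embedding x)) \<longlonglongrightarrow> f x * indicator A x"
      by (intro AE_I2 tendsto_mult tendsto_const lim) (simp add: space_restrict_space)
    show "AE x in torus. norm (f x * g n (torus_embedding x)) \<le> \<bar>f x\<bar>" for n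
      using bound by (intro AE_I2) (simp add: abs_mult mult_left_le)
  qed
  then show ?thesis
    by (simp add: integral_continuous_orthogonal(2)[OF f orth cont] LIMSEQ_const_iff)
qed

text \<open>
  By inner regularity the set where \<open>f\<close> is positive is exhausted up to measure \<open>e\<close> by a compact set
  \<open>T\<close>; since \<open>f\<close> is positive on \<open>T\<close> and has integral 0 over it, \<open>T\<close> is a null set.
\<close>

lemma null_sets_positive_part_if_orthogonal:
  fixes f :: "real^'d \<Rightarrow> real"
  assumes f: "integrable torus f"
    and orth: "\<And>k. (LINT x|torus. f x * cos (freq_phase k x)) = 0"
      "\<And>k. (LINT x|torus. f x * sin (freq_phase k x)) = 0"
  shows "{x \<in> box 0 1. 0 < f x} \<in> null_sets lebesgue"
proof -
  let ?P = "{x \<in> box 0 1. 0 < f x}"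
  have [measurable]: "f \<in> borel_measurable torus" using f by (rule borel_measurable_integrable)
  have box: "box 0 1 \<subseteq> cbox 0 (1::real^'d)" by (rule box_subset_cbox)
  have P: "?P \<in> sets lebesgue"
  proof -
    have "{x \<in> space torus. 0 < f x} \<in> sets torus" by measurable
    then have "{x \<in> cbox 0 1. 0 < f x} \<in> sets lebesgue"
      by (simp add: space_restrict_space sets_restrict_space_iff)
    then have "box 0 1 \<inter> {x \<in> cbox 0 1. 0 < f x} \<in> sets lebesgue" by (intro sets.Int) auto
    moreover have "box 0 1 \<inter> {x \<in> cbox 0 1. 0 < f x} = ?P" using box by blast
    ultimately show ?thesis by simp
  qed
  have "emeasure lebesgue ?P \<le> 0 + ennreal e" if "e > 0" for e :: real
  proof -
    obtain T where T: "closed T" "T \<subseteq> ?P" "?P - T \<in> lmeasurable" "emeasure lebesgue (?P - T) < ennreal e"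
      using sets_lebesgue_inner_closed[OF P \<open>e > 0\<close>] by blast
    have Tb: "T \<subseteq> box 0 1" "T \<in> sets lebesgue" using T(1,2) by (auto simp: borel_closed)
    have "bounded T" using bounded_subset[OF bounded_box Tb(1)] .
    then have "compact T" using T(1) by (simp add: compact_eq_bounded_closed)
    have "emeasure lebesgue T = 0"
    proof (cases "T = {}")
      case False
      have int: "integrable torus (\<lambda>x. f x * indicator T x)"
        using Tb(2) by (intro integrable_mult_bounded[OF f, where C = 1] measurable_restrict_space1
            borel_measurable_indicator) (auto simp: indicator_def)
      have nonneg: "AE x in torus. 0 \<le> f x * indicator T x"
        using T(2) by (intro AE_I2) (auto simp: indicator_def)
      have "AE x in torus. f x * indicator T x = 0"
        using integral_nonneg_eq_0_iff_AE[OF int nonneg]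
          integral_compact_orthogonal[OF f orth \<open>compact T\<close> Tb(1) False] by simp
      then have "AE x in torus. x \<notin> T"
        by eventually_elim (use T(2) in \<open>auto simp: indicator_def split: if_splits\<close>)
      then have "AE x in lebesgue. x \<in> cbox 0 1 \<longrightarrow> x \<notin> T"
        by (subst (asm) AE_restrict_space_iff) auto
      then have "AE x in lebesgue. x \<notin> T"
        by eventually_elim (use Tb(1) box in blast)
      then show ?thesis using Tb(2) AE_iff_measurable[of T lebesgue "\<lambda>x. x \<notin> T"] by simp
    qed simp
    have "emeasure lebesgue ?P = emeasure lebesgue (T \<union> (?P - T))"
      using T(2) by (intro arg_cong[where f = "emeasure lebesgue"]) blast
    also have "\<dots> \<le> emeasure lebesgue T + emeasure lebesgue (?P - T)"
      by (rule emeasure_subadditive[OF Tb(2) fmeasurableD[OF T(3)]])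
    also have "\<dots> \<le> 0 + ennreal e"
      using \<open>emeasure lebesgue T = 0\<close> T(4) by (intro add_mono) (simp_all only: order_refl less_imp_le)
    finally show ?thesis .
  qed
  then have "emeasure lebesgue ?P \<le> 0" by (rule ennreal_le_epsilon)
  then have "emeasure lebesgue ?P = 0" by (simp only: le_zero_eq)
  then show ?thesis by (rule null_setsI[OF _ P])
qed

lemma AE_zero_if_orthogonal_trig:
  fixes f :: "real^'d \<Rightarrow> real"
  assumes f: "integrable torus f"
    and orth: "\<And>k. (LINT x|torus. f x * cos (freq_phase k x)) = 0"
      "\<And>k. (LINT x|torus. f x * sin (freq_phase k x)) = 0"
  shows "AE x in torus. f x = 0"
proof -
  have pos: "{x \<in> box 0 1. 0 < f x} \<in> null_sets lebesgue"
    by (rule null_sets_positive_part_if_orthogonal[OF assms])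
  have neg: "{x \<in> box 0 1. 0 < - f x} \<in> null_sets lebesgue"
    using assms by (intro null_sets_positive_part_if_orthogonal) auto
  \<comment> \<open>the boundary of the cube, where the embedding is not injective, is a null set\<close>
  have "cbox 0 1 - box 0 (1::real^'d) \<in> null_sets lebesgue"
    using negligible_frontier_interval[of 0 "1::real^'d"] by (simp add: negligible_iff_null_sets)
  then have "AE x in lebesgue. x \<notin> cbox 0 (1::real^'d) - box 0 1" by (rule AE_not_in)
  moreover note AE_not_in[OF pos] AE_not_in[OF neg]
  ultimately have "AE x in lebesgue. x \<in> cbox 0 1 \<longrightarrow> f x = 0"
    by eventually_elim auto
  then show ?thesis by (subst AE_restrict_space_iff) auto
qed

lemma cos_phase_hartley: "cos (freq_phase k x) = (hartley k x + hartley (- k) x) / 2"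
  and sin_phase_hartley: "sin (freq_phase k x) = (hartley k x - hartley (- k) x) / 2"
  by (simp_all add: hartley_def freq_phase_uminus)

lemma hartley_basis_complete:
  fixes h :: "'d::finite torus_L2"
  assumes orth: "\<And>k. inner h (hartley_basis k) = 0"
  shows "h = 0"
proof -
  obtain f where f: "L2_fun f" "h = abs_torus_L2 f" by (rule torus_L2_representative)
  have int: "integrable torus (\<lambda>x. f x * hartley k x)" "(LINT x|torus. f x * hartley k x) = 0" for k
    using orth[of k] L2_fun_prod_integrable[OF f(1) L2_fun_hartley]
    by (simp_all add: f hartley_basis_def inner_abs_torus_L2 L2_fun_hartley)
  have "(\<lambda>x. f x * cos (freq_phase k x)) = (\<lambda>x. (f x * hartley k x + f x * hartley (- k) x) / 2)"
    "(\<lambda>x. f x * sin (freq_phase k x)) = (\<lambda>x. (f x * hartley k x - f x * hartley (- k) x) / 2)" for k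
    by (simp_all add: fun_eq_iff cos_phase_hartley sin_phase_hartley algebra_simps)
  then have "(LINT x|torus. f x * cos (freq_phase k x)) = 0"
    "(LINT x|torus. f x * sin (freq_phase k x)) = 0" for k
    by (simp_all only:) (simp_all add: int)
  then have "AE x in torus. f x = 0"
    by (intro AE_zero_if_orthogonal_trig L2_fun_integrable[OF f(1)])
  then have "(LINT x|torus. f x * f x) = 0"
    by (intro integral_eq_zero_AE) auto
  then have "inner h h = 0" by (simp add: f inner_abs_torus_L2)
  then show ?thesis by simp
qed

section \<open>Smooth functions and distributions on the torus\<close>

text \<open>
  A partial derivative of a combination of \<open>cos\<close> and \<open>sin\<close> with a fixed phase is again such a combination.
\<close>

lemma iter_pderiv_trig:
  "\<exists>a' b'. iter_pderiv js (\<lambda>x. a * cos (freq_phase k x) + b * sin (freq_phase k x)) =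
    (\<lambda>x. a' * cos (freq_phase k x) + b' * sin (freq_phase k x))"
proof (induction js)
  case (Cons j js)
  then obtain a' b' where IH: "iter_pderiv js (\<lambda>x. a * cos (freq_phase k x) + b * sin (freq_phase k x)) =
      (\<lambda>x. a' * cos (freq_phase k x) + b' * sin (freq_phase k x))" by blast
  let ?c = "2 * pi * inner (freq_vec k) (axis j 1)"
  have "frechet_derivative (\<lambda>x. a' * cos (freq_phase k x) + b' * sin (freq_phase k x)) (at x) (axis j 1)
      = (?c * b') * cos (freq_phase k x) + (- ?c * a') * sin (freq_phase k x)" for x
  proof -
    have "((\<lambda>x. a' * cos (freq_phase k x) + b' * sin (freq_phase k x)) has_derivative
        (\<lambda>h. 2 * pi * inner (freq_vec k) h * (b' * cos (freq_phase k x) - a' * sin (freq_phase k x)))) (at x)"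
      unfolding freq_phase_inner
      by (auto intro!: derivative_eq_intros simp: fun_eq_iff algebra_simps)
    then show ?thesis
      by (simp add: frechet_derivative_at[symmetric] algebra_simps)
  qed
  then show ?case
    unfolding iter_pderiv.simps IH
    by (intro exI[of _ "?c * b'"] exI[of _ "- ?c * a'"]) (simp only:)
qed auto

lemma differentiable_trig:
  "(\<lambda>x. a * cos (freq_phase k x) + b * sin (freq_phase k x)) differentiable at x"
  unfolding freq_phase_inner differentiable_def
  by (rule exI) (auto intro!: derivative_eq_intros)

lemma freq_phase_periodic: "freq_phase k (x + axis j 1) = freq_phase k x + 2 * pi * of_int (k $ j)"
  by (simp add: freq_phase_inner inner_add_right inner_axis freq_vec_def distrib_left)

lemma trig_torus_smooth:
  "(\<lambda>x. a * cos (freq_phase k x) + b * sin (freq_phase k x)) \<in> torus_smooth"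
proof -
  have "iter_pderiv js (\<lambda>x. a * cos (freq_phase k x) + b * sin (freq_phase k x)) differentiable at x" for js x
    using iter_pderiv_trig[of js a k b] differentiable_trig[of _ k _ x] by auto
  then show ?thesis
    by (simp add: torus_smooth_def freq_phase_periodic cos_add sin_add cos_integer_2pi sin_integer_2pi)
qed

lemma cos_phase_torus_smooth: "(\<lambda>x. cos (freq_phase k x)) \<in> torus_smooth"
  and sin_phase_torus_smooth: "(\<lambda>x. sin (freq_phase k x)) \<in> torus_smooth"
  and hartley_torus_smooth: "hartley k \<in> torus_smooth"
  using trig_torus_smooth[of 1 k 0] trig_torus_smooth[of 0 k 1] trig_torus_smooth[of 1 k 1]
  by (simp_all add: hartley_def[abs_def])

lemma iter_pderiv_periodic:
  fixes f :: "real^'d \<Rightarrow> real"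
  assumes "f \<in> torus_smooth"
  shows "iter_pderiv js f (x + axis j 1) = iter_pderiv js f x"
proof (induction js arbitrary: x)
  case Nil
  then show ?case using assms by (simp add: torus_smooth_def)
next
  case (Cons i js)
  let ?g = "iter_pderiv js f" and ?v = "axis j (1::real)"
  have "(?g has_derivative frechet_derivative ?g (at (x + ?v))) (at (x + ?v))"
    using assms by (simp add: torus_smooth_def frechet_derivative_works[symmetric])
  moreover have "((\<lambda>y. y + ?v) has_derivative (\<lambda>h. h)) (at x)"
    by (auto intro!: derivative_eq_intros)
  ultimately have "((\<lambda>y. ?g (y + ?v)) has_derivative frechet_derivative ?g (at (x + ?v))) (at x)"
    using has_derivative_compose by blast
  then have "(?g has_derivative frechet_derivative ?g (at (x + ?v))) (at x)"
    by (simp add: Cons.IH)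
  then show ?case by (simp add: frechet_derivative_at[symmetric])
qed

lemma periodic_integer_shift:
  fixes g :: "real^'d \<Rightarrow> real"
  assumes g: "\<And>x. g (x + axis j 1) = g x"
  shows "g (x + of_int n *\<^sub>R axis j 1) = g x"
proof -
  have nat: "g (y + real m *\<^sub>R axis j 1) = g y" for y m
  proof (induction m)
    case (Suc m)
    have "y + real (Suc m) *\<^sub>R axis j 1 = (y + real m *\<^sub>R axis j 1) + axis j 1"
      by (simp add: scaleR_left_distrib add.commute add.left_commute)
    then show ?case using g Suc by metis
  qed simp
  show ?thesis
  proof (cases "n \<ge> 0")
    case True
    then show ?thesis using nat[of x "nat n"] by simp
  next
    case False
    then have eq: "x + of_int n *\<^sub>R axis j 1 + real (nat (- n)) *\<^sub>R axis j 1 = x"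
      by simp
    show ?thesis using nat[of "x + of_int n *\<^sub>R axis j 1" "nat (- n)"] unfolding eq by simp
  qed
qed

text \<open>
  Every value is attained on the compact unit cube, by subtracting the integer part one coordinate at
  a time.
\<close>

lemma periodic_continuous_bounded:
  fixes g :: "real^'d \<Rightarrow> real"
  assumes per: "\<And>x j. g (x + axis j 1) = g x" and cont: "continuous_on UNIV g"
  shows "bdd_above (range (\<lambda>x. \<bar>g x\<bar>))"
proof -
  have reduce: "\<exists>y. g y = g x \<and> (\<forall>j\<in>S. 0 \<le> y $ j \<and> y $ j \<le> 1)" for S x
    using finite[of S]
  proof induction
    case (insert j S)
    then obtain y where y: "g y = g x" "\<forall>j\<in>S. 0 \<le> y $ j \<and> y $ j \<le> 1" by blast
    let ?y = "y + of_int (- \<lfloor>y $ j\<rfloor>) *\<^sub>R axis j 1"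
    have "g ?y = g y" by (rule periodic_integer_shift) (rule per)
    then have "g ?y = g x" using y(1) by simp
    moreover have "?y $ i = (if i = j then y $ j - \<lfloor>y $ j\<rfloor> else y $ i)" for i
      by (simp add: axis_def)
    moreover have "0 \<le> y $ j - \<lfloor>y $ j\<rfloor>" "y $ j - \<lfloor>y $ j\<rfloor> \<le> 1" by linarith+
    ultimately show ?case using y(2) by (intro exI[of _ ?y]) auto
  qed auto
  have "bounded (g ` cbox 0 1)"
    by (intro compact_imp_bounded compact_continuous_image continuous_on_subset[OF cont]) auto
  then obtain C where C: "\<And>y. y \<in> cbox 0 1 \<Longrightarrow> \<bar>g y\<bar> \<le> C" unfolding bounded_iff by auto
  have "\<bar>g x\<bar> \<le> C" for x
  proof -
    obtain y where "g y = g x" "\<forall>j. 0 \<le> y $ j \<and> y $ j \<le> 1" using reduce[of x UNIV] by auto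
    then show ?thesis using C[of y] by (simp add: mem_box_cart)
  qed
  then show ?thesis by (intro bdd_aboveI2)
qed

text \<open>
  The content is boundedness: the supremum of an unbounded set of reals is an arbitrary value, possibly
  negative.
\<close>

lemma SUP_iter_pderiv_nonneg:
  fixes f :: "real^'d \<Rightarrow> real"
  assumes f: "f \<in> torus_smooth"
  shows "0 \<le> (SUP x. \<bar>iter_pderiv js f x\<bar>)"
proof -
  have "continuous_on UNIV (iter_pderiv js f)"
    using f by (auto simp: torus_smooth_def intro!: continuous_at_imp_continuous_on
        differentiable_imp_continuous_within)
  then have "bdd_above (range (\<lambda>x. \<bar>iter_pderiv js f x\<bar>))"
    by (intro periodic_continuous_bounded iter_pderiv_periodic[OF f])
  then have "\<bar>iter_pderiv js f 0\<bar> \<le> (SUP x. \<bar>iter_pderiv js f x\<bar>)" by (rule cSUP_upper[OF UNIV_I])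
  then show ?thesis by linarith
qed

lemma C_norm_nonneg: "f \<in> torus_smooth \<Longrightarrow> 0 \<le> C_norm n f"
  unfolding C_norm_def by (intro sum_nonneg SUP_iter_pderiv_nonneg)

lemma C_norm_mono:
  fixes f :: "real^'d \<Rightarrow> real"
  assumes f: "f \<in> torus_smooth" and "m \<le> n"
  shows "C_norm m f \<le> C_norm n f"
  unfolding C_norm_def
proof (rule sum_mono2)
  show "finite {js :: 'd list. length js \<le> n}"
    using finite_lists_length_le[of "UNIV :: 'd set" n] by simp
  show "{js :: 'd list. length js \<le> m} \<subseteq> {js. length js \<le> n}" using \<open>m \<le> n\<close> by auto
qed (rule SUP_iter_pderiv_nonneg[OF f])

text \<open>
  Two distributions may be bounded by seminorms of different orders; monotonicity of the seminorms in
  their order provides a common one.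
\<close>

lemma torus_distributions_add_scale:
  assumes F: "F \<in> torus_distributions" and G: "G \<in> torus_distributions"
  shows "(\<lambda>\<phi>. F \<phi> + c * G \<phi>) \<in> torus_distributions"
proof -
  obtain C1 n1 where 1: "\<And>\<phi>. \<phi> \<in> torus_smooth \<Longrightarrow> \<bar>F \<phi>\<bar> \<le> C1 * C_norm n1 \<phi>"
    using F unfolding torus_distributions_def by blast
  obtain C2 n2 where 2: "\<And>\<phi>. \<phi> \<in> torus_smooth \<Longrightarrow> \<bar>G \<phi>\<bar> \<le> C2 * C_norm n2 \<phi>"
    using G unfolding torus_distributions_def by blast
  have "\<bar>F \<phi> + c * G \<phi>\<bar> \<le> (\<bar>C1\<bar> + \<bar>c\<bar> * \<bar>C2\<bar>) * C_norm (max n1 n2) \<phi>" if \<phi>: "\<phi> \<in> torus_smooth" for \<phi>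
  proof -
    have "\<bar>F \<phi>\<bar> \<le> \<bar>C1\<bar> * C_norm (max n1 n2) \<phi>"
      by (rule order_trans[OF 1[OF \<phi>]]) (intro mult_mono C_norm_mono C_norm_nonneg \<phi>; simp)
    moreover have "\<bar>c\<bar> * \<bar>G \<phi>\<bar> \<le> \<bar>c\<bar> * (\<bar>C2\<bar> * C_norm (max n1 n2) \<phi>)"
      by (intro mult_left_mono order_trans[OF 2[OF \<phi>]] mult_mono C_norm_mono C_norm_nonneg \<phi>; simp)
    moreover have "\<bar>F \<phi> + c * G \<phi>\<bar> \<le> \<bar>F \<phi>\<bar> + \<bar>c\<bar> * \<bar>G \<phi>\<bar>"
      using abs_triangle_ineq[of "F \<phi>" "c * G \<phi>"] by (simp add: abs_mult)
    ultimately show ?thesis by (simp add: distrib_right)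
  qed
  moreover have "F (\<lambda>x. \<phi> x + \<psi> x) + c * G (\<lambda>x. \<phi> x + \<psi> x) = (F \<phi> + c * G \<phi>) + (F \<psi> + c * G \<psi>)"
    "F (\<lambda>x. a * \<phi> x) + c * G (\<lambda>x. a * \<phi> x) = a * (F \<phi> + c * G \<phi>)"
    if "\<phi> \<in> torus_smooth" "\<psi> \<in> torus_smooth" for \<phi> \<psi> a
    using F G that unfolding torus_distributions_def by (auto simp: algebra_simps)
  ultimately show ?thesis unfolding torus_distributions_def by auto
qed

section \<open>Sobolev spaces in Hartley coordinates\<close>

lemma sobolev_weight_pos: "0 < sobolev_weight s k"
proof -
  have "0 \<le> (\<Sum>j\<in>UNIV. (real_of_int (k $ j))\<^sup>2)" by (intro sum_nonneg) simp
  then show ?thesis unfolding sobolev_weight_def by (intro powr_gt_zero[THEN iffD2]) linarith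
qed

lemma sobolev_weight_uminus: "sobolev_weight s (- k) = sobolev_weight s k"
  by (simp add: sobolev_weight_def)

lemma sobolev_weight_inverse: "sobolev_weight (- s) k = 1 / sobolev_weight s k"
  by (simp add: sobolev_weight_def powr_minus_divide)

lemma sobolev_weight_le_1: "s \<ge> 0 \<Longrightarrow> sobolev_weight (- s) k \<le> 1"
proof -
  assume "s \<ge> 0"
  have "0 \<le> (\<Sum>j\<in>UNIV. (real_of_int (k $ j))\<^sup>2)" by (intro sum_nonneg) simp
  then have "1 \<le> sobolev_weight s k"
    unfolding sobolev_weight_def using \<open>s \<ge> 0\<close> by (intro ge_one_powr_ge_zero) linarith+
  then show ?thesis by (simp add: sobolev_weight_inverse)
qed

lemma sum_japanese_bracket_int_bounded:
  fixes p :: real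
  assumes "p > 1 / 2"
  shows "\<exists>S. \<forall>n. (\<Sum>i\<in>{- int n..int n}. (1 + (real_of_int i)\<^sup>2) powr (- p)) \<le> S"
proof -
  let ?f = "\<lambda>i. (1 + (real_of_int i)\<^sup>2) powr (- p)"
  \<comment> \<open>starting at \<open>n = 1\<close>, where the comparison with a pure power is valid\<close>
  have "summable (\<lambda>n. ?f (int n))"
  proof (rule summable_comparison_test'[where N = 1])
    show "summable (\<lambda>n. real n powr (- 2 * p))" using assms by (simp add: summable_real_powr_iff)
    fix n :: nat assume "1 \<le> n"
    then have "(1 + (real n)\<^sup>2) powr (- p) \<le> ((real n)\<^sup>2) powr (- p)"
      using assms by (intro powr_mono2') auto
    also have "\<dots> = real n powr (- 2 * p)"
      using \<open>1 \<le> n\<close> by (simp add: powr_powr flip: powr_numeral)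
    finally show "norm (?f (int n)) \<le> real n powr (- 2 * p)" by simp
  qed
  then have S: "(\<Sum>i\<le>n. ?f (int i)) \<le> (\<Sum>i. ?f (int i))" for n
    by (intro sum_le_suminf) auto
  have "(\<Sum>i\<in>{- int n..int n}. ?f i) \<le> 2 * (\<Sum>i. ?f (int i))" for n
  proof -
    have "{- int n..int n} \<subseteq> int ` {..n} \<union> (\<lambda>i. - int i) ` {..n}"
    proof
      fix i assume "i \<in> {- int n..int n}"
      then show "i \<in> int ` {..n} \<union> (\<lambda>i. - int i) ` {..n}"
        by (cases "i \<ge> 0") (auto simp: image_iff intro: bexI[of _ "nat i"] bexI[of _ "nat (- i)"])
    qed
    then have "(\<Sum>i\<in>{- int n..int n}. ?f i) \<le> sum ?f (int ` {..n} \<union> (\<lambda>i. - int i) ` {..n})"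
      by (intro sum_mono2) auto
    also have "\<dots> \<le> sum ?f (int ` {..n}) + sum ?f ((\<lambda>i. - int i) ` {..n})"
      by (subst sum.union_inter[symmetric]) (auto intro!: sum_nonneg)
    also have "\<dots> = (\<Sum>i\<le>n. ?f (int i)) + (\<Sum>i\<le>n. ?f (int i))"
      by (simp add: sum.reindex inj_on_def)
    finally show ?thesis using S[of n] by linarith
  qed
  then show ?thesis by blast
qed

text \<open>
  Since every factor \<open>1 + (k $ j)\<^sup>2\<close> is at most \<open>1 + \<parallel>k\<parallel>\<^sup>2\<close>, their product over the \<open>d\<close> coordinates is at
  most the \<open>d\<close>-th power of it.  The weight is thus dominated by a product of one-dimensional weights of
  exponent \<open>t / d > 1/2\<close>, whose sum over a box factorizes.
\<close>

lemma sobolev_weight_summable: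
  assumes t: "t > real CARD('d) / 2"
  shows "(\<lambda>k :: int^'d. sobolev_weight (- t) k) summable_on UNIV"
proof -
  let ?d = "real CARD('d)"
  define f where "f i = (1 + (real_of_int i)\<^sup>2) powr (- (t / ?d))" for i
  have d: "?d > 0" by simp
  have "t > 0" using t d by linarith
  have "t / ?d > 1 / 2" using t d by (simp add: field_simps)
  then obtain S where S: "\<And>n. (\<Sum>i\<in>{- int n..int n}. f i) \<le> S"
    using sum_japanese_bracket_int_bounded unfolding f_def by blast
  have le_prod: "sobolev_weight (- t) k \<le> (\<Prod>j\<in>UNIV. f (k $ j))" for k :: "int^'d"
  proof -
    let ?b = "1 + (\<Sum>j\<in>UNIV. (real_of_int (k $ j))\<^sup>2)"
    have b: "?b > 0" by (intro add_pos_nonneg sum_nonneg) auto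
    have "(\<Prod>j\<in>UNIV. 1 + (real_of_int (k $ j))\<^sup>2) \<le> (\<Prod>j\<in>(UNIV :: 'd set). ?b)"
      by (intro prod_mono) (auto intro!: member_le_sum)
    then have le: "(\<Prod>j\<in>UNIV. 1 + (real_of_int (k $ j))\<^sup>2) \<le> ?b ^ CARD('d)" by simp
    have "sobolev_weight (- t) k = (?b ^ CARD('d)) powr (- (t / ?d))"
      using b by (simp add: sobolev_weight_def powr_powr flip: powr_realpow)
    also have "\<dots> \<le> (\<Prod>j\<in>UNIV. 1 + (real_of_int (k $ j))\<^sup>2) powr (- (t / ?d))"
      using le \<open>t > 0\<close> d by (intro powr_mono2') (auto intro!: prod_pos add_pos_nonneg)
    also have "\<dots> = (\<Prod>j\<in>UNIV. f (k $ j))"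
      unfolding f_def by (rule prod_powr_distrib)
    finally show ?thesis .
  qed
  have bound: "(\<Sum>k\<in>A. sobolev_weight (- t) k) \<le> S ^ CARD('d)" if A: "finite A" for A :: "(int^'d) set"
  proof -
    define n where "n = nat (Max (insert 0 ((\<lambda>(k, j). \<bar>k $ j\<bar>) ` (A \<times> UNIV))))"
    have n: "\<bar>k $ j\<bar> \<le> int n" if "k \<in> A" for k j
    proof -
      have "\<bar>k $ j\<bar> \<le> Max (insert 0 ((\<lambda>(k, j). \<bar>k $ j\<bar>) ` (A \<times> UNIV)))"
        using A that by (intro Max_ge) auto
      then show ?thesis unfolding n_def by linarith
    qed
    let ?B = "(\<lambda>g. \<chi> j. g j) ` (PiE UNIV (\<lambda>_::'d. {- int n..int n}))"
    have fin: "finite (PiE UNIV (\<lambda>_::'d. {- int n..int n}))" by (intro finite_PiE) auto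
    have "A \<subseteq> ?B"
    proof
      fix k assume "k \<in> A"
      then have "(\<lambda>j. k $ j) \<in> PiE UNIV (\<lambda>_::'d. {- int n..int n})"
        using n[of k] by (auto simp: abs_le_iff minus_le_iff)
      moreover have "k = (\<chi> j. k $ j)" by simp
      ultimately show "k \<in> ?B" by blast
    qed
    then have "(\<Sum>k\<in>A. sobolev_weight (- t) k) \<le> (\<Sum>k\<in>?B. sobolev_weight (- t) k)"
      using fin by (intro sum_mono2) (auto intro: less_imp_le[OF sobolev_weight_pos])
    also have "\<dots> \<le> (\<Sum>k\<in>?B. \<Prod>j\<in>UNIV. f (k $ j))"
      by (intro sum_mono le_prod)
    also have "\<dots> = (\<Sum>g\<in>PiE UNIV (\<lambda>_::'d. {- int n..int n}). \<Prod>j\<in>UNIV. f (g j))"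
      by (subst sum.reindex) (auto simp: inj_on_def fun_eq_iff vec_eq_iff)
    also have "\<dots> = (\<Prod>j\<in>(UNIV::'d set). \<Sum>i\<in>{- int n..int n}. f i)"
      by (rule prod_sum_PiE[symmetric]) auto
    also have "\<dots> \<le> S ^ CARD('d)"
      using S[of n] by (simp add: power_mono sum_nonneg f_def)
    finally show ?thesis .
  qed
  show ?thesis
    by (rule nonneg_bdd_above_summable_on)
      (auto intro!: bdd_aboveI2[where M = "S ^ CARD('d)"] bound less_imp_le[OF sobolev_weight_pos])
qed

lemma torus_distribution_hartley:
  assumes "F \<in> torus_distributions"
  shows "F (\<lambda>x. cos (freq_phase k x)) = (F (hartley k) + F (hartley (- k))) / 2"
    and "F (\<lambda>x. sin (freq_phase k x)) = (F (hartley k) - F (hartley (- k))) / 2"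
proof -
  let ?c = "\<lambda>x. cos (freq_phase k x)" and ?s = "\<lambda>x. sin (freq_phase k x)"
  have add: "F (\<lambda>x. \<phi> x + \<psi> x) = F \<phi> + F \<psi>" and scale: "F (\<lambda>x. a * \<phi> x) = a * F \<phi>"
    if "\<phi> \<in> torus_smooth" "\<psi> \<in> torus_smooth" for \<phi> \<psi> a
    using assms that unfolding torus_distributions_def by auto
  have s': "(\<lambda>x. -1 * sin (freq_phase k x)) \<in> torus_smooth"
    using trig_torus_smooth[of 0 k "-1"] by simp
  have "F (hartley k) = F ?c + F ?s"
    using add[OF cos_phase_torus_smooth sin_phase_torus_smooth] by (simp add: hartley_def[abs_def])
  moreover have "F (hartley (- k)) = F (\<lambda>x. ?c x + -1 * ?s x)"
    by (simp add: hartley_def[abs_def] freq_phase_uminus)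
  moreover have "\<dots> = F ?c - F ?s"
    unfolding add[OF cos_phase_torus_smooth s'] scale[OF sin_phase_torus_smooth sin_phase_torus_smooth]
    by simp
  ultimately show "F ?c = (F (hartley k) + F (hartley (- k))) / 2"
    "F ?s = (F (hartley k) - F (hartley (- k))) / 2"
    by simp_all
qed

lemma fourier_coeff_hartley:
  assumes "F \<in> torus_distributions"
  shows "fourier_coeff F k = Complex ((F (hartley k) + F (hartley (- k))) / 2)
    (- (F (hartley k) - F (hartley (- k))) / 2)"
  by (simp only: fourier_coeff_def torus_distribution_hartley[OF assms] minus_divide_left)

text \<open>
  The Hartley coefficients at \<open>k\<close> and \<open>- k\<close> carry the same information as the complex Fourier
  coefficient at \<open>k\<close>; as the Sobolev weights are even in \<open>k\<close>, all sums over frequencies can be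
  rewritten in terms of Hartley coefficients.
\<close>

lemma cmod_fourier_coeff:
  assumes "F \<in> torus_distributions"
  shows "(cmod (fourier_coeff F k))\<^sup>2 = ((F (hartley k))\<^sup>2 + (F (hartley (- k)))\<^sup>2) / 2"
  by (simp add: fourier_coeff_hartley[OF assms] cmod_power2 power_divide power2_sum power2_diff)
    (simp add: field_simps)

lemma summable_on_uminus_reindex:
  fixes f :: "'a::ab_group_add \<Rightarrow> 'b::{comm_monoid_add,t2_space}"
  shows "(\<lambda>k. f (- k)) summable_on UNIV \<longleftrightarrow> f summable_on UNIV"
    and "(\<Sum>\<^sub>\<infinity>k. f (- k)) = (\<Sum>\<^sub>\<infinity>k. f k)"
proof -
  have "bij (uminus :: 'a \<Rightarrow> 'a)" by (rule involuntory_imp_bij) simp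
  then show "(\<lambda>k. f (- k)) summable_on UNIV \<longleftrightarrow> f summable_on UNIV"
    and "(\<Sum>\<^sub>\<infinity>k. f (- k)) = (\<Sum>\<^sub>\<infinity>k. f k)"
    by (auto simp: summable_on_reindex_bij_betw infsum_reindex_bij_betw)
qed

lemma sobolev_iff_hartley:
  "F \<in> sobolev s \<longleftrightarrow> F \<in> torus_distributions \<and> (\<lambda>k. sobolev_weight s k * (F (hartley k))\<^sup>2) summable_on UNIV"
proof (cases "F \<in> torus_distributions")
  case True
  let ?a = "\<lambda>k. sobolev_weight s k * (F (hartley k))\<^sup>2"
  have eq: "sobolev_weight s k * (cmod (fourier_coeff F k))\<^sup>2 = 1/2 * (?a k + ?a (- k))" for k
    by (simp add: cmod_fourier_coeff[OF True] sobolev_weight_uminus distrib_left)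
  have nonneg: "0 \<le> ?a k" for k using sobolev_weight_pos[of s k] by simp
  have "(\<lambda>k. sobolev_weight s k * (cmod (fourier_coeff F k))\<^sup>2) summable_on UNIV \<longleftrightarrow> ?a summable_on UNIV"
  proof
    assume "?a summable_on UNIV"
    then have "(\<lambda>k. 1/2 * (?a k + ?a (- k))) summable_on UNIV"
      using summable_on_uminus_reindex(1)[of ?a] by (intro summable_on_cmult_right summable_on_add) auto
    then show "(\<lambda>k. sobolev_weight s k * (cmod (fourier_coeff F k))\<^sup>2) summable_on UNIV"
      unfolding eq .
  next
    assume "(\<lambda>k. sobolev_weight s k * (cmod (fourier_coeff F k))\<^sup>2) summable_on UNIV"
    then have "(\<lambda>k. 2 * (1/2 * (?a k + ?a (- k)))) summable_on UNIV"
      unfolding eq by (rule summable_on_cmult_right)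
    then show "?a summable_on UNIV"
      by (rule summable_on_comparison_test) (use nonneg in auto)
  qed
  with True show ?thesis by (simp add: sobolev_def)
qed (simp add: sobolev_def)

lemma abs_mult_weighted_le:
  fixes a b w :: real
  assumes "w > 0"
  shows "\<bar>a * b\<bar> \<le> w * a\<^sup>2 + 1 / w * b\<^sup>2"
proof -
  have "2 * (sqrt w * \<bar>a\<bar>) * (\<bar>b\<bar> / sqrt w) \<le> (sqrt w * \<bar>a\<bar>)\<^sup>2 + (\<bar>b\<bar> / sqrt w)\<^sup>2"
    by (rule sum_squares_bound)
  then have "2 * (\<bar>a\<bar> * \<bar>b\<bar>) \<le> w * a\<^sup>2 + 1 / w * b\<^sup>2"
    using assms by (simp add: power_mult_distrib power_divide)
  moreover have "0 \<le> \<bar>a\<bar> * \<bar>b\<bar>" by simp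
  ultimately show ?thesis unfolding abs_mult by linarith
qed

text \<open>
  The duality between \<open>H\<^sup>t\<close> and its dual on the level of coefficients.
\<close>

lemma weighted_product_summable:
  fixes a b :: "int^'d \<Rightarrow> real"
  assumes "(\<lambda>k. sobolev_weight t k * (a k)\<^sup>2) summable_on UNIV"
    and "(\<lambda>k. sobolev_weight (- t) k * (b k)\<^sup>2) summable_on UNIV"
  shows "(\<lambda>k. \<bar>a k * b k\<bar>) summable_on UNIV" "(\<lambda>k. a k * b k) summable_on UNIV"
proof -
  show abs: "(\<lambda>k. \<bar>a k * b k\<bar>) summable_on UNIV"
  proof (rule summable_on_comparison_test[OF summable_on_add[OF assms]])
    show "\<bar>a k * b k\<bar> \<le> sobolev_weight t k * (a k)\<^sup>2 + sobolev_weight (- t) k * (b k)\<^sup>2" for k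
      unfolding sobolev_weight_inverse by (rule abs_mult_weighted_le[OF sobolev_weight_pos])
  qed simp
  then show "(\<lambda>k. a k * b k) summable_on UNIV"
    using summable_on_iff_abs_summable_on_real by (metis (no_types, lifting) real_norm_def summable_on_cong)
qed

lemma sobolev_pairing_hartley:
  fixes F G :: "(real^'d \<Rightarrow> real) \<Rightarrow> real"
  assumes G: "G \<in> sobolev t" and F: "F \<in> sobolev (- t)"
  shows "sobolev_pairing G F = (\<Sum>\<^sub>\<infinity>k. G (hartley k) * F (hartley k))"
proof -
  have GD: "G \<in> torus_distributions" and FD: "F \<in> torus_distributions"
    using G F by (auto simp: sobolev_def)
  let ?p = "\<lambda>k. fourier_coeff G k * cnj (fourier_coeff F k)"
  let ?q = "\<lambda>k. G (hartley k) * F (hartley k)"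
  have q: "?q summable_on UNIV"
    using G F unfolding sobolev_iff_hartley by (elim conjE) (rule weighted_product_summable(2))
  have Gs: "(\<lambda>k. sobolev_weight t k * (cmod (fourier_coeff G k))\<^sup>2) summable_on UNIV"
    and Fs: "(\<lambda>k. sobolev_weight (- t) k * (cmod (fourier_coeff F k))\<^sup>2) summable_on UNIV"
    using G F by (simp_all add: sobolev_def)
  have norm: "norm (?p k) = \<bar>cmod (fourier_coeff G k) * cmod (fourier_coeff F k)\<bar>" for k
    by (simp add: norm_mult)
  have "(\<lambda>k. norm (?p k)) summable_on UNIV"
    unfolding norm by (rule weighted_product_summable(1)[OF Gs Fs])
  then have "?p summable_on UNIV"
    by (rule abs_summable_summable)
  from infsum_Re[OF this] have "sobolev_pairing G F = (\<Sum>\<^sub>\<infinity>k. Re (?p k))"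
    unfolding sobolev_pairing_def by (rule sym)
  also have "(\<lambda>k. Re (?p k)) = (\<lambda>k. 1/2 * (?q k + ?q (- k)))"
    by (simp add: fun_eq_iff fourier_coeff_hartley[OF GD] fourier_coeff_hartley[OF FD] field_simps)
  also have "(\<Sum>\<^sub>\<infinity>k. 1/2 * (?q k + ?q (- k))) = 1/2 * ((\<Sum>\<^sub>\<infinity>k. ?q k) + (\<Sum>\<^sub>\<infinity>k. ?q (- k)))"
    using q summable_on_uminus_reindex(1)[of ?q]
    by (subst infsum_cmult_right', subst infsum_add) auto
  also have "\<dots> = (\<Sum>\<^sub>\<infinity>k. ?q k)"
    by (simp add: summable_on_uminus_reindex(2)[of ?q])
  finally show ?thesis .
qed

lemma L2_distr_hartley: "L2_distr u (hartley k) = inner u (hartley_basis k)"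
  by (simp add: L2_distr_def hartley_basis_def)

lemma hartley_parseval:
  fixes u v :: "'d::finite torus_L2"
  shows "((\<lambda>k. (inner u (hartley_basis k))\<^sup>2) has_sum (norm u)\<^sup>2) UNIV"
    and "((\<lambda>k. inner u (hartley_basis k) * inner v (hartley_basis k)) has_sum inner u v) UNIV"
proof -
  have perp: "inner u h = 0" if "\<And>k. k \<in> UNIV \<Longrightarrow> inner h (hartley_basis k) = 0" for h :: "'d torus_L2"
    using hartley_basis_complete[of h] that by simp
  show "((\<lambda>k. (inner u (hartley_basis k))\<^sup>2) has_sum (norm u)\<^sup>2) UNIV"
    by (rule parseval[OF orthonormal_hartley_basis perp])
  show "((\<lambda>k. inner u (hartley_basis k) * inner v (hartley_basis k)) has_sum inner u v) UNIV"
    by (rule parseval_inner[OF orthonormal_hartley_basis perp])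
qed

text \<open>
  A single term of the Sobolev norm is bounded by the whole norm.  With summable weights this is the
  uniform decay of coefficients that makes \<open>K\<close> bounded on \<open>L\<^sup>2\<close> and \<open>K K\<^sup>*\<close> compact.
\<close>

lemma bounded_linear_sobolev_coefficients:
  assumes "bounded_linear_sobolev t K"
  shows "\<exists>C\<ge>0. \<forall>u k. (inner (K u) (hartley_basis k))\<^sup>2 \<le> C * sobolev_weight (- t) k * (norm u)\<^sup>2"
proof -
  obtain C where C: "\<And>u. sobolev_norm t (L2_distr (K u)) \<le> C * norm u"
    and H: "\<And>u. L2_distr (K u) \<in> sobolev t"
    using assms unfolding bounded_linear_sobolev_def by blast
  have "(inner (K u) (hartley_basis k))\<^sup>2 \<le> (2 * C\<^sup>2) * sobolev_weight (- t) k * (norm u)\<^sup>2" for u k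
  proof -
    let ?F = "L2_distr (K u)" and ?w = "sobolev_weight t"
    let ?f = "\<lambda>k. ?w k * (cmod (fourier_coeff ?F k))\<^sup>2"
    have sum: "?f summable_on UNIV" and D: "?F \<in> torus_distributions"
      using H[of u] by (auto simp: sobolev_def)
    have nonneg: "0 \<le> ?f k" for k using sobolev_weight_pos[of t k] by simp
    have "?w k * (inner (K u) (hartley_basis k))\<^sup>2 \<le> 2 * ?f k"
      using sobolev_weight_pos[of t k]
      by (simp add: cmod_fourier_coeff[OF D] L2_distr_hartley distrib_left)
    also have "?f k \<le> (\<Sum>\<^sub>\<infinity>k. ?f k)"
      using finite_sum_le_infsum[OF sum, of "{k}"] nonneg by simp
    also have "\<dots> = (sobolev_norm t ?F)\<^sup>2"
      using nonneg by (simp add: sobolev_norm_def infsum_nonneg)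
    also have "\<dots> \<le> (C * norm u)\<^sup>2"
      using C[of u] nonneg by (intro power_mono) (auto simp: sobolev_norm_def infsum_nonneg)
    finally show ?thesis
      using sobolev_weight_pos[of t k]
      by (simp add: sobolev_weight_inverse field_simps power_mult_distrib)
  qed
  then show ?thesis by (intro exI[of _ "2 * C\<^sup>2"]) auto
qed

lemma bounded_linear_if_bounded_linear_sobolev:
  fixes K :: "'d::finite torus_L2 \<Rightarrow> 'd torus_L2"
  assumes K: "bounded_linear_sobolev t K" and t: "t > real CARD('d) / 2"
  shows "bounded_linear K"
proof -
  obtain C where C: "C \<ge> 0" "\<And>u k. (inner (K u) (hartley_basis k))\<^sup>2 \<le> C * sobolev_weight (- t) k * (norm u)\<^sup>2"
    using bounded_linear_sobolev_coefficients[OF K] by blast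
  define S where "S = (\<Sum>\<^sub>\<infinity>k::int^'d. sobolev_weight (- t) k)"
  have S: "((\<lambda>k::int^'d. sobolev_weight (- t) k) has_sum S) UNIV"
    unfolding S_def by (rule has_sum_infsum[OF sobolev_weight_summable[OF t]])
  have S0: "S \<ge> 0" unfolding S_def by (intro infsum_nonneg less_imp_le[OF sobolev_weight_pos])
  have "norm (K u) \<le> norm u * sqrt (C * S)" for u
  proof (rule power2_le_imp_le)
    have "((\<lambda>k::int^'d. C * (norm u)\<^sup>2 * sobolev_weight (- t) k) has_sum C * (norm u)\<^sup>2 * S) UNIV"
      by (rule has_sum_cmult_right[OF S])
    from has_sum_mono[OF hartley_parseval(1)[of "K u"] this]
    have "(norm (K u))\<^sup>2 \<le> C * (norm u)\<^sup>2 * S" using C(2)[of u] by (simp add: mult_ac)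
    then show "(norm (K u))\<^sup>2 \<le> (norm u * sqrt (C * S))\<^sup>2"
      using C(1) S0 by (simp add: power_mult_distrib mult_ac)
  qed (use C(1) S0 in simp)
  then show ?thesis
    using K unfolding bounded_linear_sobolev_def
    by (intro bounded_linear_intro) (auto simp: linear_add linear_scale)
qed

section \<open>White noise in Hartley coordinates\<close>

lemma (in complete_measure) borel_measurable_if_AE_eq:
  fixes f g :: "'a \<Rightarrow> 'b::topological_space"
  assumes g: "g \<in> borel_measurable M" and eq: "AE x in M. f x = g x"
  shows "f \<in> borel_measurable M"
proof (rule measurableI)
  fix A :: "'b set" assume A: "A \<in> sets borel"
  show "f -` A \<inter> space M \<in> sets M"
  proof (rule in_sets_AE)
    show "g -` A \<inter> space M \<in> sets M" by (rule measurable_sets[OF g A])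
    show "AE x in M. x \<in> g -` A \<inter> space M \<longleftrightarrow> x \<in> f -` A \<inter> space M"
      using eq by eventually_elim auto
  qed auto
qed simp

text \<open>
  The noise coefficients are uncorrelated with unit variance.  They are square integrable because the
  integral of a square that is not integrable would be 0 by convention, and not 1.
\<close>

lemma gaussian_white_noise_hartley:
  fixes N :: "'w \<Rightarrow> (real^'d \<Rightarrow> real) \<Rightarrow> real"
  assumes N: "gaussian_white_noise M N"
  shows "(\<lambda>\<omega>. N \<omega> (hartley k)) \<in> borel_measurable M"
    and "integrable M (\<lambda>\<omega>. N \<omega> (hartley k) * N \<omega> (hartley l))"
    and "(LINT \<omega>|M. N \<omega> (hartley k) * N \<omega> (hartley l)) = (if k = l then 1 else 0)"
proof -
  have meas: "(\<lambda>\<omega>. N \<omega> (hartley k)) \<in> borel_measurable M" for k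
    using N hartley_torus_smooth[of k] by (auto simp: gaussian_white_noise_def centered_gaussian_def)
  have eq: "(LINT \<omega>|M. N \<omega> (hartley k) * N \<omega> (hartley l)) = (if k = l then 1 else 0)" for k l
    using N by (simp add: gaussian_white_noise_def hartley_torus_smooth integral_hartley_product)
  have sq: "integrable M (\<lambda>\<omega>. N \<omega> (hartley k) * N \<omega> (hartley k))" for k
    using eq[of k k] not_integrable_integral_eq by fastforce
  show "(\<lambda>\<omega>. N \<omega> (hartley k)) \<in> borel_measurable M" by (rule meas)
  show "(LINT \<omega>|M. N \<omega> (hartley k) * N \<omega> (hartley l)) = (if k = l then 1 else 0)" by (rule eq)
  show "integrable M (\<lambda>\<omega>. N \<omega> (hartley k) * N \<omega> (hartley l))"
  proof (rule Bochner_Integration.integrable_bound)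
    show "integrable M (\<lambda>\<omega>. N \<omega> (hartley k) * N \<omega> (hartley k) + N \<omega> (hartley l) * N \<omega> (hartley l))"
      by (intro Bochner_Integration.integrable_add sq)
    show "(\<lambda>\<omega>. N \<omega> (hartley k) * N \<omega> (hartley l)) \<in> borel_measurable M"
      by (intro borel_measurable_times meas)
    show "AE \<omega> in M. norm (N \<omega> (hartley k) * N \<omega> (hartley l))
        \<le> norm (N \<omega> (hartley k) * N \<omega> (hartley k) + N \<omega> (hartley l) * N \<omega> (hartley l))"
      using abs_mult_weighted_le[of 1] by (intro AE_I2) (simp add: power2_eq_square)
  qed
qed

lemma int_vec_enumeration: "\<exists>\<phi> :: nat \<Rightarrow> int^'d. bij \<phi>"
proof -
  have "inj (\<lambda>n::int. (\<chi> j. n) :: int^'d)" by (auto simp: inj_def vec_eq_iff)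
  then have "infinite (UNIV :: (int^'d) set)"
    using finite_imageD[of "\<lambda>n::int. (\<chi> j. n) :: int^'d" UNIV] infinite_UNIV_int
    by (meson finite_subset subset_UNIV)
  then show ?thesis
    using bij_betw_from_nat_into[of "UNIV :: (int^'d) set"] by auto
qed

text \<open>
  White noise almost surely has the regularity \<open>H\<^bsup>-t\<^esup>\<close> for \<open>t > d/2\<close>: the expected squared norm is
  the sum of the weights.
\<close>

lemma gaussian_white_noise_AE_weighted_summable:
  fixes N :: "'w \<Rightarrow> (real^'d \<Rightarrow> real) \<Rightarrow> real"
  assumes N: "gaussian_white_noise M N" and t: "t > real CARD('d) / 2"
  shows "AE \<omega> in M. (\<lambda>k. sobolev_weight (- t) k * (N \<omega> (hartley k))\<^sup>2) summable_on UNIV"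
proof -
  obtain \<phi> :: "nat \<Rightarrow> int^'d" where \<phi>: "bij \<phi>" using int_vec_enumeration by blast
  let ?f = "\<lambda>\<omega> k. sobolev_weight (- t) k * (N \<omega> (hartley k))\<^sup>2"
  have nonneg: "0 \<le> ?f \<omega> k" for \<omega> k using sobolev_weight_pos[of "- t" k] by simp
  have sq: "(N \<omega> (hartley k))\<^sup>2 = N \<omega> (hartley k) * N \<omega> (hartley k)" for \<omega> k
    by (rule power2_eq_square)
  have "AE \<omega> in M. summable (\<lambda>i. ?f \<omega> (\<phi> i))"
  proof (rule AE_summable_if_summable_integrals)
    show "integrable M (\<lambda>\<omega>. ?f \<omega> (\<phi> i))" for i
      unfolding sq by (intro integrable_mult_right gaussian_white_noise_hartley(2)[OF N])
    have "(\<lambda>i. sobolev_weight (- t) (\<phi> i)) summable_on UNIV"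
      using sobolev_weight_summable[OF t] summable_on_reindex_bij_betw[OF \<phi>] by blast
    then show "summable (\<lambda>i. LINT \<omega>|M. ?f \<omega> (\<phi> i))"
      unfolding sq by (simp add: gaussian_white_noise_hartley(3)[OF N] summable_on_imp_summable)
  qed (rule nonneg)
  then show ?thesis
  proof eventually_elim
    case (elim \<omega>)
    then have "(\<lambda>i. ?f \<omega> (\<phi> i)) summable_on UNIV"
      using nonneg by (intro summable_nonneg_imp_summable_on)
    then show ?case by (rule summable_on_reindex_bij_betw[OF \<phi>, of "?f \<omega>", THEN iffD1])
  qed
qed

text \<open>
  White noise paired with \<open>y \<in> H\<^sup>t\<close> has second moment at most \<open>\<parallel>y\<parallel>\<^sup>2\<close>, where the \<open>a k\<close> are the
  coefficients of \<open>y\<close>: this holds for the partial sums by orthonormality of the noise coefficients, and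
  passes to the almost sure limit by Fatou's lemma.  The inequality suffices for upper bounds.  The
  pairing is a sum that exists only almost surely, so a measurable version \<open>Z\<close> has to be provided.
\<close>

lemma gaussian_white_noise_functional:
  fixes N :: "'w \<Rightarrow> (real^'d \<Rightarrow> real) \<Rightarrow> real" and a :: "int^'d \<Rightarrow> real"
  assumes N: "gaussian_white_noise M N" and t: "t > real CARD('d) / 2"
    and a: "(\<lambda>k. sobolev_weight t k * (a k)\<^sup>2) summable_on UNIV" and s: "((\<lambda>k. (a k)\<^sup>2) has_sum s) UNIV"
  shows "\<exists>Z\<in>borel_measurable M. (AE \<omega> in M. Z \<omega> = (\<Sum>\<^sub>\<infinity>k. a k * N \<omega> (hartley k))) \<and>
    (\<integral>\<^sup>+\<omega>. ennreal ((Z \<omega>)\<^sup>2) \<partial>M) \<le> ennreal s"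
proof -
  obtain \<phi> :: "nat \<Rightarrow> int^'d" where \<phi>: "bij \<phi>" using int_vec_enumeration by blast
  let ?n = "\<lambda>\<omega> i. N \<omega> (hartley (\<phi> i))" and ?b = "\<lambda>i. a (\<phi> i)"
  note noise = gaussian_white_noise_hartley[OF N]
  have [measurable]: "(\<lambda>\<omega>. ?n \<omega> i) \<in> borel_measurable M" for i by (rule noise(1))
  \<comment> \<open>the series along an enumeration is measurable everywhere, also where it diverges\<close>
  define Z where "Z \<omega> = (\<Sum>i. ?b i * ?n \<omega> i)" for \<omega>
  define Zm where "Zm m \<omega> = (\<Sum>i<m. ?b i * ?n \<omega> i)" for m \<omega>
  have Z[measurable]: "Z \<in> borel_measurable M" unfolding Z_def[abs_def] by measurable
  have [measurable]: "Zm m \<in> borel_measurable M" for m unfolding Zm_def[abs_def] by measurable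
  have sums: "AE \<omega> in M. (\<lambda>i. ?b i * ?n \<omega> i) sums (\<Sum>\<^sub>\<infinity>k. a k * N \<omega> (hartley k))"
    using gaussian_white_noise_AE_weighted_summable[OF N t]
  proof eventually_elim
    case (elim \<omega>)
    have "((\<lambda>k. a k * N \<omega> (hartley k)) has_sum (\<Sum>\<^sub>\<infinity>k. a k * N \<omega> (hartley k))) UNIV"
      by (intro has_sum_infsum weighted_product_summable(2)[OF a elim])
    then have "((\<lambda>i. ?b i * ?n \<omega> i) has_sum (\<Sum>\<^sub>\<infinity>k. a k * N \<omega> (hartley k))) UNIV"
      using has_sum_reindex_bij_betw[OF \<phi>, of "\<lambda>k. a k * N \<omega> (hartley k)"] by simp
    then show ?case by (rule has_sum_imp_sums)
  qed
  then have eq: "AE \<omega> in M. Z \<omega> = (\<Sum>\<^sub>\<infinity>k. a k * N \<omega> (hartley k))"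
    by eventually_elim (simp add: Z_def sums_iff)
  have moment: "(\<integral>\<^sup>+\<omega>. ennreal ((Zm m \<omega>)\<^sup>2) \<partial>M) \<le> ennreal s" for m
  proof -
    have sq: "(Zm m \<omega>)\<^sup>2 = (\<Sum>i<m. \<Sum>j<m. ?b i * ?b j * (?n \<omega> i * ?n \<omega> j))" for \<omega>
      by (simp add: Zm_def power2_eq_square sum_product mult_ac)
    have "(LINT \<omega>|M. (Zm m \<omega>)\<^sup>2) = (\<Sum>i<m. \<Sum>j<m. ?b i * ?b j * (if \<phi> i = \<phi> j then 1 else 0))"
      unfolding sq by (subst Bochner_Integration.integral_sum;
          (intro Bochner_Integration.integrable_sum integrable_mult_right noise(2))?)
        (simp add: noise)
    also have "\<dots> = (\<Sum>i<m. \<Sum>j<m. if i = j then (?b i)\<^sup>2 else 0)"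
      using bij_is_inj[OF \<phi>] by (intro sum.cong refl) (auto simp: inj_eq power2_eq_square)
    also have "\<dots> = (\<Sum>i<m. (?b i)\<^sup>2)" by simp
    also have "\<dots> = (\<Sum>k\<in>\<phi> ` {..<m}. (a k)\<^sup>2)"
      using inj_on_subset[OF bij_is_inj[OF \<phi>]] by (simp add: sum.reindex)
    also have "\<dots> \<le> s" by (rule finite_sum_le_has_sum[OF s]) auto
    finally have "(LINT \<omega>|M. (Zm m \<omega>)\<^sup>2) \<le> s" .
    moreover have "integrable M (\<lambda>\<omega>. (Zm m \<omega>)\<^sup>2)"
      unfolding sq by (intro Bochner_Integration.integrable_sum integrable_mult_right noise(2))
    ultimately show ?thesis by (simp add: nn_integral_eq_integral ennreal_leI)
  qed
  have "(\<integral>\<^sup>+\<omega>. ennreal ((Z \<omega>)\<^sup>2) \<partial>M) = (\<integral>\<^sup>+\<omega>. liminf (\<lambda>m. ennreal ((Zm m \<omega>)\<^sup>2)) \<partial>M)"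
  proof (rule nn_integral_cong_AE)
    show "AE \<omega> in M. ennreal ((Z \<omega>)\<^sup>2) = liminf (\<lambda>m. ennreal ((Zm m \<omega>)\<^sup>2))"
      using sums
    proof eventually_elim
      case (elim \<omega>)
      then have "(\<lambda>m. Zm m \<omega>) \<longlonglongrightarrow> Z \<omega>"
        unfolding Zm_def Z_def by (simp add: sums_def sums_iff flip: sums_unique)
      then have "(\<lambda>m. ennreal ((Zm m \<omega>)\<^sup>2)) \<longlonglongrightarrow> ennreal ((Z \<omega>)\<^sup>2)"
        by (intro tendsto_intros)
      then show ?case by (intro lim_imp_Liminf[symmetric]) auto
    qed
  qed
  also have "\<dots> \<le> liminf (\<lambda>m. \<integral>\<^sup>+\<omega>. ennreal ((Zm m \<omega>)\<^sup>2) \<partial>M)"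
    by (rule nn_integral_liminf) measurable
  also have "\<dots> \<le> liminf (\<lambda>m. ennreal s)"
    by (intro Liminf_mono always_eventually allI moment)
  also have "\<dots> = ennreal s" by (simp add: Liminf_const)
  finally show ?thesis using Z eq by blast
qed

section \<open>The normal equation with noisy data\<close>

lemma quadratic_nonneg_imp_linear_zero:
  fixes b c :: real
  assumes "\<And>s. 0 \<le> s * b + s\<^sup>2 * c"
  shows "b = 0"
proof (rule ccontr)
  assume "b \<noteq> 0"
  define d where "d = \<bar>c\<bar> + 1"
  have d: "d > 0" "c \<le> d" by (auto simp: d_def)
  \<comment> \<open>the minimum of \<open>s * b + s\<^sup>2 * d\<close> over \<open>s\<close>\<close>
  define s where "s = - b / (2 * d)"
  have "s * b + s\<^sup>2 * c \<le> s * b + s\<^sup>2 * d" using d by (intro add_left_mono mult_left_mono) auto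
  also have "\<dots> = - b\<^sup>2 / (4 * d)" using d by (simp add: s_def power2_eq_square field_simps)
  also have "\<dots> < 0" using d \<open>b \<noteq> 0\<close> by simp
  finally show False using assms[of s] by simp
qed

text \<open>
  Along every line through the minimizer the functional is a quadratic polynomial, whose linear
  coefficient must vanish.
\<close>

lemma quadratic_minimizer_normal_equation:
  fixes K :: "'a::real_inner \<Rightarrow> 'b::real_inner" and p :: "'a \<Rightarrow> real"
  assumes K: "linear K" and p: "linear p"
    and min: "is_arg_min (\<lambda>u. 1/2 * (norm (K u))\<^sup>2 - p u + \<alpha> * (1/2 * (norm u)\<^sup>2)) (\<lambda>_. True) U"
  shows "inner (K U) (K h) + \<alpha> * inner U h = p h"
proof -
  interpret K: linear K by fact
  interpret p: linear p by fact
  let ?J = "\<lambda>u. 1/2 * (norm (K u))\<^sup>2 - p u + \<alpha> * (1/2 * (norm u)\<^sup>2)"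
  have expand: "(norm (a + s *\<^sub>R b))\<^sup>2 = (norm a)\<^sup>2 + 2 * s * inner a b + s\<^sup>2 * (norm b)\<^sup>2"
    for a b :: "'c::real_inner" and s
    by (simp add: power2_norm_eq_inner inner_add_left inner_add_right inner_commute[of b a]
        power2_eq_square[of s] algebra_simps)
  have "0 \<le> s * (inner (K U) (K h) + \<alpha> * inner U h - p h)
      + s\<^sup>2 * (1/2 * (norm (K h))\<^sup>2 + \<alpha> * (1/2 * (norm h)\<^sup>2))" for s
  proof -
    have "?J U \<le> ?J (U + s *\<^sub>R h)"
      using min by (simp add: is_arg_min_def not_less)
    then show ?thesis
      by (simp add: K.add K.scale p.add p.scale expand algebra_simps add_divide_distrib)
  qed
  then show ?thesis using quadratic_nonneg_imp_linear_zero by force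
qed

lemma subdifferential_quadratic_penalty: "\<mu> \<in> subdifferential quadratic_penalty u \<longleftrightarrow> \<mu> = u"
proof
  assume "\<mu> \<in> subdifferential quadratic_penalty u"
  then have "1/2 * (norm \<mu>)\<^sup>2 \<ge> 1/2 * (norm u)\<^sup>2 + inner \<mu> (\<mu> - u)"
    by (simp add: subdifferential_def quadratic_penalty_def)
  then have "(norm (\<mu> - u))\<^sup>2 \<le> 0"
    by (simp add: power2_norm_eq_inner inner_diff_left inner_diff_right inner_commute[of u \<mu>])
  then show "\<mu> = u" by simp
next
  assume "\<mu> = u"
  have "1/2 * (norm v)\<^sup>2 \<ge> 1/2 * (norm u)\<^sup>2 + inner u (v - u)" for v :: "'a torus_L2"
    using zero_le_power2[of "norm (v - u)"]
    by (simp add: power2_norm_eq_inner inner_diff_left inner_diff_right inner_commute[of v u])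
  with \<open>\<mu> = u\<close> show "\<mu> \<in> subdifferential quadratic_penalty u"
    by (simp add: subdifferential_def quadratic_penalty_def)
qed

lemma noisy_data_hartley:
  "noisy_data K u \<delta> n (hartley k) = inner (K u) (hartley_basis k) + \<delta> * n (hartley k)"
  by (simp add: noisy_data_def L2_distr_hartley)

lemma noisy_data_sobolev:
  assumes "L2_distr (K u) \<in> sobolev t" "t \<ge> 0" "n \<in> torus_distributions"
    and n: "(\<lambda>k. sobolev_weight (- t) k * (n (hartley k))\<^sup>2) summable_on UNIV"
  shows "noisy_data K u \<delta> n \<in> sobolev (- t)"
proof -
  let ?a = "\<lambda>k. inner (K u) (hartley_basis k)" and ?w = "sobolev_weight (- t)"
  have "noisy_data K u \<delta> n \<in> torus_distributions"
    using assms(1,3) unfolding noisy_data_def sobolev_def by (intro torus_distributions_add_scale) auto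
  moreover have "(\<lambda>k. ?w k * (?a k + \<delta> * n (hartley k))\<^sup>2) summable_on UNIV"
  proof (rule summable_on_comparison_test)
    show "(\<lambda>k. 2 * (?a k)\<^sup>2 + 2 * \<delta>\<^sup>2 * (?w k * (n (hartley k))\<^sup>2)) summable_on UNIV"
      by (intro summable_on_add summable_on_cmult_right n has_sum_imp_summable[OF hartley_parseval(1)])
    fix k :: "int^'a"
    \<comment> \<open>the smooth part is bounded crudely, by its \<open>L\<^sup>2\<close> norm and weights at most 1\<close>
    have "(?a k + \<delta> * n (hartley k))\<^sup>2 \<le> 2 * (?a k)\<^sup>2 + 2 * (\<delta> * n (hartley k))\<^sup>2"
      using sum_squares_bound[of "?a k" "\<delta> * n (hartley k)"] by (simp add: power2_sum)
    then have "?w k * (?a k + \<delta> * n (hartley k))\<^sup>2 \<le> ?w k * (2 * (?a k)\<^sup>2 + 2 * (\<delta> * n (hartley k))\<^sup>2)"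
      by (intro mult_left_mono less_imp_le[OF sobolev_weight_pos])
    also have "\<dots> = ?w k * (2 * (?a k)\<^sup>2) + 2 * \<delta>\<^sup>2 * (?w k * (n (hartley k))\<^sup>2)"
      by (simp add: algebra_simps)
    also have "\<dots> \<le> 2 * (?a k)\<^sup>2 + 2 * \<delta>\<^sup>2 * (?w k * (n (hartley k))\<^sup>2)"
      using sobolev_weight_le_1[OF \<open>t \<ge> 0\<close>, of k] less_imp_le[OF sobolev_weight_pos[of "- t" k]]
      by (intro add_right_mono mult_left_le_one_le) auto
    finally show "?w k * (?a k + \<delta> * n (hartley k))\<^sup>2
        \<le> 2 * (?a k)\<^sup>2 + 2 * \<delta>\<^sup>2 * (?w k * (n (hartley k))\<^sup>2)" .
  qed (intro mult_nonneg_nonneg zero_le_power2 less_imp_le[OF sobolev_weight_pos])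
  ultimately show ?thesis unfolding sobolev_iff_hartley noisy_data_hartley by blast
qed

text \<open>
  The duality pairing of \<open>K h\<close> with a realization \<open>n\<close> of the noise, in Hartley coordinates.
\<close>

definition noise_functional ::
  "('d::finite torus_L2 \<Rightarrow> 'd torus_L2) \<Rightarrow> ((real^'d \<Rightarrow> real) \<Rightarrow> real) \<Rightarrow> 'd torus_L2 \<Rightarrow> real"
  where "noise_functional K n h = (\<Sum>\<^sub>\<infinity>k. inner (K h) (hartley_basis k) * n (hartley k))"

lemma bounded_linear_sobolev_weighted_summable:
  assumes "bounded_linear_sobolev t K"
  shows "(\<lambda>k. sobolev_weight t k * (inner (K h) (hartley_basis k))\<^sup>2) summable_on UNIV"
  using assms sobolev_iff_hartley[of "L2_distr (K h)" t]
  by (simp add: bounded_linear_sobolev_def L2_distr_hartley)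

lemma linear_noise_functional:
  assumes K: "bounded_linear_sobolev t K"
    and n: "(\<lambda>k. sobolev_weight (- t) k * (n (hartley k))\<^sup>2) summable_on UNIV"
  shows "linear (noise_functional K n)"
proof -
  have lin: "linear K" using K by (simp add: bounded_linear_sobolev_def)
  have s: "(\<lambda>k. inner (K h) (hartley_basis k) * n (hartley k)) summable_on UNIV" for h
    by (rule weighted_product_summable(2)[OF bounded_linear_sobolev_weighted_summable[OF K] n])
  show ?thesis
  proof (rule linearI)
    show "noise_functional K n (x + y) = noise_functional K n x + noise_functional K n y" for x y
      unfolding noise_functional_def linear_add[OF lin] inner_add_left distrib_right
      by (rule infsum_add[OF s s])
    show "noise_functional K n (r *\<^sub>R x) = r *\<^sub>R noise_functional K n x" for r x
      unfolding noise_functional_def linear_scale[OF lin] inner_scaleR_left mult.assoc real_scaleR_def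
      by (rule infsum_cmult_right')
  qed
qed

text \<open>
  The exact part of the data turns into an \<open>L\<^sup>2\<close> inner product; this is Parseval's identity and uses the
  completeness of the trigonometric system.
\<close>

lemma sobolev_pairing_noisy_data:
  assumes K: "bounded_linear_sobolev t K" and "t \<ge> 0" "n \<in> torus_distributions"
    and n: "(\<lambda>k. sobolev_weight (- t) k * (n (hartley k))\<^sup>2) summable_on UNIV"
  shows "sobolev_pairing (L2_distr (K h)) (noisy_data K u \<delta> n)
    = inner (K h) (K u) + \<delta> * noise_functional K n h"
proof -
  have H: "L2_distr (K u) \<in> sobolev t" for u
    using K by (simp add: bounded_linear_sobolev_def)
  have data: "noisy_data K u \<delta> n \<in> sobolev (- t)"
    using assms H by (intro noisy_data_sobolev)
  have "sobolev_pairing (L2_distr (K h)) (noisy_data K u \<delta> n)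
      = (\<Sum>\<^sub>\<infinity>k. inner (K h) (hartley_basis k) * inner (K u) (hartley_basis k)
          + \<delta> * (inner (K h) (hartley_basis k) * n (hartley k)))"
    using sobolev_pairing_hartley[OF H[of h] data]
    by (simp add: L2_distr_hartley noisy_data_hartley algebra_simps)
  also have "\<dots> = (\<Sum>\<^sub>\<infinity>k. inner (K h) (hartley_basis k) * inner (K u) (hartley_basis k))
      + (\<Sum>\<^sub>\<infinity>k. \<delta> * (inner (K h) (hartley_basis k) * n (hartley k)))"
    by (intro infsum_add has_sum_imp_summable[OF hartley_parseval(2)] summable_on_cmult_right
        weighted_product_summable(2)[OF bounded_linear_sobolev_weighted_summable[OF K] n])
  also have "\<dots> = inner (K h) (K u) + \<delta> * noise_functional K n h"
    by (simp only: infsumI[OF hartley_parseval(2)] infsum_cmult_right' noise_functional_def)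
  finally show ?thesis .
qed

text \<open>
  The normal equation of the minimizer, with the exact solution subtracted.  The source condition turns
  \<open>inner u h\<close> into \<open>inner w (K h)\<close>.
\<close>

lemma tikhonov_error_equation:
  assumes K: "bounded_linear_sobolev t K" and "t \<ge> 0" "n \<in> torus_distributions"
    and n: "(\<lambda>k. sobolev_weight (- t) k * (n (hartley k))\<^sup>2) summable_on UNIV"
    and L: "\<And>x y. inner x (L y) = inner (K x) y" and u: "u = L w"
    and U: "is_arg_min (variational_functional K quadratic_penalty \<alpha> (noisy_data K u \<delta> n)) (\<lambda>_. True) U"
  shows "inner (K (U - u)) (K h) + \<alpha> * inner (U - u) h
    = \<delta> * noise_functional K n h - \<alpha> * inner w (K h)"
proof -
  have lin: "linear K" using K by (simp add: bounded_linear_sobolev_def)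
  interpret K: linear K by fact
  interpret p: linear "noise_functional K n" by (rule linear_noise_functional[OF K n])
  have eq: "variational_functional K quadratic_penalty \<alpha> (noisy_data K u \<delta> n)
      = (\<lambda>v. 1/2 * (norm (K v))\<^sup>2 - (inner (K v) (K u) + \<delta> * noise_functional K n v)
          + \<alpha> * (1/2 * (norm v)\<^sup>2))"
    by (simp add: fun_eq_iff variational_functional_def quadratic_penalty_def
        sobolev_pairing_noisy_data[OF assms(1-4)])
  have "linear (\<lambda>v. inner (K v) (K u) + \<delta> * noise_functional K n v)"
    by (intro linearI) (simp_all add: K.add K.scale p.add p.scale inner_add_left algebra_simps)
  then have "inner (K U) (K h) + \<alpha> * inner U h = inner (K h) (K u) + \<delta> * noise_functional K n h"
    by (rule quadratic_minimizer_normal_equation[OF lin _ U[unfolded eq]])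
  moreover have "inner u h = inner w (K h)"
    using L[of h w] by (simp add: u inner_commute)
  ultimately show ?thesis
    by (simp add: K.diff inner_diff_left inner_commute[of "K h"] algebra_simps)
qed

section \<open>The expected error and its rate\<close>

lemma has_sum_nat_imp_sums:
  fixes f :: "nat \<Rightarrow> real"
  assumes "(f has_sum s) J"
  shows "(\<lambda>j. if j \<in> J then f j else 0) sums s"
proof -
  have "((\<lambda>j. if j \<in> J then f j else 0) has_sum s) UNIV \<longleftrightarrow> (f has_sum s) J"
    by (rule has_sum_cong_neutral) auto
  with assms show ?thesis by (intro has_sum_imp_sums) simp
qed

lemma finite_level_sets_if_summable_powr:
  fixes l :: "nat \<Rightarrow> real"
  assumes "summable (\<lambda>j. l j powr m)" "\<mu> \<noteq> 0"
  shows "finite {j. l j = \<mu>}"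
proof -
  have "(\<lambda>j. l j powr m) \<longlonglongrightarrow> 0" by (rule summable_LIMSEQ_zero[OF assms(1)])
  moreover have "0 < \<mu> powr m" using assms(2) by simp
  ultimately have "eventually (\<lambda>j. l j powr m < \<mu> powr m) sequentially" by (rule order_tendstoD(2))
  then obtain N where N: "\<And>j. j \<ge> N \<Longrightarrow> l j powr m < \<mu> powr m"
    unfolding eventually_sequentially by blast
  have "{j. l j = \<mu>} \<subseteq> {..<N}" using N by (force simp: not_le[symmetric])
  then show ?thesis by (rule finite_subset) simp
qed

text \<open>
  The first bound interpolates: one splits \<open>l = l powr m * l powr (1 - m)\<close> and estimates the second
  factor by \<open>(l + \<alpha>) powr (1 - m)\<close>.  It trades the summability of \<open>l powr m\<close> for a negative power of
  \<open>\<alpha>\<close> and governs the variance; the second bound governs the bias.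
\<close>

lemma spectral_filter_bounds:
  fixes l \<alpha> m :: real
  assumes "0 < l" "0 < \<alpha>" "0 < m" "m \<le> 1"
  shows "l / (l + \<alpha>)\<^sup>2 \<le> \<alpha> powr (- 1 - m) * l powr m" and "l * \<alpha>\<^sup>2 / (l + \<alpha>)\<^sup>2 \<le> \<alpha>"
proof -
  have "l = l powr m * l powr (1 - m)" using assms by (simp flip: powr_add)
  also have "\<dots> \<le> l powr m * (l + \<alpha>) powr (1 - m)"
    using assms by (intro mult_left_mono powr_mono2) auto
  finally have "l / (l + \<alpha>)\<^sup>2 \<le> l powr m * (l + \<alpha>) powr (1 - m) / (l + \<alpha>)\<^sup>2"
    using assms by (intro divide_right_mono) auto
  also have "\<dots> = l powr m * ((l + \<alpha>) powr (1 - m) * (l + \<alpha>) powr (- 2))"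
    using assms by (simp add: powr_minus_divide)
  also have "\<dots> = l powr m * (l + \<alpha>) powr (- 1 - m)"
    by (simp flip: powr_add)
  also have "\<dots> \<le> l powr m * \<alpha> powr (- 1 - m)"
    using assms by (intro mult_left_mono powr_mono2') auto
  finally show "l / (l + \<alpha>)\<^sup>2 \<le> \<alpha> powr (- 1 - m) * l powr m" by (simp add: mult.commute)
  have "l * \<alpha> \<le> (l + \<alpha>)\<^sup>2" using assms by (simp add: power2_sum)
  then have "l * \<alpha> * \<alpha> \<le> (l + \<alpha>)\<^sup>2 * \<alpha>" using assms by (intro mult_right_mono) auto
  then show "l * \<alpha>\<^sup>2 / (l + \<alpha>)\<^sup>2 \<le> \<alpha>"
    using assms by (simp add: pos_divide_le_eq power2_eq_square[of \<alpha>] mult.commute mult.left_commute)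
qed

text \<open>
  The bias-variance estimate at a fixed noise level.  In the expansion of the error along the singular
  vectors of \<open>K\<close>, the noise contributes at most \<open>\<delta>\<^sup>2 * l j / (l j + \<alpha>)\<^sup>2\<close> to the expected square of the
  \<open>j\<close>-th coefficient and the source element contributes \<open>\<alpha>\<^sup>2 * l j / (l j + \<alpha>)\<^sup>2 * (inner w (v j))\<^sup>2\<close>.
  Summing over \<open>j\<close> with the filter bounds and Bessel's inequality gives the two terms; the factor 2
  comes from separating them.  The expansion also makes the squared error measurable, as it expresses it
  almost surely by measurable functions and the probability space is complete.
\<close>

lemma expected_tikhonov_error_bound:
  fixes K :: "'d::finite torus_L2 \<Rightarrow> 'd torus_L2"
    and N :: "'w \<Rightarrow> (real^'d \<Rightarrow> real) \<Rightarrow> real"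
  assumes t: "t > real CARD('d) / 2" and K: "bounded_linear_sobolev t K"
    and M: "prob_space M" "complete_measure M" and N: "gaussian_white_noise M N"
    and l: "eigenvalue_sequence (K \<circ> adjoint K) l"
    and m: "0 < m" "m \<le> 1" and sum: "summable (\<lambda>j. l j powr m)"
    and u: "u = adjoint K w" and "\<alpha> > 0"
    and U: "AE \<omega> in M. noisy_data K u \<delta> (N \<omega>) \<in> sobolev (- t) \<longrightarrow>
      is_arg_min (variational_functional K quadratic_penalty \<alpha> (noisy_data K u \<delta> (N \<omega>))) (\<lambda>_. True) (U \<omega>)"
  shows "integrable M (\<lambda>\<omega>. (norm (U \<omega> - u))\<^sup>2)"
    and "(LINT \<omega>|M. (norm (U \<omega> - u))\<^sup>2)
      \<le> 2 * \<delta>\<^sup>2 * \<alpha> powr (- 1 - m) * (\<Sum>j. l j powr m) + 2 * \<alpha> * (norm w)\<^sup>2"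
proof -
  interpret prob_space M by fact
  interpret complete_measure M by fact
  define L where "L = adjoint K"
  have "t \<ge> 0" using t by (meson divide_nonneg_pos less_imp_le of_nat_0_le_iff order_trans zero_less_numeral)
  have K': "bounded_linear K" by (rule bounded_linear_if_bounded_linear_sobolev[OF K t])
  have lin: "linear K" using K by (simp add: bounded_linear_sobolev_def)
  have L: "inner x (L y) = inner (K x) y" for x y
    unfolding L_def by (rule inner_adjoint[OF orthonormal_hartley_basis hartley_basis_complete K'])
  have L': "bounded_linear L" by (rule bounded_linear_adjoint_pair[OF K' L])
  define B where "B x = K (L x)" for x
  have B: "bounded_linear B" unfolding B_def by (rule bounded_linear_compose[OF K' L'])
  have B_inner: "inner (B x) y = inner (L x) (L y)" for x y by (simp add: B_def L)
  have lB: "eigenvalue_sequence B l" using l by (simp add: L_def B_def[abs_def] o_def)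
  obtain C where C: "C \<ge> 0" "\<And>u k. (inner (K u) (hartley_basis k))\<^sup>2 \<le> C * sobolev_weight (- t) k * (norm u)\<^sup>2"
    using bounded_linear_sobolev_coefficients[OF K] by blast
  obtain D where D: "\<And>x. norm (L x) \<le> norm x * D"
    using bounded_linear.bounded[OF L'] by blast
  have compact: "compact (closure (B ` cball 0 1))"
  proof (rule compact_image_of_ball[OF orthonormal_hartley_basis hartley_basis_complete])
    show "(\<lambda>k::int^'d. (C * D\<^sup>2) * sobolev_weight (- t) k) summable_on UNIV"
      by (intro summable_on_cmult_right sobolev_weight_summable t)
    fix x k
    have "(inner (B x) (hartley_basis k))\<^sup>2 \<le> C * sobolev_weight (- t) k * (norm (L x))\<^sup>2"
      unfolding B_def by (rule C(2))
    also have "\<dots> \<le> C * sobolev_weight (- t) k * (norm x * D)\<^sup>2"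
      using C(1) less_imp_le[OF sobolev_weight_pos[of "- t" k]]
      by (intro mult_left_mono power_mono D) auto
    finally show "(inner (B x) (hartley_basis k))\<^sup>2 \<le> (C * D\<^sup>2) * sobolev_weight (- t) k * (norm x)\<^sup>2"
      by (simp add: power_mult_distrib mult_ac)
  qed
  have selfadj: "inner (B x) y = inner x (B y)" and pos: "0 \<le> inner (B x) x" for x y
    by (simp_all add: B_inner inner_commute[of x "B y"] inner_commute[of "L y"])
  obtain J v where on: "orthonormal_on J v"
    and J: "\<forall>j\<in>J. B (v j) = l j *\<^sub>R v j \<and> l j > 0"
    and J_complete: "\<forall>x. (\<forall>j\<in>J. inner x (v j) = 0) \<longrightarrow> inner (B x) x = 0"
    using eigenvalue_sequence_orthonormal_basis[OF B compact selfadj pos lB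
        finite_level_sets_if_summable_powr[OF sum]] by blast
  have eig: "B (v j) = l j *\<^sub>R v j" and lpos: "l j > 0" if "j \<in> J" for j
    using J that by auto
  have perp: "inner (B x) x = 0" if "\<And>j. j \<in> J \<Longrightarrow> inner x (v j) = 0" for x
    using J_complete that by blast
  \<comment> \<open>a preimage of \<open>v j\<close> under \<open>K\<close>, which makes \<open>v j\<close> an admissible test element for the noise\<close>
  define g where "g j = (1 / l j) *\<^sub>R L (v j)" for j
  have Kg: "K (g j) = v j" if "j \<in> J" for j
    using eig[OF that] lpos[OF that] by (simp add: g_def B_def linear_scale[OF lin])
  have "\<exists>Z. Z \<in> borel_measurable M \<and> (AE \<omega> in M. Z \<omega> = noise_functional K (N \<omega>) (g j)) \<and>
      (\<integral>\<^sup>+\<omega>. ennreal ((Z \<omega>)\<^sup>2) \<partial>M) \<le> ennreal 1" if "j \<in> J" for j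
  proof -
    have "(norm (K (g j)))\<^sup>2 = 1"
      using on that by (simp add: Kg orthonormal_on_def power2_norm_eq_inner)
    then have "((\<lambda>k. (inner (K (g j)) (hartley_basis k))\<^sup>2) has_sum 1) UNIV"
      using hartley_parseval(1)[of "K (g j)"] by simp
    then show ?thesis
      unfolding noise_functional_def Bex_def[symmetric]
      by (rule gaussian_white_noise_functional[OF N t bounded_linear_sobolev_weighted_summable[OF K]])
  qed
  then have "\<forall>j\<in>J. \<exists>Z. Z \<in> borel_measurable M \<and> (AE \<omega> in M. Z \<omega> = noise_functional K (N \<omega>) (g j)) \<and>
      (\<integral>\<^sup>+\<omega>. ennreal ((Z \<omega>)\<^sup>2) \<partial>M) \<le> ennreal 1"
    by blast
  from bchoice[OF this] obtain Z where Z: "\<And>j. j \<in> J \<Longrightarrow> Z j \<in> borel_measurable M"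
    "\<And>j. j \<in> J \<Longrightarrow> AE \<omega> in M. Z j \<omega> = noise_functional K (N \<omega>) (g j)"
    "\<And>j. j \<in> J \<Longrightarrow> (\<integral>\<^sup>+\<omega>. ennreal ((Z j \<omega>)\<^sup>2) \<partial>M) \<le> ennreal 1"
    by blast
  define f where "f j \<omega> = (if j \<in> J then l j * (\<delta> * Z j \<omega> - \<alpha> * inner w (v j))\<^sup>2 / (l j + \<alpha>)\<^sup>2 else 0)" for j \<omega>
  have f_meas[measurable]: "f j \<in> borel_measurable M" for j
  proof (cases "j \<in> J")
    case True
    note [measurable] = Z(1)[OF True]
    from True show ?thesis unfolding f_def[abs_def] by simp
  qed (simp add: f_def[abs_def])
  have f_nonneg: "0 \<le> f j \<omega>" for j \<omega>
    using lpos[of j] by (auto simp: f_def less_imp_le)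
  have sums: "AE \<omega> in M. (\<lambda>j. f j \<omega>) sums (norm (U \<omega> - u))\<^sup>2"
  proof -
    have "AE \<omega> in M. \<forall>j\<in>J. Z j \<omega> = noise_functional K (N \<omega>) (g j)"
      using Z(2) by (intro AE_ball_countable') auto
    moreover note gaussian_white_noise_AE_weighted_summable[OF N t] U
    moreover have "AE \<omega> in M. N \<omega> \<in> torus_distributions"
      using N by (intro AE_I2) (simp add: gaussian_white_noise_def)
    ultimately show ?thesis
    proof eventually_elim
      case (elim \<omega>)
      have "L2_distr (K u) \<in> sobolev t" using K by (simp add: bounded_linear_sobolev_def)
      then have "noisy_data K u \<delta> (N \<omega>) \<in> sobolev (- t)"
        by (intro noisy_data_sobolev \<open>t \<ge> 0\<close> elim)
      with elim have min: "is_arg_min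
          (variational_functional K quadratic_penalty \<alpha> (noisy_data K u \<delta> (N \<omega>))) (\<lambda>_. True) (U \<omega>)"
        by blast
      have zero: "noise_functional K (N \<omega>) h = 0" if "K h = 0" for h
        using that by (simp add: noise_functional_def)
      have "((\<lambda>j. l j * (\<delta> * noise_functional K (N \<omega>) (g j) - \<alpha> * inner w (v j))\<^sup>2 / (l j + \<alpha>)\<^sup>2)
          has_sum (norm (U \<omega> - u))\<^sup>2) J"
        unfolding g_def
        by (rule spectral_error_expansion[OF lin L on eig[unfolded B_def] lpos perp[unfolded B_def]
              linear_noise_functional[OF K elim(2)] zero \<open>\<alpha> > 0\<close>
              tikhonov_error_equation[OF K \<open>t \<ge> 0\<close> elim(4,2) L u[folded L_def] min]])
      from has_sum_nat_imp_sums[OF this] show ?case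
        using elim(1) by (simp add: f_def cong: if_cong)
    qed
  qed
  define c where "c j = 2 * \<delta>\<^sup>2 * \<alpha> powr (- 1 - m) * l j powr m
      + 2 * \<alpha> * (if j \<in> J then (inner w (v j))\<^sup>2 else 0)" for j
  have c_nonneg: "0 \<le> c j" for j using \<open>\<alpha> > 0\<close> by (simp add: c_def)
  have f_le: "(\<integral>\<^sup>+\<omega>. ennreal (f j \<omega>) \<partial>M) \<le> ennreal (c j)" for j
  proof (cases "j \<in> J")
    case True
    note l0 = lpos[OF True] and [measurable] = Z(1)[OF True]
    define a where "a = 2 * \<delta>\<^sup>2 * (l j / (l j + \<alpha>)\<^sup>2)"
    define b where "b = 2 * (inner w (v j))\<^sup>2 * (l j * \<alpha>\<^sup>2 / (l j + \<alpha>)\<^sup>2)"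
    have ab: "0 \<le> a" "0 \<le> b" using l0 by (simp_all add: a_def b_def)
    have "f j \<omega> \<le> a * (Z j \<omega>)\<^sup>2 + b" for \<omega>
    proof -
      have "(\<delta> * Z j \<omega> - \<alpha> * inner w (v j))\<^sup>2 \<le> 2 * (\<delta> * Z j \<omega>)\<^sup>2 + 2 * (\<alpha> * inner w (v j))\<^sup>2"
        using zero_le_power2[of "\<delta> * Z j \<omega> + \<alpha> * inner w (v j)"] by (simp add: power2_sum power2_diff)
      then have "l j / (l j + \<alpha>)\<^sup>2 * (\<delta> * Z j \<omega> - \<alpha> * inner w (v j))\<^sup>2
          \<le> l j / (l j + \<alpha>)\<^sup>2 * (2 * (\<delta> * Z j \<omega>)\<^sup>2 + 2 * (\<alpha> * inner w (v j))\<^sup>2)"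
        using l0 by (intro mult_left_mono) auto
      also have "\<dots> = a * (Z j \<omega>)\<^sup>2 + b"
        by (simp add: a_def b_def power_mult_distrib algebra_simps)
      finally show ?thesis using True by (simp add: f_def)
    qed
    then have "(\<integral>\<^sup>+\<omega>. ennreal (f j \<omega>) \<partial>M) \<le> (\<integral>\<^sup>+\<omega>. ennreal a * ennreal ((Z j \<omega>)\<^sup>2) + ennreal b \<partial>M)"
      using ab by (intro nn_integral_mono) (simp flip: ennreal_mult ennreal_plus add: ennreal_leI)
    also have "\<dots> = ennreal a * (\<integral>\<^sup>+\<omega>. ennreal ((Z j \<omega>)\<^sup>2) \<partial>M) + ennreal b"
      by (simp add: nn_integral_add nn_integral_cmult emeasure_space_1)
    also have "\<dots> \<le> ennreal a * ennreal 1 + ennreal b"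
      by (intro add_right_mono mult_left_mono Z(3)[OF True]) simp
    also have "\<dots> = ennreal (a + b)" using ab by simp
    also have "\<dots> \<le> ennreal (c j)"
    proof (intro ennreal_leI)
      have "a \<le> 2 * \<delta>\<^sup>2 * (\<alpha> powr (- 1 - m) * l j powr m)"
        unfolding a_def by (intro mult_left_mono spectral_filter_bounds(1) l0 \<open>\<alpha> > 0\<close> m) simp
      moreover have "b \<le> 2 * (inner w (v j))\<^sup>2 * \<alpha>"
        unfolding b_def by (intro mult_left_mono spectral_filter_bounds(2)[OF l0 \<open>\<alpha> > 0\<close> m]) simp
      ultimately show "a + b \<le> c j" using True by (simp add: c_def mult_ac)
    qed
    finally show ?thesis .
  qed (simp add: f_def)
  define R where "R = 2 * \<delta>\<^sup>2 * \<alpha> powr (- 1 - m) * (\<Sum>j. l j powr m)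
      + 2 * \<alpha> * (\<Sum>\<^sub>\<infinity>j\<in>J. (inner w (v j))\<^sup>2)"
  have "c sums R"
    unfolding c_def[abs_def] R_def
    by (intro sums_add sums_mult summable_sums[OF sum] has_sum_nat_imp_sums has_sum_infsum
        bessel_summable(1)[OF on])
  have int_le: "(\<integral>\<^sup>+\<omega>. ennreal ((norm (U \<omega> - u))\<^sup>2) \<partial>M) \<le> ennreal R"
  proof -
    have "(\<integral>\<^sup>+\<omega>. ennreal ((norm (U \<omega> - u))\<^sup>2) \<partial>M) = (\<integral>\<^sup>+\<omega>. (\<Sum>j. ennreal (f j \<omega>)) \<partial>M)"
      using sums by (intro nn_integral_cong_AE; eventually_elim)
        (simp add: suminf_ennreal2[OF f_nonneg] sums_iff)
    also have "\<dots> = (\<Sum>j. \<integral>\<^sup>+\<omega>. ennreal (f j \<omega>) \<partial>M)"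
      by (rule nn_integral_suminf) measurable
    also have "\<dots> \<le> (\<Sum>j. ennreal (c j))"
      by (intro suminf_le f_le) auto
    also have "\<dots> = ennreal R"
      using \<open>c sums R\<close> by (simp add: suminf_ennreal2[OF c_nonneg] sums_iff)
    finally show ?thesis .
  qed
  have "(\<lambda>\<omega>. (norm (U \<omega> - u))\<^sup>2) \<in> borel_measurable M"
  proof (rule borel_measurable_if_AE_eq)
    show "(\<lambda>\<omega>. \<Sum>j. f j \<omega>) \<in> borel_measurable M" by measurable
    show "AE \<omega> in M. (norm (U \<omega> - u))\<^sup>2 = (\<Sum>j. f j \<omega>)"
      using sums by eventually_elim (simp add: sums_iff)
  qed
  then show int: "integrable M (\<lambda>\<omega>. (norm (U \<omega> - u))\<^sup>2)"
    using le_less_trans[OF int_le ennreal_less_top] by (intro integrableI_nonneg) auto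
  have "R \<ge> 0" using \<open>c sums R\<close> c_nonneg by (metis sums_unique suminf_nonneg sums_summable)
  then have "(LINT \<omega>|M. (norm (U \<omega> - u))\<^sup>2) \<le> R"
    using int_le int by (simp add: nn_integral_eq_integral)
  also have "\<dots> \<le> 2 * \<delta>\<^sup>2 * \<alpha> powr (- 1 - m) * (\<Sum>j. l j powr m) + 2 * \<alpha> * (norm w)\<^sup>2"
    unfolding R_def using \<open>\<alpha> > 0\<close> by (intro add_left_mono mult_left_mono bessel_summable(2)[OF on]) simp
  finally show "(LINT \<omega>|M. (norm (U \<omega> - u))\<^sup>2)
      \<le> 2 * \<delta>\<^sup>2 * \<alpha> powr (- 1 - m) * (\<Sum>j. l j powr m) + 2 * \<alpha> * (norm w)\<^sup>2" .
qed

text \<open>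
  With \<open>\<kappa> = 2 / (2 + m)\<close> one has \<open>2 - \<kappa> * (1 + m) = \<kappa>\<close>, so for \<open>\<alpha>\<close> of order \<open>\<delta> powr \<kappa>\<close> both terms
  have this order.
\<close>

lemma tikhonov_rate_balance:
  fixes \<alpha> :: "real \<Rightarrow> real"
  assumes "m > 0" and \<alpha>: "\<alpha> \<in> \<Theta>[at_right 0](\<lambda>\<delta>. \<delta> powr (2 / (2 + m)))"
    and \<alpha>_pos: "\<And>\<delta>. \<delta> > 0 \<Longrightarrow> \<alpha> \<delta> > 0" and "A \<ge> 0" "B \<ge> 0"
    and E: "\<And>\<delta>. \<delta> > 0 \<Longrightarrow> 0 \<le> E \<delta>"
      "\<And>\<delta>. \<delta> > 0 \<Longrightarrow> E \<delta> \<le> A * \<delta>\<^sup>2 * \<alpha> \<delta> powr (- 1 - m) + B * \<alpha> \<delta>"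
  shows "E \<in> O[at_right 0](\<lambda>\<delta>. \<delta> powr (2 / (2 + m)))"
proof -
  let ?\<kappa> = "2 / (2 + m)"
  obtain c1 where c1: "c1 > 0" "\<forall>\<^sub>F \<delta> in at_right 0. norm (\<alpha> \<delta>) \<ge> c1 * norm (\<delta> powr ?\<kappa>)"
    using landau_omega.bigE[OF bigthetaD2[OF \<alpha>]] by blast
  obtain c2 where c2: "c2 > 0" "\<forall>\<^sub>F \<delta> in at_right 0. norm (\<alpha> \<delta>) \<le> c2 * norm (\<delta> powr ?\<kappa>)"
    using landau_o.bigE[OF bigthetaD1[OF \<alpha>]] by blast
  have "\<forall>\<^sub>F \<delta> :: real in at_right 0. \<delta> > 0" by (rule eventually_at_right_less)
  with c1(2) c2(2)
  have "\<forall>\<^sub>F \<delta> in at_right 0. norm (E \<delta>) \<le> (A * c1 powr (- 1 - m) + B * c2) * norm (\<delta> powr ?\<kappa>)"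
  proof eventually_elim
    case (elim \<delta>)
    then have lower: "c1 * \<delta> powr ?\<kappa> \<le> \<alpha> \<delta>" and upper: "\<alpha> \<delta> \<le> c2 * \<delta> powr ?\<kappa>"
      using \<alpha>_pos[of \<delta>] by auto
    have "\<delta>\<^sup>2 * \<alpha> \<delta> powr (- 1 - m) \<le> \<delta>\<^sup>2 * (c1 * \<delta> powr ?\<kappa>) powr (- 1 - m)"
      using lower \<open>c1 > 0\<close> \<open>\<delta> > 0\<close> \<open>m > 0\<close> by (intro mult_left_mono powr_mono2') auto
    also have "\<dots> = c1 powr (- 1 - m) * (\<delta> powr 2 * \<delta> powr (?\<kappa> * (- 1 - m)))"
      using \<open>c1 > 0\<close> \<open>\<delta> > 0\<close> by (simp add: powr_mult powr_powr)
    also have "\<delta> powr 2 * \<delta> powr (?\<kappa> * (- 1 - m)) = \<delta> powr ?\<kappa>"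
    proof -
      have "2 + ?\<kappa> * (- 1 - m) = ?\<kappa>" using \<open>m > 0\<close> by (simp add: field_simps)
      then show ?thesis by (simp flip: powr_add)
    qed
    finally have "A * (\<delta>\<^sup>2 * \<alpha> \<delta> powr (- 1 - m)) \<le> A * (c1 powr (- 1 - m) * \<delta> powr ?\<kappa>)"
      using \<open>A \<ge> 0\<close> by (rule mult_left_mono)
    moreover have "B * \<alpha> \<delta> \<le> B * (c2 * \<delta> powr ?\<kappa>)"
      using \<open>B \<ge> 0\<close> upper by (intro mult_left_mono)
    ultimately show ?case
      using E[OF \<open>\<delta> > 0\<close>] by (simp add: algebra_simps)
  qed
  then show ?thesis by (rule bigoI)
qed

theorem theorem4p3:
  fixes K :: "'d::finite torus_L2 \<Rightarrow> 'd torus_L2"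
    and t m :: real
    and M :: "'w measure"
    and N :: "'w \<Rightarrow> (real^'d \<Rightarrow> real) \<Rightarrow> real"
    and u_true \<mu>_true w_true :: "'d torus_L2"
    and \<alpha> :: "real \<Rightarrow> real"
    and U \<mu> :: "real \<Rightarrow> 'w \<Rightarrow> 'd torus_L2"
    and eig :: "nat \<Rightarrow> real"
  assumes "t > real CARD('d) / 2"
    and "bounded_linear_sobolev t K"
    and "prob_space M" and "complete_measure M"
    and "gaussian_white_noise M N"
    and "eigenvalue_sequence (K \<circ> adjoint K) eig"
    and "0 < m" and "m \<le> 1"
    and "summable (\<lambda>j. eig j powr m)"
    and "\<mu>_true \<in> subdifferential quadratic_penalty u_true"
    and "\<mu>_true = adjoint K w_true"
    and "\<And>\<delta>. \<delta> > 0 \<Longrightarrow> \<alpha> \<delta> > 0"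
    and "\<alpha> \<in> \<Theta>[at_right 0](\<lambda>\<delta>. \<delta> powr (2 / (2 + m)))"
    and "\<And>\<delta>. \<delta> > 0 \<Longrightarrow> AE \<omega> in M. noisy_data K u_true \<delta> (N \<omega>) \<in> sobolev (- t) \<longrightarrow>
           is_arg_min
             (variational_functional K quadratic_penalty (\<alpha> \<delta>) (noisy_data K u_true \<delta> (N \<omega>)))
             (\<lambda>_. True) (U \<delta> \<omega>)"
    and "\<And>\<delta>. \<delta> > 0 \<Longrightarrow> AE \<omega> in M. \<mu> \<delta> \<omega> \<in> subdifferential quadratic_penalty (U \<delta> \<omega>)"
  shows "(\<forall>\<delta>>0.
      integrable M (\<lambda>\<omega>. sym_bregman (\<mu> \<delta> \<omega>) \<mu>_true (U \<delta> \<omega>) u_true) \<and>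
      integrable M (\<lambda>\<omega>. (norm (U \<delta> \<omega> - u_true))\<^sup>2) \<and>
      (LINT \<omega>|M. sym_bregman (\<mu> \<delta> \<omega>) \<mu>_true (U \<delta> \<omega>) u_true) =
      (LINT \<omega>|M. (norm (U \<delta> \<omega> - u_true))\<^sup>2)) \<and>
    (\<lambda>\<delta>. LINT \<omega>|M. (norm (U \<delta> \<omega> - u_true))\<^sup>2)
      \<in> O[at_right 0](\<lambda>\<delta>. \<delta> powr (2 / (2 + m)))"
proof -
  interpret M: complete_measure M by fact
  have \<mu>_true: "\<mu>_true = u_true"
    using assms(10) by (simp add: subdifferential_quadratic_penalty)
  with assms(11) have source: "u_true = adjoint K w_true" by simp
  let ?err = "\<lambda>\<delta> \<omega>. (norm (U \<delta> \<omega> - u_true))\<^sup>2"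
  let ?breg = "\<lambda>\<delta> \<omega>. sym_bregman (\<mu> \<delta> \<omega>) \<mu>_true (U \<delta> \<omega>) u_true"
  let ?S = "\<Sum>j. eig j powr m"
  have int: "integrable M (?err \<delta>)"
    and bound: "(LINT \<omega>|M. ?err \<delta> \<omega>)
      \<le> (2 * ?S) * \<delta>\<^sup>2 * \<alpha> \<delta> powr (- 1 - m) + (2 * (norm w_true)\<^sup>2) * \<alpha> \<delta>" if "\<delta> > 0" for \<delta>
    using expected_tikhonov_error_bound[OF assms(1-9) source assms(12)[OF that] assms(14)[OF that]]
    by (simp_all add: mult_ac)
  have breg: "integrable M (?breg \<delta>) \<and> (LINT \<omega>|M. ?breg \<delta> \<omega>) = (LINT \<omega>|M. ?err \<delta> \<omega>)" if "\<delta> > 0" for \<delta>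
  proof -
    have AE: "AE \<omega> in M. ?breg \<delta> \<omega> = ?err \<delta> \<omega>"
      using assms(15)[OF that]
      by eventually_elim
        (simp add: subdifferential_quadratic_penalty sym_bregman_def \<mu>_true power2_norm_eq_inner)
    note meas = borel_measurable_integrable[OF int[OF that]]
    have meas': "?breg \<delta> \<in> borel_measurable M"
      by (rule M.borel_measurable_if_AE_eq[OF meas AE])
    show ?thesis
      using integrable_cong_AE[OF meas' meas AE] integral_cong_AE[OF meas' meas AE] int[OF that] by simp
  qed
  have "(\<lambda>\<delta>. LINT \<omega>|M. ?err \<delta> \<omega>) \<in> O[at_right 0](\<lambda>\<delta>. \<delta> powr (2 / (2 + m)))"
  proof (rule tikhonov_rate_balance[OF assms(7) assms(13) assms(12)])
    show "0 \<le> 2 * ?S" using assms(9) by (simp add: suminf_nonneg)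
    show "0 \<le> 2 * (norm w_true)\<^sup>2" by simp
    show "0 \<le> (LINT \<omega>|M. ?err \<delta> \<omega>)" for \<delta> by simp
  qed (auto intro: bound)
  with int breg show ?thesis by blast
qed

end
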